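(* Let $\Theta\in(0,2\pi)$ and $\kappa=\frac{\sin\Theta}{1-\cos\Theta}$. For $\sigma\in[0,1]$, a finite interval $I\subseteq\mathbb R$ containing at least one $E_j$, and a solution $\mu$ of $$\sum_{E_j\in I}\frac{|\Phi_j(p)|^2}{E_j-\mu}=\sigma\sum_{E_j\in I}(E_j-\kappa)\frac{|\Phi_j(p)|^2}{1+E_j^2},$$ let $$\psi=\sum_{E_j\in I}\frac{\overline{\Phi_j(p)}}{E_j-\mu}\Phi_j+\sigma\sum_{E_j\notin I}(E_j-\kappa)\frac{\overline{\Phi_j(p)}}{1+E_j^2}\Phi_j\in\mathrm{Dom}(H_\Theta),$$ and let $d=\|(H_\Theta-\mu)\psi\|/\|\psi\|$ be the discrepancy of the quasimode $(\psi,\mu)$ of $H_\Theta$. (1) Let $\sigma=1$ and let $I=[0,T]$ where $T>E_1$. Then the discrepancy $d$ of the quasimode $\psi$ satisfies $$d\ll\frac{\mu}{\sqrt T}.$$ (2) Let $\sigma=0$ and let $I$ be any (finite) interval containing at least two of the $E_j$. If $\mu\in I$, then $d\le\frac1{\sqrt2}\ell(I)$, where $\ell(I)$ is the length of $I$. (3) If, in addition to the hypotheses of (2), $I$ contains precisely two of the $E_j$, then $d\le\frac12\ell(I)$.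
   Context: Notation. $f\ll g$ means that there exists a positive constant $C$ (the implied constant) such that $f\le Cg$. Setting. $\mathcal M$ is a compact 2-dimensional Riemannian manifold, possibly with piecewise-smooth boundary, $\Delta$ is a self-adjoint Laplacian on $\mathcal M$ with $-\Delta\ge0$, and $p\in\mathcal M$ is a fixed point. $\|\cdot\|$ and $\langle\cdot,\cdot\rangle$ are the norm and inner product (linear in the first argument) of $L^2(\mathcal M)$. $-\Delta$ has an orthonormal basis of eigenfunctions. In each eigenspace the orthonormal basis is chosen so that at most one basis element is nonzero at $p$; basis eigenfunctions vanishing at $p$ are discarded, and the remaining ones are denoted $\Phi_j$, with eigenvalues $E_1<E_2<E_3<\cdots$ (so $\Phi_j(p)\neq0$ and each $E_j$ is listed once). Weyl's law is a standing fact: $N(E):=\sum_{E_j\le E}|\Phi_j(p)|^2=\frac{E}{4\pi}+O(E^{1/2})$. All sums over $E_j\in I$ or $E_j\notin I$ run over this list. The operator $H_\Theta$. Let $g_{\pm i}:=\sum_{j\ge1}\frac{\overline{\Phi_j(p)}}{E_j\mp i}\Phi_j\in L^2(\mathcal M)$, $\mathcal D_p:=\{f\in\mathrm{Dom}(\Delta): f(p)=0\}$, and let $H_0$ be the symmetric operator $f\mapsto-\Delta f$ with domain $\mathcal D_p$. Its deficiency subspaces are spanned by $g_{i}$ and $g_{-i}$, so $\mathrm{Dom}(H_0^* )=\mathcal D_p\oplus\mathrm{span}\{g_i,g_{-i}\}$; every $\psi\in\mathrm{Dom}(H_0^* )$ is uniquely $\psi=\hat\psi+a_+(\psi)g_i+a_-(\psi)g_{-i}$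 with $\hat\psi\in\mathcal D_p$, $a_\pm(\psi)\in\mathbb C$, and $H_0^*\psi=H_0\hat\psi+i\,a_+(\psi)g_i-i\,a_-(\psi)g_{-i}$. $H_\Theta$ is the self-adjoint restriction of $H_0^*$ to $\mathrm{Dom}(H_\Theta)=\{\psi\in\mathrm{Dom}(H_0^* ): a_-(\psi)=-e^{i\Theta}a_+(\psi)\}$. A quasimode of a self-adjoint operator $H$ with discrepancy $d$ is a pair $(\psi,\mu)\in\mathrm{Dom}(H)\times\mathbb R$ with $\|(H-\mu)\psi\|\le d\|\psi\|$.
   Formalization: In (1) the bound is stated for solutions 0 < μ ≤ B, with implied constant depending on B (uniform in T); as written it fails for μ ≤ 0 and, on the round sphere, uniformly in large μ. *)

theory Defs
  imports "HOL-Analysis.Analysis" "HOL-Library.Landau_Symbols"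
begin

section \<open>Compact Riemannian surfaces with piecewise smooth boundary\<close>

text \<open>For open \<open>S\<close>: continuous differentiability of order \<open>k\<close>, and smoothness.\<close>

primrec cont_diff_on ::
  "nat \<Rightarrow> 'a::euclidean_space set \<Rightarrow> ('a \<Rightarrow> 'b::real_normed_vector) \<Rightarrow> bool" where
  "cont_diff_on 0 S f \<longleftrightarrow> continuous_on S f"
| "cont_diff_on (Suc k) S f \<longleftrightarrow>
     (\<exists>D. (\<forall>x\<in>S. (f has_derivative D x) (at x)) \<and> (\<forall>v. cont_diff_on k S (\<lambda>x. D x v)))"

definition smooth_on :: "'a::euclidean_space set \<Rightarrow> ('a \<Rightarrow> 'b::real_normed_vector) \<Rightarrow> bool" where
  "smooth_on S f \<longleftrightarrow> (\<forall>k. cont_diff_on k S f)"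

text \<open>
  The ambient surface is a whole type \<open>'a\<close>; the manifold \<open>\<M>\<close> of the theorem is a compact
  subset \<open>M\<close> of it. This covers closed surfaces (\<open>M = UNIV\<close>) as well as surfaces with boundary,
  which sit in an open surface without boundary.
\<close>

type_synonym 'a chart = "'a set \<times> ('a \<Rightarrow> real^2)"

definition chart_inv :: "'a chart \<Rightarrow> real^2 \<Rightarrow> 'a" where
  "chart_inv c = inv_into (fst c) (snd c)"

definition smooth_atlas :: "'a::topological_space chart set \<Rightarrow> bool" where
  "smooth_atlas \<A> \<longleftrightarrow>
     (\<Union>c\<in>\<A>. fst c) = UNIV \<and>
     (\<forall>c\<in>\<A>. open (fst c) \<and> open (snd c ` fst c) \<and>
              homeomorphism (fst c) (snd c ` fst c) (snd c) (chart_inv c)) \<and>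
     (\<forall>c\<in>\<A>. \<forall>c'\<in>\<A>. smooth_on (snd c ` (fst c \<inter> fst c')) (snd c' \<circ> chart_inv c))"

text \<open>\<open>G c z\<close> is the Gram matrix of the metric in the chart \<open>c\<close> at the coordinate point \<open>z\<close>.\<close>

definition riemannian_metric ::
  "'a::topological_space chart set \<Rightarrow> ('a chart \<Rightarrow> real^2 \<Rightarrow> real^2^2) \<Rightarrow> bool" where
  "riemannian_metric \<A> G \<longleftrightarrow>
     (\<forall>c\<in>\<A>. smooth_on (snd c ` fst c) (G c)) \<and>
     (\<forall>c\<in>\<A>. \<forall>z\<in>snd c ` fst c.
        transpose (G c z) = G c z \<and> (\<forall>v. v \<noteq> 0 \<longrightarrow> 0 < v \<bullet> (G c z *v v))) \<and>
     (\<forall>c\<in>\<A>. \<forall>c'\<in>\<A>. \<forall>q\<in>fst c \<inter> fst c'.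
        let J = matrix (frechet_derivative (snd c' \<circ> chart_inv c) (at (snd c q)))
        in G c (snd c q) = transpose J ** G c' (snd c' q) ** J)"

definition riemannian_volume ::
  "'a::topological_space chart set \<Rightarrow> ('a chart \<Rightarrow> real^2 \<Rightarrow> real^2^2) \<Rightarrow> 'a measure \<Rightarrow> bool" where
  "riemannian_volume \<A> G vol \<longleftrightarrow>
     sets vol = sets borel \<and>
     (\<forall>c\<in>\<A>. \<forall>B\<in>sets borel. B \<subseteq> fst c \<longrightarrow>
        emeasure vol B = (\<integral>\<^sup>+ z \<in> snd c ` B. ennreal (sqrt (det (G c z))) \<partial>lborel))"

definition smooth_arc :: "'a::topological_space chart set \<Rightarrow> (real \<Rightarrow> 'a) \<Rightarrow> bool" where
  "smooth_arc \<A> \<gamma> \<longleftrightarrow>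
     inj_on \<gamma> {0..1} \<and>
     (\<forall>t\<in>{0..1}. \<forall>c\<in>\<A>. \<gamma> t \<in> fst c \<longrightarrow>
        (\<exists>e>0. \<gamma> ` ball t e \<subseteq> fst c \<and> smooth_on (ball t e) (snd c \<circ> \<gamma>) \<and>
               vector_derivative (snd c \<circ> \<gamma>) (at t) \<noteq> 0))"

text \<open>
  A topological surface with (possibly empty) boundary whose frontier consists of finitely many
  regular smooth arcs meeting only at end points. The condition \<open>M \<subseteq> closure (interior M)\<close> follows
  from the local condition by invariance of domain; it is listed for convenience.
\<close>

definition compact_surface_pw_smooth ::
  "'a::{t2_space,second_countable_topology} chart set \<Rightarrow> 'a set \<Rightarrow> bool" where
  "compact_surface_pw_smooth \<A> M \<longleftrightarrow>
     compact M \<and> M \<subseteq> closure (interior M) \<and>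
     (\<forall>q\<in>M. \<exists>W V. q \<in> W \<and> openin (top_of_set M) W \<and>
        openin (top_of_set {z::real^2. 0 \<le> z $ 1}) V \<and> W homeomorphic V) \<and>
     (\<exists>\<Gamma>. finite \<Gamma> \<and> (\<forall>\<gamma>\<in>\<Gamma>. smooth_arc \<A> \<gamma>) \<and> frontier M = (\<Union>\<gamma>\<in>\<Gamma>. \<gamma> ` {0..1}) \<and>
        (\<forall>\<gamma>\<in>\<Gamma>. \<forall>\<delta>\<in>\<Gamma>. \<gamma> \<noteq> \<delta> \<longrightarrow> \<gamma> ` {0..1} \<inter> \<delta> ` {0..1} \<subseteq> {\<gamma> 0, \<gamma> 1} \<inter> {\<delta> 0, \<delta> 1}))"

section \<open>The space $L^2$ and unbounded operators\<close>

text \<open>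
  Elements of $L^2$ are represented by functions, equality being equality almost everywhere.
  Operators are represented by their graphs.
\<close>

definition l2 :: "'a measure \<Rightarrow> ('a \<Rightarrow> complex) set" where
  "l2 m = {f. f \<in> borel_measurable m \<and> integrable m (\<lambda>x. (cmod (f x))\<^sup>2)}"

definition l2_inner :: "'a measure \<Rightarrow> ('a \<Rightarrow> complex) \<Rightarrow> ('a \<Rightarrow> complex) \<Rightarrow> complex" where
  "l2_inner m f g = (\<integral>x. f x * cnj (g x) \<partial>m)"

definition l2_norm :: "'a measure \<Rightarrow> ('a \<Rightarrow> complex) \<Rightarrow> real" where
  "l2_norm m f = sqrt (\<integral>x. (cmod (f x))\<^sup>2 \<partial>m)"

definition l2_sums ::
  "'a measure \<Rightarrow> (nat \<Rightarrow> complex) \<Rightarrow> (nat \<Rightarrow> 'a \<Rightarrow> complex) \<Rightarrow> ('a \<Rightarrow> complex) \<Rightarrow> bool" where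
  "l2_sums m c u f \<longleftrightarrow>
     f \<in> l2 m \<and> (\<lambda>n. l2_norm m (\<lambda>x. f x - (\<Sum>j<n. c j * u j x))) \<longlonglongrightarrow> 0"

definition l2_suminf ::
  "'a measure \<Rightarrow> (nat \<Rightarrow> complex) \<Rightarrow> (nat \<Rightarrow> 'a \<Rightarrow> complex) \<Rightarrow> 'a \<Rightarrow> complex" where
  "l2_suminf m c u = (SOME f. l2_sums m c u f)"

type_synonym 'a l2_op = "(('a \<Rightarrow> complex) \<times> ('a \<Rightarrow> complex)) set"

definition op_dom :: "'a l2_op \<Rightarrow> ('a \<Rightarrow> complex) set" where
  "op_dom T = fst ` T"

definition op_apply :: "'a l2_op \<Rightarrow> ('a \<Rightarrow> complex) \<Rightarrow> 'a \<Rightarrow> complex" where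
  "op_apply T f = (SOME h. (f, h) \<in> T)"

definition adjoint_op :: "'a measure \<Rightarrow> 'a l2_op \<Rightarrow> 'a l2_op" where
  "adjoint_op m T = {(\<psi>, \<eta>). \<psi> \<in> l2 m \<and> \<eta> \<in> l2 m \<and>
     (\<forall>(f, h)\<in>T. l2_inner m h \<psi> = l2_inner m f \<eta>)}"

definition densely_defined :: "'a measure \<Rightarrow> 'a l2_op \<Rightarrow> bool" where
  "densely_defined m T \<longleftrightarrow>
     (\<forall>f\<in>l2 m. \<forall>\<epsilon>>0. \<exists>u\<in>op_dom T. l2_norm m (\<lambda>x. f x - u x) < \<epsilon>)"

definition self_adjoint :: "'a measure \<Rightarrow> 'a l2_op \<Rightarrow> bool" where
  "self_adjoint m T \<longleftrightarrow> densely_defined m T \<and> adjoint_op m T = T"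

section \<open>Self-adjoint Laplacians\<close>

definition partial_deriv :: "2 \<Rightarrow> (real^2 \<Rightarrow> complex) \<Rightarrow> real^2 \<Rightarrow> complex" where
  "partial_deriv i f z = frechet_derivative f (at z) (axis i 1)"

text \<open>$\Delta f = |g|^{-1/2} \sum_{i,j} \partial_i (|g|^{1/2} g^{ij} \partial_j f)$ in the coordinates of
  the chart \<open>c\<close>.\<close>

definition laplace_beltrami ::
  "('a chart \<Rightarrow> real^2 \<Rightarrow> real^2^2) \<Rightarrow> 'a chart \<Rightarrow> ('a \<Rightarrow> complex) \<Rightarrow> 'a \<Rightarrow> complex" where
  "laplace_beltrami G c f q =
     (1 / sqrt (det (G c (snd c q)))) *\<^sub>R
     (\<Sum>i\<in>UNIV. partial_deriv i
        (\<lambda>w. \<Sum>j\<in>UNIV. (sqrt (det (G c w)) * matrix_inv (G c w) $ i $ j) *\<^sub>R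
                      partial_deriv j (f \<circ> chart_inv c) w)
        (snd c q))"

definition test_function ::
  "'a::topological_space chart set \<Rightarrow> 'a set \<Rightarrow> ('a \<Rightarrow> complex) \<Rightarrow> bool" where
  "test_function \<A> M f \<longleftrightarrow>
     (\<exists>K. compact K \<and> K \<subseteq> interior M \<and> (\<forall>q. q \<notin> K \<longrightarrow> f q = 0)) \<and>
     (\<forall>c\<in>\<A>. smooth_on (snd c ` fst c) (f \<circ> chart_inv c))"

text \<open>
  A self-adjoint Laplacian is a self-adjoint extension of the Laplace--Beltrami operator on the
  smooth functions with compact support in the interior (the choice of the extension is the choice
  of boundary conditions).
\<close>

definition self_adjoint_laplacian ::
  "'a::topological_space chart set \<Rightarrow> ('a chart \<Rightarrow> real^2 \<Rightarrow> real^2^2) \<Rightarrow> 'a measure \<Rightarrow>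
     'a l2_op \<Rightarrow> bool" where
  "self_adjoint_laplacian \<A> G m \<Delta> \<longleftrightarrow>
     self_adjoint m \<Delta> \<and>
     (\<forall>f. test_function \<A> (space m) f \<longrightarrow>
        (\<exists>h. (f, h) \<in> \<Delta> \<and>
          (\<forall>c\<in>\<A>. AE q in m. q \<in> fst c \<longrightarrow> h q = laplace_beltrami G c f q)))"

definition nonpositive_op :: "'a measure \<Rightarrow> 'a l2_op \<Rightarrow> bool" where
  "nonpositive_op m T \<longleftrightarrow> (\<forall>(f, h)\<in>T. Re (l2_inner m h f) \<le> 0)"

text \<open>
  The value at \<open>p\<close> of an element of $L^2$ is the value of a representative continuous at \<open>p\<close>.
  For a Laplacian on a surface such a representative exists for every element of the domain
  (elliptic regularity); this is what makes the condition \<open>f(p) = 0\<close> on the domain meaningful.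
\<close>

definition continuous_rep_at ::
  "'a::t2_space measure \<Rightarrow> 'a \<Rightarrow> ('a \<Rightarrow> complex) \<Rightarrow> ('a \<Rightarrow> complex) \<Rightarrow> bool" where
  "continuous_rep_at m p f f' \<longleftrightarrow>
     (AE x in m. f' x = f x) \<and> continuous (at p within space m) f'"

definition domain_evaluable_at :: "'a::t2_space measure \<Rightarrow> 'a \<Rightarrow> 'a l2_op \<Rightarrow> bool" where
  "domain_evaluable_at m p \<Delta> \<longleftrightarrow> (\<forall>f\<in>op_dom \<Delta>. \<exists>f'. continuous_rep_at m p f f')"

section \<open>Eigenfunctions\<close>

text \<open>Every eigenfunction is given by its representative that is continuous at \<open>p\<close>.\<close>

definition eigenbasis ::
  "'a::t2_space measure \<Rightarrow> 'a \<Rightarrow> 'a l2_op \<Rightarrow> (nat \<Rightarrow> 'a \<Rightarrow> complex) \<Rightarrow> (nat \<Rightarrow> real) \<Rightarrow> bool" where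
  "eigenbasis m p \<Delta> e ev \<longleftrightarrow>
     (\<forall>n. (e n, \<lambda>x. - (of_real (ev n) * e n x)) \<in> \<Delta> \<and> continuous (at p within space m) (e n)) \<and>
     (\<forall>n k. l2_inner m (e n) (e k) = (if n = k then 1 else 0)) \<and>
     (\<forall>f\<in>l2 m. l2_sums m (\<lambda>n. l2_inner m f (e n)) e f)"

text \<open>
  \<open>\<Phi>\<close>, \<open>E\<close> list the basis eigenfunctions not vanishing at \<open>p\<close> and their eigenvalues, starting with
  index 0 (so \<open>E 0\<close> is $E_1$). Strict monotonicity of \<open>E\<close> says in particular that at most one basis
  element of each eigenspace is nonzero at \<open>p\<close>.
\<close>

definition lists_nonvanishing ::
  "'a \<Rightarrow> (nat \<Rightarrow> 'a \<Rightarrow> complex) \<Rightarrow> (nat \<Rightarrow> real) \<Rightarrow> (nat \<Rightarrow> 'a \<Rightarrow> complex) \<Rightarrow> (nat \<Rightarrow> real) \<Rightarrow> bool" where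
  "lists_nonvanishing p e ev \<Phi> E \<longleftrightarrow>
     strict_mono E \<and>
     (\<exists>r. bij_betw r UNIV {n. e n p \<noteq> 0} \<and> (\<forall>j. \<Phi> j = e (r j) \<and> E j = ev (r j)))"

definition weyl_law :: "'a \<Rightarrow> (nat \<Rightarrow> 'a \<Rightarrow> complex) \<Rightarrow> (nat \<Rightarrow> real) \<Rightarrow> bool" where
  "weyl_law p \<Phi> E \<longleftrightarrow>
     (\<forall>x. finite {j. E j \<le> x}) \<and>
     (\<lambda>x. (\<Sum>j | E j \<le> x. (cmod (\<Phi> j p))\<^sup>2) - x / (4 * pi)) \<in> O(\<lambda>x. sqrt x)"

section \<open>The operator $H_\Theta$\<close>

definition dom_p :: "'a::t2_space measure \<Rightarrow> 'a \<Rightarrow> 'a l2_op \<Rightarrow> ('a \<Rightarrow> complex) set" where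
  "dom_p m p \<Delta> = {f \<in> op_dom \<Delta>. \<exists>f'. continuous_rep_at m p f f' \<and> f' p = 0}"

definition H_0 :: "'a::t2_space measure \<Rightarrow> 'a \<Rightarrow> 'a l2_op \<Rightarrow> 'a l2_op" where
  "H_0 m p \<Delta> = {(f, \<lambda>x. - h x) | f h. (f, h) \<in> \<Delta> \<and> f \<in> dom_p m p \<Delta>}"

text \<open>$g_{\pm i}$ is \<open>defect m p \<Phi> E (\<plusminus> \<i>)\<close>.\<close>

definition defect ::
  "'a measure \<Rightarrow> 'a \<Rightarrow> (nat \<Rightarrow> 'a \<Rightarrow> complex) \<Rightarrow> (nat \<Rightarrow> real) \<Rightarrow> complex \<Rightarrow> 'a \<Rightarrow> complex" where
  "defect m p \<Phi> E z = l2_suminf m (\<lambda>j. cnj (\<Phi> j p) / (of_real (E j) - z)) \<Phi>"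

definition H_Theta ::
  "'a::t2_space measure \<Rightarrow> 'a \<Rightarrow> 'a l2_op \<Rightarrow> (nat \<Rightarrow> 'a \<Rightarrow> complex) \<Rightarrow> (nat \<Rightarrow> real) \<Rightarrow> real \<Rightarrow>
     'a l2_op" where
  "H_Theta m p \<Delta> \<Phi> E \<Theta> =
     {(\<psi>, \<eta>) \<in> adjoint_op m (H_0 m p \<Delta>).
        \<exists>\<psi>'\<in>dom_p m p \<Delta>. \<exists>a_plus a_minus.
          (AE x in m. \<psi> x = \<psi>' x + a_plus * defect m p \<Phi> E \<i> x
                                 + a_minus * defect m p \<Phi> E (- \<i>) x) \<and>
          a_minus = - exp (\<i> * of_real \<Theta>) * a_plus}"

section \<open>Quasimodes\<close>

definition secular_solution ::
  "'a \<Rightarrow> (nat \<Rightarrow> 'a \<Rightarrow> complex) \<Rightarrow> (nat \<Rightarrow> real) \<Rightarrow> real \<Rightarrow> real \<Rightarrow> real set \<Rightarrow> real \<Rightarrow> bool" where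
  "secular_solution p \<Phi> E \<kappa> \<sigma> I \<mu> \<longleftrightarrow>
     (\<forall>j. E j \<in> I \<longrightarrow> E j \<noteq> \<mu>) \<and>
     (\<Sum>j | E j \<in> I. (cmod (\<Phi> j p))\<^sup>2 / (E j - \<mu>)) =
       \<sigma> * (\<Sum>j | E j \<in> I. (E j - \<kappa>) * (cmod (\<Phi> j p))\<^sup>2 / (1 + (E j)\<^sup>2))"

definition quasimode_fun ::
  "'a measure \<Rightarrow> 'a \<Rightarrow> (nat \<Rightarrow> 'a \<Rightarrow> complex) \<Rightarrow> (nat \<Rightarrow> real) \<Rightarrow> real \<Rightarrow> real \<Rightarrow> real set \<Rightarrow> real \<Rightarrow>
     'a \<Rightarrow> complex" where
  "quasimode_fun m p \<Phi> E \<kappa> \<sigma> I \<mu> = (\<lambda>x.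
     (\<Sum>j | E j \<in> I. cnj (\<Phi> j p) / of_real (E j - \<mu>) * \<Phi> j x) +
     of_real \<sigma> * l2_suminf m
       (\<lambda>j. if E j \<notin> I then of_real (E j - \<kappa>) * cnj (\<Phi> j p) / of_real (1 + (E j)\<^sup>2) else 0) \<Phi> x)"

definition discrepancy :: "'a measure \<Rightarrow> 'a l2_op \<Rightarrow> ('a \<Rightarrow> complex) \<Rightarrow> real \<Rightarrow> real" where
  "discrepancy m H \<psi> \<mu> =
     l2_norm m (\<lambda>x. op_apply H \<psi> x - of_real \<mu> * \<psi> x) / l2_norm m \<psi>"

end

theory Submission
  imports Defs
begin

text \<open>
  Every $f$ in the domain of $\Delta$ has a value $f(p)$, the limit of the averages of $f$ over
  shrinking neighbourhoods of $p$. These averages are bounded functionals, so by uniform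
  boundedness evaluation at $p$ is bounded in the graph norm, and
  $f(p) = \sum_j \langle f, \Phi_j\rangle \Phi_j(p)$. Hence $g_{\pm i}$ lies in the domain of the adjoint
  of $H_0$, and since $\sum_j |\Phi_j(p)|^2 = \infty$ by Weyl's law, that adjoint is
  single-valued. Since $\kappa = \cot(\Theta/2)$, the vector $g_i - e^{i\Theta} g_{-i}$ has the
  coefficients $(1 - e^{i\Theta}) (E_j - \kappa) \overline{\Phi_j(p)} / (1 + E_j^2)$, and the secular
  equation says that $\psi$ minus $\sigma / (1 - e^{i\Theta})$ times this vector vanishes at $p$.
  So $(H_\Theta - \mu) \psi$ has the coefficients $(1 - \sigma) \overline{\Phi_j(p)}$ for
  $E_j \in I$ and $-\sigma ((\kappa + \mu) E_j + 1 - \kappa \mu) \overline{\Phi_j(p)} / (1 + E_j^2)$ otherwise.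

  For $\sigma = 1$ Weyl's law bounds the square of its norm by a constant over $T$; the factor $\mu$ is
  harmless, because the positive solutions $\mu$ are bounded away from $0$ uniformly in $T$. For $\sigma = 0$
  let $\alpha = \mu - \min E_j$, $\beta = \max E_j - \mu$ and $y_j = 1/(E_j - \mu)$ with $E_j \in I$;
  averaging $(y_j - 1/\beta)(y_j + 1/\alpha) \ge 0$ with the weights $|\Phi_j(p)|^2$ gives
  $d^2 \le \alpha \beta \le (\alpha + \beta)^2/4$, so $d \le \ell(I)/2$ in (2) as well as in (3).
\<close>

section \<open>The space $L^2$\<close>

text \<open>The second sum in \<psi> is dictated by the domain of H_\<Theta>. The boundary vector
  g_i - e^(i \<Theta>) g_(-i) has coefficients of size |\<Phi>_j(p)|/E_j, which decay too slowly for
  the domain of \<Delta>. Copying its coefficients outside I leaves a finite sum as the remaining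
  part of \<psi>, whose value at p is explicit; requiring that value to be zero is the secular
  equation. The obstacle is that point values come without any estimate: each element of the domain
  merely has some representative continuous at p, whereas the adjoint of H_0 can be reached only
  through continuity of evaluation in the graph norm. Moreover L^2 consists of functions and
  \<open>op_apply\<close> selects one of many images, so no norm of (H_\<Theta> - \<mu>) \<psi> can
  be computed before images are known to be unique almost everywhere. In (1) the danger is a family
  of roots tending to 0 as T grows. If E_1 = 0, the pole at 0 repels them. If E_1 > 0, the
  difference of the two sides at \<mu> = 0 has to be kept away from 0 from below, uniformly in the
  number of terms.\<close>

lemma l2_measurable [measurable_dest]: "f \<in> l2 m \<Longrightarrow> f \<in> borel_measurable m"
  by (simp add: l2_def)

lemma l2_integrable: "f \<in> l2 m \<Longrightarrow> integrable m (\<lambda>x. (cmod (f x))\<^sup>2)"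
  by (simp add: l2_def)

lemma l2_bounded_by:
  assumes "f \<in> borel_measurable m" "integrable m g" "\<And>x. (cmod (f x))\<^sup>2 \<le> g x"
  shows "f \<in> l2 m"
proof -
  have "integrable m (\<lambda>x. (cmod (f x))\<^sup>2)"
    by (rule Bochner_Integration.integrable_bound[OF assms(2)])
       (use assms in \<open>auto intro!: order_trans[OF assms(3)]\<close>)
  then show ?thesis using assms by (simp add: l2_def)
qed

lemma cmod_add_sq_le: "(cmod (a + b))\<^sup>2 \<le> 2 * (cmod a)\<^sup>2 + 2 * (cmod b)\<^sup>2"
proof -
  have "(cmod (a + b))\<^sup>2 \<le> (cmod a + cmod b)\<^sup>2"
    by (intro power_mono norm_triangle_ineq) auto
  also have "\<dots> \<le> 2 * (cmod a)\<^sup>2 + 2 * (cmod b)\<^sup>2"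
    using zero_le_power2[of "cmod a - cmod b"] by (simp add: power2_eq_square algebra_simps)
  finally show ?thesis .
qed

lemma l2_zero [simp]: "(\<lambda>x. 0) \<in> l2 m"
  by (simp add: l2_def)

lemma borel_measurable_cnj [measurable]: "cnj \<in> borel_measurable borel"
  by (intro borel_measurable_continuous_onI continuous_intros)

lemma l2_cmult: "f \<in> l2 m \<Longrightarrow> (\<lambda>x. c * f x) \<in> l2 m"
  by (auto simp: l2_def norm_mult power_mult_distrib)

lemma l2_add:
  assumes "f \<in> l2 m" "g \<in> l2 m"
  shows "(\<lambda>x. f x + g x) \<in> l2 m"
  by (rule l2_bounded_by[where g="\<lambda>x. 2 * (cmod (f x))\<^sup>2 + 2 * (cmod (g x))\<^sup>2"])
     (use assms in \<open>auto simp: l2_def cmod_add_sq_le\<close>)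

lemma l2_uminus: "f \<in> l2 m \<Longrightarrow> (\<lambda>x. - f x) \<in> l2 m"
  by (simp add: l2_def)

lemma l2_diff:
  assumes "f \<in> l2 m" "g \<in> l2 m"
  shows "(\<lambda>x. f x - g x) \<in> l2 m"
  using l2_add[OF assms(1) l2_uminus[OF assms(2)]] by simp

lemma l2_sum: "(\<And>i. i \<in> A \<Longrightarrow> f i \<in> l2 m) \<Longrightarrow> (\<lambda>x. \<Sum>i\<in>A. f i x) \<in> l2 m"
  by (induction A rule: infinite_finite_induct) (auto intro: l2_add)

lemmas l2_intros = l2_zero l2_cmult l2_add l2_diff l2_uminus l2_sum

lemma l2_inner_integrable:
  assumes "f \<in> l2 m" "g \<in> l2 m"
  shows "integrable m (\<lambda>x. f x * cnj (g x))"
proof (rule Bochner_Integration.integrable_bound)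
  show "integrable m (\<lambda>x. (cmod (f x))\<^sup>2 + (cmod (g x))\<^sup>2)"
    using assms by (auto simp: l2_def)
  show "(\<lambda>x. f x * cnj (g x)) \<in> borel_measurable m"
    using assms by measurable
  show "AE x in m. norm (f x * cnj (g x)) \<le> norm ((cmod (f x))\<^sup>2 + (cmod (g x))\<^sup>2)"
  proof (rule AE_I2)
    fix x
    have "2 * (cmod (f x) * cmod (g x)) \<le> (cmod (f x))\<^sup>2 + (cmod (g x))\<^sup>2"
      using zero_le_power2[of "cmod (f x) - cmod (g x)"]
      by (simp add: power2_eq_square algebra_simps)
    moreover have "0 \<le> cmod (f x) * cmod (g x)" by simp
    ultimately have "cmod (f x) * cmod (g x) \<le> (cmod (f x))\<^sup>2 + (cmod (g x))\<^sup>2" by linarith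
    then show "norm (f x * cnj (g x)) \<le> norm ((cmod (f x))\<^sup>2 + (cmod (g x))\<^sup>2)"
      by (simp add: norm_mult)
  qed
qed

lemma l2_inner_cnj: "l2_inner m g f = cnj (l2_inner m f g)"
  unfolding l2_inner_def
  by (subst Bochner_Integration.integral_cnj[symmetric]) (simp add: mult.commute)

lemma l2_inner_add_left:
  "\<lbrakk>f \<in> l2 m; g \<in> l2 m; h \<in> l2 m\<rbrakk> \<Longrightarrow>
    l2_inner m (\<lambda>x. f x + g x) h = l2_inner m f h + l2_inner m g h"
  unfolding l2_inner_def
  by (simp add: distrib_right Bochner_Integration.integral_add l2_inner_integrable)

lemma l2_inner_cmult_left [simp]: "l2_inner m (\<lambda>x. c * f x) h = c * l2_inner m f h"
  unfolding l2_inner_def by (simp add: mult.assoc)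

lemma l2_inner_uminus_left [simp]: "l2_inner m (\<lambda>x. - f x) h = - l2_inner m f h"
  unfolding l2_inner_def by simp

lemma l2_inner_zero_left [simp]: "l2_inner m (\<lambda>x. 0) h = 0"
  unfolding l2_inner_def by simp

lemma l2_inner_diff_left:
  "\<lbrakk>f \<in> l2 m; g \<in> l2 m; h \<in> l2 m\<rbrakk> \<Longrightarrow>
    l2_inner m (\<lambda>x. f x - g x) h = l2_inner m f h - l2_inner m g h"
  using l2_inner_add_left[of f m "\<lambda>x. - g x" h] by (simp add: l2_uminus)

lemma l2_inner_sum_left:
  "\<lbrakk>\<And>i. i \<in> A \<Longrightarrow> f i \<in> l2 m; h \<in> l2 m\<rbrakk> \<Longrightarrow>
    l2_inner m (\<lambda>x. \<Sum>i\<in>A. f i x) h = (\<Sum>i\<in>A. l2_inner m (f i) h)"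
  by (induction A rule: infinite_finite_induct) (auto simp: l2_inner_add_left l2_sum)

lemma l2_inner_add_right:
  "\<lbrakk>f \<in> l2 m; g \<in> l2 m; h \<in> l2 m\<rbrakk> \<Longrightarrow>
    l2_inner m h (\<lambda>x. f x + g x) = l2_inner m h f + l2_inner m h g"
  by (simp add: l2_inner_cnj[of m h] l2_inner_add_left)

lemma l2_inner_cmult_right [simp]: "l2_inner m h (\<lambda>x. c * f x) = cnj c * l2_inner m h f"
  by (simp add: l2_inner_cnj[of m h])

lemma l2_inner_uminus_right [simp]: "l2_inner m h (\<lambda>x. - f x) = - l2_inner m h f"
  by (simp add: l2_inner_cnj[of m h])

lemma l2_inner_zero_right [simp]: "l2_inner m h (\<lambda>x. 0) = 0"
  by (simp add: l2_inner_cnj[of m h])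

lemma l2_inner_diff_right:
  "\<lbrakk>f \<in> l2 m; g \<in> l2 m; h \<in> l2 m\<rbrakk> \<Longrightarrow>
    l2_inner m h (\<lambda>x. f x - g x) = l2_inner m h f - l2_inner m h g"
  by (simp add: l2_inner_cnj[of m h] l2_inner_diff_left)

lemma l2_inner_sum_right:
  "\<lbrakk>\<And>i. i \<in> A \<Longrightarrow> f i \<in> l2 m; h \<in> l2 m\<rbrakk> \<Longrightarrow>
    l2_inner m h (\<lambda>x. \<Sum>i\<in>A. f i x) = (\<Sum>i\<in>A. l2_inner m h (f i))"
  by (simp add: l2_inner_cnj[of m h] l2_inner_sum_left)

lemma l2_norm_nonneg [simp]: "0 \<le> l2_norm m f"
  by (simp add: l2_norm_def)

lemma l2_norm_power2: "(l2_norm m f)\<^sup>2 = (\<integral>x. (cmod (f x))\<^sup>2 \<partial>m)"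
  by (simp add: l2_norm_def)

lemma l2_inner_self: "l2_inner m f f = of_real ((l2_norm m f)\<^sup>2)"
  unfolding l2_inner_def l2_norm_power2
  by (subst integral_complex_of_real[symmetric]) (simp add: complex_norm_square[symmetric])

lemma l2_norm_cmult: "l2_norm m (\<lambda>x. c * f x) = cmod c * l2_norm m f"
  by (simp add: l2_norm_def norm_mult power_mult_distrib real_sqrt_mult)

lemma l2_norm_zero [simp]: "l2_norm m (\<lambda>x. 0) = 0"
  by (simp add: l2_norm_def)

lemma l2_norm_minus_commute: "l2_norm m (\<lambda>x. f x - g x) = l2_norm m (\<lambda>x. g x - f x)"
  by (simp add: l2_norm_def norm_minus_commute)

lemma l2_norm_eq_0_iff: "f \<in> l2 m \<Longrightarrow> l2_norm m f = 0 \<longleftrightarrow> (AE x in m. f x = 0)"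
  unfolding l2_norm_def by (simp add: integral_nonneg_eq_0_iff_AE l2_integrable)

lemma l2_inner_cong_AE:
  assumes "f \<in> l2 m" "f' \<in> l2 m" "g \<in> l2 m" "g' \<in> l2 m"
    and "AE x in m. f x = f' x" "AE x in m. g x = g' x"
  shows "l2_inner m f g = l2_inner m f' g'"
  unfolding l2_inner_def
proof (rule integral_cong_AE)
  show "(\<lambda>x. f x * cnj (g x)) \<in> borel_measurable m" "(\<lambda>x. f' x * cnj (g' x)) \<in> borel_measurable m"
    using assms(1-4) by measurable
  show "AE x in m. f x * cnj (g x) = f' x * cnj (g' x)"
    using assms(5,6) by eventually_elim simp
qed

lemma l2_norm_cong_AE:
  assumes "f \<in> l2 m" "f' \<in> l2 m" "AE x in m. f x = f' x"
  shows "l2_norm m f = l2_norm m f'"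
proof -
  have "l2_inner m f f = l2_inner m f' f'"
    using l2_inner_cong_AE assms by blast
  then have "(l2_norm m f)\<^sup>2 = (l2_norm m f')\<^sup>2"
    unfolding l2_inner_self using of_real_eq_iff by blast
  then show ?thesis by simp
qed

lemma l2_norm_diff_cmult_power2:
  assumes "f \<in> l2 m" "g \<in> l2 m"
  shows "(l2_norm m (\<lambda>x. f x - c * g x))\<^sup>2 =
    (l2_norm m f)\<^sup>2 - 2 * Re (cnj c * l2_inner m f g) + (cmod c)\<^sup>2 * (l2_norm m g)\<^sup>2"
proof -
  have "complex_of_real ((l2_norm m (\<lambda>x. f x - c * g x))\<^sup>2) =
     l2_inner m f f - cnj c * l2_inner m f g - c * cnj (l2_inner m f g) + c * cnj c * l2_inner m g g"
    unfolding l2_inner_self[symmetric]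
    using assms by (simp add: l2_inner_diff_left l2_inner_diff_right l2_intros l2_inner_cnj[of m g f] algebra_simps)
  also have "\<dots> = of_real ((l2_norm m f)\<^sup>2 - 2 * Re (cnj c * l2_inner m f g) + (cmod c)\<^sup>2 * (l2_norm m g)\<^sup>2)"
    unfolding l2_inner_self by (simp add: complex_eq_iff cmod_power2) (simp add: power2_eq_square algebra_simps)
  finally show ?thesis using of_real_eq_iff by blast
qed

lemma l2_Cauchy_Schwarz:
  assumes f: "f \<in> l2 m" and g: "g \<in> l2 m"
  shows "cmod (l2_inner m f g) \<le> l2_norm m f * l2_norm m g"
proof (cases "l2_norm m g = 0")
  case True
  then have "AE x in m. g x = 0" using l2_norm_eq_0_iff[OF g] by simp
  then have "l2_inner m f g = l2_inner m f (\<lambda>x. 0)"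
    using f g by (intro l2_inner_cong_AE) auto
  then show ?thesis using True by simp
next
  case False
  define a where "a = l2_inner m f g"
  define N where "N = (l2_norm m g)\<^sup>2"
  have N: "N > 0" using False by (simp add: N_def)
  \<comment> \<open>The coefficient of the orthogonal projection of f onto g, which minimises the
    norm of f - c g.\<close>
  define c where "c = a / of_real N"
  have "0 \<le> (l2_norm m (\<lambda>x. f x - c * g x))\<^sup>2" by simp
  also have "\<dots> = (l2_norm m f)\<^sup>2 - 2 * Re (cnj c * a) + (cmod c)\<^sup>2 * N"
    unfolding a_def N_def by (rule l2_norm_diff_cmult_power2[OF f g])
  also have "cnj c * a = of_real ((cmod a)\<^sup>2 / N)"
    by (simp add: c_def complex_norm_square[symmetric] mult.commute)
  also have "(cmod c)\<^sup>2 * N = (cmod a)\<^sup>2 / N"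
    using N by (simp add: c_def norm_divide power_divide power2_eq_square)
  finally have "(cmod a)\<^sup>2 \<le> (l2_norm m f)\<^sup>2 * N"
    using N by (simp add: field_simps)
  then have "(cmod a)\<^sup>2 \<le> (l2_norm m f * l2_norm m g)\<^sup>2"
    by (simp add: N_def power_mult_distrib)
  then show ?thesis unfolding a_def
    by (meson l2_norm_nonneg mult_nonneg_nonneg power2_le_imp_le)
qed

lemma l2_norm_triangle_diff:
  assumes f: "f \<in> l2 m" and g: "g \<in> l2 m"
  shows "l2_norm m (\<lambda>x. f x - g x) \<le> l2_norm m f + l2_norm m g"
proof (rule power2_le_imp_le)
  have "(l2_norm m (\<lambda>x. f x - g x))\<^sup>2 =
      (l2_norm m f)\<^sup>2 - 2 * Re (l2_inner m f g) + (l2_norm m g)\<^sup>2"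
    using l2_norm_diff_cmult_power2[OF f g, of 1] by simp
  moreover have "- Re (l2_inner m f g) \<le> l2_norm m f * l2_norm m g"
    using l2_Cauchy_Schwarz[OF f g] abs_Re_le_cmod[of "l2_inner m f g"] by linarith
  ultimately show "(l2_norm m (\<lambda>x. f x - g x))\<^sup>2 \<le> (l2_norm m f + l2_norm m g)\<^sup>2"
    by (simp add: power2_sum)
qed simp

lemma l2_norm_uminus [simp]: "l2_norm m (\<lambda>x. - f x) = l2_norm m f"
  by (simp add: l2_norm_def)

lemma l2_norm_triangle:
  assumes f: "f \<in> l2 m" and g: "g \<in> l2 m"
  shows "l2_norm m (\<lambda>x. f x + g x) \<le> l2_norm m f + l2_norm m g"
  using l2_norm_triangle_diff[OF f l2_uminus[OF g]] by simp

lemma l2_norm_triangle3: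
  assumes "f \<in> l2 m" "g \<in> l2 m" "h \<in> l2 m"
  shows "l2_norm m (\<lambda>x. f x - h x) \<le> l2_norm m (\<lambda>x. f x - g x) + l2_norm m (\<lambda>x. g x - h x)"
  using l2_norm_triangle[OF l2_diff[OF assms(1,2)] l2_diff[OF assms(2,3)]] by simp

lemma tendsto_l2_inner_left:
  assumes "\<And>n. f n \<in> l2 m" "g \<in> l2 m" "h \<in> l2 m"
    and "(\<lambda>n. l2_norm m (\<lambda>x. g x - f n x)) \<longlonglongrightarrow> 0"
  shows "(\<lambda>n. l2_inner m (f n) h) \<longlonglongrightarrow> l2_inner m g h"
proof -
  have "(\<lambda>n. l2_inner m (f n) h - l2_inner m g h) \<longlonglongrightarrow> 0"
  proof (rule Lim_null_comparison)
    show "(\<lambda>n. l2_norm m (\<lambda>x. g x - f n x) * l2_norm m h) \<longlonglongrightarrow> 0"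
      using tendsto_mult_right[OF assms(4), of "l2_norm m h"] by simp
    show "\<forall>\<^sub>F n in sequentially. norm (l2_inner m (f n) h - l2_inner m g h)
        \<le> l2_norm m (\<lambda>x. g x - f n x) * l2_norm m h"
    proof (intro always_eventually allI)
      fix n
      have "l2_inner m g h - l2_inner m (f n) h = l2_inner m (\<lambda>x. g x - f n x) h"
        using assms by (simp add: l2_inner_diff_left)
      then show "norm (l2_inner m (f n) h - l2_inner m g h) \<le> l2_norm m (\<lambda>x. g x - f n x) * l2_norm m h"
        using l2_Cauchy_Schwarz[OF l2_diff[OF assms(2) assms(1)[of n]] assms(3)]
        by (simp add: norm_minus_commute)
    qed
  qed
  then show ?thesis by (simp add: LIM_zero_iff)
qed

lemma tendsto_l2_inner_right:
  assumes "\<And>n. f n \<in> l2 m" "g \<in> l2 m" "h \<in> l2 m"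
    and "(\<lambda>n. l2_norm m (\<lambda>x. g x - f n x)) \<longlonglongrightarrow> 0"
  shows "(\<lambda>n. l2_inner m h (f n)) \<longlonglongrightarrow> l2_inner m h g"
  using tendsto_cnj[OF tendsto_l2_inner_left[OF assms]]
  by (simp flip: l2_inner_cnj)

section \<open>Completeness of L^2\<close>

lemma ennreal_l2_norm_power2:
  "f \<in> l2 m \<Longrightarrow> (\<integral>\<^sup>+x. ennreal ((cmod (f x))\<^sup>2) \<partial>m) = ennreal ((l2_norm m f)\<^sup>2)"
  unfolding l2_norm_power2 by (intro nn_integral_eq_integral l2_integrable) auto

text \<open>With the extended integral, membership and norm bound come out together, so Fatou's
  lemma can be applied to a limit not yet known to be square integrable.\<close>

lemma l2I_nn_integral:
  assumes "f \<in> borel_measurable m" "(\<integral>\<^sup>+x. ennreal ((cmod (f x))\<^sup>2) \<partial>m) \<le> ennreal (B\<^sup>2)" "0 \<le> B"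
  shows "f \<in> l2 m" "l2_norm m f \<le> B"
proof -
  have "(\<integral>\<^sup>+x. ennreal (norm ((cmod (f x))\<^sup>2)) \<partial>m) < \<infinity>"
    using assms(2) by (auto intro: order_le_less_trans)
  then show f: "f \<in> l2 m"
    using assms(1) by (simp add: l2_def integrable_iff_bounded)
  have "ennreal ((l2_norm m f)\<^sup>2) \<le> ennreal (B\<^sup>2)"
    using assms(2) by (simp add: ennreal_l2_norm_power2[OF f])
  then have "(l2_norm m f)\<^sup>2 \<le> B\<^sup>2"
    by (subst (asm) ennreal_le_iff) auto
  then show "l2_norm m f \<le> B"
    using assms(3) by (rule power2_le_imp_le)
qed

text \<open>Weighting the squared increments by 2^n leaves their integrals summable, since 2^n
  4^(-n) = 2^(-n), and still forces geometric decay of the increments at almost every point. Fatou's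
  lemma, with n fixed and k growing, then bounds the distance to the pointwise limit.\<close>

lemma l2_complete_rapid:
  assumes f: "\<And>n. f n \<in> l2 m"
    and rapid: "\<And>n. l2_norm m (\<lambda>x. f (Suc n) x - f n x) \<le> (1/2) ^ n"
  obtains g where "g \<in> l2 m" "\<And>n. l2_norm m (\<lambda>x. g x - f n x) \<le> 2 * (1/2) ^ n"
proof -
  define d where "d n = (\<lambda>x. f (Suc n) x - f n x)" for n
  have d: "d n \<in> l2 m" for n unfolding d_def using f by (intro l2_diff)
  have [measurable]: "f n \<in> borel_measurable m" "d n \<in> borel_measurable m" for n
    using f d by (auto dest: l2_measurable)
  define S where "S x = (\<Sum>n. ennreal (2 ^ n * (cmod (d n x))\<^sup>2))" for x
  have [measurable]: "S \<in> borel_measurable m" unfolding S_def by measurable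
  have term_le: "(\<integral>\<^sup>+x. ennreal (2 ^ n * (cmod (d n x))\<^sup>2) \<partial>m) \<le> ennreal ((1/2) ^ n)" for n
  proof -
    have "(\<integral>\<^sup>+x. ennreal (2 ^ n * (cmod (d n x))\<^sup>2) \<partial>m) =
        (\<integral>\<^sup>+x. ennreal (2 ^ n) * ennreal ((cmod (d n x))\<^sup>2) \<partial>m)"
      by (simp add: ennreal_mult)
    also have "\<dots> = ennreal (2 ^ n) * ennreal ((l2_norm m (d n))\<^sup>2)"
      by (subst nn_integral_cmult) (auto simp: ennreal_l2_norm_power2[OF d])
    also have "\<dots> = ennreal (2 ^ n * (l2_norm m (d n))\<^sup>2)"
      by (simp add: ennreal_mult)
    also have "\<dots> \<le> ennreal (2 ^ n * ((1/2) ^ n)\<^sup>2)"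
      using rapid by (intro ennreal_leI mult_left_mono power_mono) (auto simp: d_def)
    also have "(2::real) ^ n * ((1/2) ^ n)\<^sup>2 = (1/2) ^ n"
      by (simp add: power2_eq_square power_one_over)
    finally show ?thesis .
  qed
  have "(\<integral>\<^sup>+x. S x \<partial>m) = (\<Sum>n. \<integral>\<^sup>+x. ennreal (2 ^ n * (cmod (d n x))\<^sup>2) \<partial>m)"
    unfolding S_def by (intro nn_integral_suminf) measurable
  also have "\<dots> \<le> (\<Sum>n. ennreal ((1/2) ^ n))"
    by (intro suminf_le term_le) auto
  also have "\<dots> = ennreal (\<Sum>n. (1/2) ^ n)"
    by (intro suminf_ennreal2) (auto intro: summable_geometric)
  finally have "(\<integral>\<^sup>+x. S x \<partial>m) \<noteq> \<infinity>"
    by (auto simp: top_unique)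
  then have "AE x in m. S x \<noteq> \<infinity>"
    by (intro nn_integral_PInf_AE) auto
  then have conv: "AE x in m. convergent (\<lambda>n. f n x)"
  proof eventually_elim
    case (elim x)
    then obtain s where s: "S x = ennreal s" "s \<ge> 0"
      by (cases "S x") auto
    have bound: "cmod (d n x) \<le> sqrt s * (sqrt (1/2)) ^ n" for n
    proof -
      have "ennreal (2 ^ n * (cmod (d n x))\<^sup>2) \<le> S x"
      proof -
        have "(\<Sum>k\<in>{n}. ennreal (2 ^ k * (cmod (d k x))\<^sup>2)) \<le> S x"
          unfolding S_def by (rule sum_le_suminf) auto
        then show ?thesis
          by (simp only: sum.insert finite.emptyI empty_iff not_False_eq_True sum.empty add_0_right)
      qed
      then have "2 ^ n * (cmod (d n x))\<^sup>2 \<le> s" unfolding s by (subst (asm) ennreal_le_iff) (use s in auto)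
      then have "(cmod (d n x))\<^sup>2 \<le> s * (1/2) ^ n" by (simp add: field_simps power_one_over)
      then have "sqrt ((cmod (d n x))\<^sup>2) \<le> sqrt (s * (1/2) ^ n)" by (rule real_sqrt_le_mono)
      then show ?thesis by (simp add: real_sqrt_mult real_sqrt_power)
    qed
    have "summable (\<lambda>n. sqrt s * (sqrt (1/2)) ^ n)"
      by (intro summable_mult summable_geometric) (auto simp: real_sqrt_divide)
    then have "summable (\<lambda>n. d n x)"
      by (rule summable_comparison_test[rotated]) (use bound in auto)
    then have "convergent (\<lambda>n. \<Sum>k<n. d k x)"
      by (simp add: summable_iff_convergent)
    then have "convergent (\<lambda>n. f 0 x + (\<Sum>k<n. d k x))"
      by (intro convergent_add convergent_const)
    moreover have "f 0 x + (\<Sum>k<n. d k x) = f n x" for n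
      unfolding d_def using sum_lessThan_telescope[of "\<lambda>n. f n x" n] by simp
    ultimately show ?case by simp
  qed
  define g where "g x = lim (\<lambda>n. f n x)" for x
  have [measurable]: "g \<in> borel_measurable m" unfolding g_def by measurable
  \<comment> \<open>The subtracted term strengthens the claim so that the induction closes; without
    it the bound is uniform in k.\<close>
  have step: "l2_norm m (\<lambda>x. f (n + k) x - f n x) \<le> 2 * (1/2) ^ n - 2 * (1/2) ^ (n + k)" for n k
  proof (induction k)
    case (Suc k)
    have "l2_norm m (\<lambda>x. f (n + Suc k) x - f n x) \<le>
        l2_norm m (\<lambda>x. f (Suc (n + k)) x - f (n + k) x) + l2_norm m (\<lambda>x. f (n + k) x - f n x)"
      using l2_norm_triangle3[OF f[of "Suc (n + k)"] f[of "n + k"] f[of n]] by simp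
    also have "\<dots> \<le> (1/2) ^ (n + k) + (2 * (1/2) ^ n - 2 * (1/2) ^ (n + k))"
      using rapid Suc by (intro add_mono)
    finally show ?case by (simp add: field_simps)
  qed simp
  have bound: "(\<integral>\<^sup>+x. ennreal ((cmod (g x - f n x))\<^sup>2) \<partial>m) \<le> ennreal ((2 * (1/2) ^ n)\<^sup>2)" for n
  proof -
    have "(\<integral>\<^sup>+x. ennreal ((cmod (g x - f n x))\<^sup>2) \<partial>m) =
        (\<integral>\<^sup>+x. liminf (\<lambda>k. ennreal ((cmod (f (n + k) x - f n x))\<^sup>2)) \<partial>m)"
    proof (rule nn_integral_cong_AE, use conv in eventually_elim)
      case (elim x)
      then have "(\<lambda>k. f k x) \<longlonglongrightarrow> g x" unfolding g_def by (simp add: convergent_LIMSEQ_iff)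
      then have "(\<lambda>k. f (n + k) x) \<longlonglongrightarrow> g x"
        by (subst add.commute) (rule LIMSEQ_ignore_initial_segment)
      then have "(\<lambda>k. ennreal ((cmod (f (n + k) x - f n x))\<^sup>2)) \<longlonglongrightarrow> ennreal ((cmod (g x - f n x))\<^sup>2)"
        by (intro tendsto_intros)
      then show ?case by (rule lim_imp_Liminf[OF trivial_limit_sequentially, symmetric])
    qed
    also have "\<dots> \<le> liminf (\<lambda>k. \<integral>\<^sup>+x. ennreal ((cmod (f (n + k) x - f n x))\<^sup>2) \<partial>m)"
      by (intro nn_integral_liminf) measurable
    also have "\<dots> \<le> liminf (\<lambda>k::nat. ennreal ((2 * (1/2) ^ n)\<^sup>2))"
    proof (intro Liminf_mono always_eventually allI)
      fix k
      have "(l2_norm m (\<lambda>x. f (n + k) x - f n x))\<^sup>2 \<le> (2 * (1/2) ^ n)\<^sup>2"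
        using step[of n k] by (intro power_mono order_trans[OF step[of n k]]) auto
      then show "(\<integral>\<^sup>+x. ennreal ((cmod (f (n + k) x - f n x))\<^sup>2) \<partial>m) \<le> ennreal ((2 * (1/2) ^ n)\<^sup>2)"
        by (subst ennreal_l2_norm_power2) (auto intro: l2_diff f ennreal_leI)
    qed
    also have "\<dots> = ennreal ((2 * (1/2) ^ n)\<^sup>2)" by (simp add: Liminf_const)
    finally show ?thesis .
  qed
  have gf: "(\<lambda>x. g x - f n x) \<in> l2 m" "l2_norm m (\<lambda>x. g x - f n x) \<le> 2 * (1/2) ^ n" for n
    using l2I_nn_integral[OF _ bound[of n]] by auto
  have "g \<in> l2 m" using l2_add[OF gf(1)[of 0] f[of 0]] by simp
  then show thesis using that gf(2) by blast
qed

lemma l2_complete: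
  assumes f: "\<And>n. f n \<in> l2 m"
    and Cauchy: "\<And>\<epsilon>. \<epsilon> > 0 \<Longrightarrow> \<exists>N. \<forall>n\<ge>N. \<forall>k\<ge>N. l2_norm m (\<lambda>x. f n x - f k x) \<le> \<epsilon>"
  obtains g where "g \<in> l2 m" "(\<lambda>n. l2_norm m (\<lambda>x. g x - f n x)) \<longlonglongrightarrow> 0"
proof -
  have "\<forall>i. \<exists>N. \<forall>n\<ge>N. \<forall>k\<ge>N. l2_norm m (\<lambda>x. f n x - f k x) \<le> (1/2) ^ i"
    using Cauchy by simp
  then obtain N where N: "\<And>i n k. n \<ge> N i \<Longrightarrow> k \<ge> N i \<Longrightarrow> l2_norm m (\<lambda>x. f n x - f k x) \<le> (1/2) ^ i"
    by metis
  \<comment> \<open>Partial sums make the index monotone, so that both r n and r (Suc n) lie beyond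
    N n.\<close>
  define r where "r n = (\<Sum>i\<le>n. N i)" for n
  have r: "r n \<ge> N n" "r (Suc n) \<ge> N n" for n
    by (auto simp: r_def member_le_sum trans_le_add1)
  obtain g where g: "g \<in> l2 m" "\<And>n. l2_norm m (\<lambda>x. g x - f (r n) x) \<le> 2 * (1/2) ^ n"
    using l2_complete_rapid[of "\<lambda>n. f (r n)" m] f N r by blast
  have "(\<lambda>n. l2_norm m (\<lambda>x. g x - f n x)) \<longlonglongrightarrow> 0"
  proof (rule LIMSEQ_I)
    fix \<epsilon> :: real assume "\<epsilon> > 0"
    then obtain i where i: "(1/2::real) ^ i < \<epsilon> / 3"
      using real_arch_pow_inv[of "\<epsilon> / 3" "1/2"] by auto
    show "\<exists>no. \<forall>n\<ge>no. norm (l2_norm m (\<lambda>x. g x - f n x) - 0) < \<epsilon>"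
    proof (intro exI allI impI)
      fix n assume "n \<ge> N i"
      have "l2_norm m (\<lambda>x. g x - f n x) \<le>
          l2_norm m (\<lambda>x. g x - f (r i) x) + l2_norm m (\<lambda>x. f (r i) x - f n x)"
        by (intro l2_norm_triangle3 f g)
      also have "\<dots> \<le> 2 * (1/2) ^ i + (1/2) ^ i"
        using g(2) N[OF r(1) \<open>n \<ge> N i\<close>] by (intro add_mono)
      finally show "norm (l2_norm m (\<lambda>x. g x - f n x) - 0) < \<epsilon>" using i by simp
    qed
  qed
  then show thesis using that g by blast
qed

section \<open>Expansions in orthonormal systems\<close>

lemma l2_sums_inner_left:
  assumes "l2_sums m c u f" "\<And>j. u j \<in> l2 m" "h \<in> l2 m"
  shows "(\<lambda>j. c j * l2_inner m (u j) h) sums l2_inner m f h"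
proof -
  have "(\<lambda>n. l2_inner m (\<lambda>x. \<Sum>j<n. c j * u j x) h) \<longlonglongrightarrow> l2_inner m f h"
    using assms by (intro tendsto_l2_inner_left l2_sum l2_cmult) (auto simp: l2_sums_def)
  then show ?thesis
    using assms by (simp add: sums_def l2_inner_sum_left l2_cmult)
qed

text \<open>Kept apart from bases because the \<Phi> j form only an orthonormal system: the
  eigenfunctions vanishing at p have been discarded.\<close>

locale orthonormal_system =
  fixes m :: "'a measure" and u :: "nat \<Rightarrow> 'a \<Rightarrow> complex"
  assumes in_l2: "u n \<in> l2 m"
    and orthonormal: "l2_inner m (u n) (u k) = (if n = k then 1 else 0)"
begin

lemma in_l2_sum: "(\<lambda>x. \<Sum>i\<in>A. c i * u i x) \<in> l2 m"
  by (intro l2_intros in_l2)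

lemma inner_sum:
  "finite A \<Longrightarrow> l2_inner m (\<lambda>x. \<Sum>i\<in>A. c i * u i x) (u k) = (if k \<in> A then c k else 0)"
  by (simp add: l2_inner_sum_left l2_cmult in_l2 orthonormal if_distrib sum.delta' cong: if_cong)

lemma norm_sum_power2:
  assumes "finite A"
  shows "(l2_norm m (\<lambda>x. \<Sum>i\<in>A. c i * u i x))\<^sup>2 = (\<Sum>i\<in>A. (cmod (c i))\<^sup>2)"
proof -
  have "complex_of_real ((l2_norm m (\<lambda>x. \<Sum>i\<in>A. c i * u i x))\<^sup>2) =
      (\<Sum>k\<in>A. cnj (c k) * l2_inner m (\<lambda>x. \<Sum>i\<in>A. c i * u i x) (u k))"
    unfolding l2_inner_self[symmetric]
    by (simp add: l2_inner_sum_right l2_cmult in_l2 in_l2_sum)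
  also have "\<dots> = (\<Sum>k\<in>A. cnj (c k) * c k)"
    using assms by (intro sum.cong) (auto simp: inner_sum)
  also have "\<dots> = of_real (\<Sum>i\<in>A. (cmod (c i))\<^sup>2)"
    by (simp add: complex_norm_square[symmetric] mult.commute)
  finally show ?thesis using of_real_eq_iff by blast
qed

lemma l2_sums_exists:
  assumes "summable (\<lambda>j. (cmod (c j))\<^sup>2)"
  shows "\<exists>f. l2_sums m c u f"
proof -
  define S where "S n x = (\<Sum>j<n. c j * u j x)" for n x
  have S: "S n \<in> l2 m" for n unfolding S_def by (rule in_l2_sum)
  obtain f where "f \<in> l2 m" "(\<lambda>n. l2_norm m (\<lambda>x. f x - S n x)) \<longlonglongrightarrow> 0"
  proof (rule l2_complete[OF S])
    fix \<epsilon> :: real assume \<epsilon>: "\<epsilon> > 0"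
    then have "\<epsilon>\<^sup>2 > 0" by simp
    then obtain N where N: "\<And>n k. k \<ge> N \<Longrightarrow> norm (\<Sum>j=k..<n. (cmod (c j))\<^sup>2) < \<epsilon>\<^sup>2"
      using assms unfolding summable_Cauchy by blast
    have le: "l2_norm m (\<lambda>x. S n x - S k x) \<le> \<epsilon>" if "k \<ge> N" "n \<ge> k" for n k
    proof -
      have "S n x - S k x = (\<Sum>j=k..<n. c j * u j x)" for x
        unfolding S_def lessThan_atLeast0
        using that by (intro sum_diff_nat_ivl) auto
      then have "(l2_norm m (\<lambda>x. S n x - S k x))\<^sup>2 = (\<Sum>j=k..<n. (cmod (c j))\<^sup>2)"
        by (simp add: norm_sum_power2)
      also have "\<dots> \<le> \<epsilon>\<^sup>2" using N[OF that(1), of n] by simp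
      finally show ?thesis by (rule power2_le_imp_le) (use \<epsilon> in simp)
    qed
    then have "l2_norm m (\<lambda>x. S n x - S k x) \<le> \<epsilon>" if "n \<ge> N" "k \<ge> N" for n k
      using le[of k n] le[of n k] that l2_norm_minus_commute[of m "S n" "S k"]
      by (cases "n \<ge> k") auto
    then show "\<exists>N. \<forall>n\<ge>N. \<forall>k\<ge>N. l2_norm m (\<lambda>x. S n x - S k x) \<le> \<epsilon>" by blast
  qed
  then show ?thesis unfolding l2_sums_def S_def by blast
qed

lemma l2_sums_l2_suminf:
  "summable (\<lambda>j. (cmod (c j))\<^sup>2) \<Longrightarrow> l2_sums m c u (l2_suminf m c u)"
  unfolding l2_suminf_def by (rule someI_ex[OF l2_sums_exists])

lemma l2_sums_inner:
  assumes "l2_sums m c u f"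
  shows "l2_inner m f (u k) = c k"
proof -
  have "(\<lambda>j. c j * l2_inner m (u j) (u k)) sums l2_inner m f (u k)"
    using l2_sums_inner_left[OF assms in_l2 in_l2] .
  then have "(\<lambda>j. if j = k then c j else 0) sums l2_inner m f (u k)"
    by (simp add: orthonormal if_distrib cong: if_cong)
  moreover have "(\<lambda>j. if j = k then c j else 0) sums c k"
    using sums_If_finite_set[of "{k}" c] by simp
  ultimately show ?thesis by (rule sums_unique2)
qed

text \<open>Pairing the expansion of f with f itself gives Parseval's identity without completeness
  of the system.\<close>

lemma l2_sums_norm:
  assumes "l2_sums m c u f"
  shows "(\<lambda>j. (cmod (c j))\<^sup>2) sums (l2_norm m f)\<^sup>2"
proof -
  have "f \<in> l2 m" using assms by (simp add: l2_sums_def)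
  have "(\<lambda>j. c j * l2_inner m (u j) f) sums of_real ((l2_norm m f)\<^sup>2)"
    using l2_sums_inner_left[OF assms in_l2 \<open>f \<in> l2 m\<close>] by (simp only: l2_inner_self)
  moreover have "c j * l2_inner m (u j) f = of_real ((cmod (c j))\<^sup>2)" for j
    using l2_sums_inner[OF assms, of j] by (simp add: l2_inner_cnj[of m "u j" f] complex_norm_square[symmetric])
  ultimately show ?thesis by (simp add: sums_of_real_iff del: of_real_power)
qed

end

locale orthonormal_basis = orthonormal_system +
  assumes expansion: "f \<in> l2 m \<Longrightarrow> l2_sums m (\<lambda>n. l2_inner m f (u n)) u f"
begin

lemma parseval: "f \<in> l2 m \<Longrightarrow> (\<lambda>n. (cmod (l2_inner m f (u n)))\<^sup>2) sums (l2_norm m f)\<^sup>2"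
  by (intro l2_sums_norm expansion)

lemma AE_eqI:
  assumes "f \<in> l2 m" "g \<in> l2 m" "\<And>n. l2_inner m f (u n) = l2_inner m g (u n)"
  shows "AE x in m. f x = g x"
proof -
  have "(\<lambda>n. (cmod (l2_inner m (\<lambda>x. f x - g x) (u n)))\<^sup>2) sums (l2_norm m (\<lambda>x. f x - g x))\<^sup>2"
    using assms by (intro parseval l2_diff)
  then have "(\<lambda>n. 0) sums (l2_norm m (\<lambda>x. f x - g x))\<^sup>2"
    using assms by (simp add: l2_inner_diff_left in_l2)
  then have "l2_norm m (\<lambda>x. f x - g x) = 0"
    using sums_unique2[OF sums_zero, of "(l2_norm m (\<lambda>x. f x - g x))\<^sup>2"] by simp
  then show ?thesis
    using l2_norm_eq_0_iff[OF l2_diff[OF assms(1,2)]] by simp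
qed

end

section \<open>Spectral weights and the secular equation\<close>

text \<open>A reversed Bhatia-Davis inequality: values of weighted mean zero that avoid the open
  interval (-1/\<alpha>, 1/\<beta>) have second moment at least 1/(\<alpha> \<beta>). AM-GM then
  replaces \<alpha> \<beta> by a quantity free of \<mu>.\<close>

lemma mean_zero_reciprocal_variance:
  fixes a E :: "'b \<Rightarrow> real"
  assumes J: "finite J" "J \<noteq> {}" and a: "\<And>j. j \<in> J \<Longrightarrow> a j > 0"
    and ne: "\<And>j. j \<in> J \<Longrightarrow> E j \<noteq> \<mu>" and zero: "(\<Sum>j\<in>J. a j / (E j - \<mu>)) = 0"
  shows "(\<Sum>j\<in>J. a j) \<le> ((Max (E ` J) - Min (E ` J)) / 2)\<^sup>2 * (\<Sum>j\<in>J. a j / (E j - \<mu>)\<^sup>2)"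
proof -
  define lo hi where "lo = Min (E ` J)" and "hi = Max (E ` J)"
  have bounds: "lo \<le> E j" "E j \<le> hi" if "j \<in> J" for j
    using J that by (auto simp: lo_def hi_def)
  \<comment> \<open>The weights are positive, so a vanishing sum needs terms of both signs and \<mu>
    lies strictly between the extreme energies.\<close>
  have "lo < \<mu>"
  proof (rule ccontr)
    assume "\<not> lo < \<mu>"
    then have "E j > \<mu>" if "j \<in> J" for j using bounds(1)[OF that] ne[OF that] by simp
    then have "(\<Sum>j\<in>J. a j / (E j - \<mu>)) > 0" using J a by (intro sum_pos) auto
    then show False using zero by simp
  qed
  have "\<mu> < hi"
  proof (rule ccontr)
    assume "\<not> \<mu> < hi"
    then have "E j < \<mu>" if "j \<in> J" for j using bounds(2)[OF that] ne[OF that] by simp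
    then have "(\<Sum>j\<in>J. - (a j / (E j - \<mu>))) > 0"
      using J a by (intro sum_pos) (auto intro: divide_pos_neg)
    then show False using zero by (simp add: sum_negf)
  qed
  define \<alpha> \<beta> where "\<alpha> = \<mu> - lo" and "\<beta> = hi - \<mu>"
  have pos: "\<alpha> > 0" "\<beta> > 0" using \<open>lo < \<mu>\<close> \<open>\<mu> < hi\<close> by (auto simp: \<alpha>_def \<beta>_def)
  define y where "y j = 1 / (E j - \<mu>)" for j
  have y: "0 \<le> (y j - 1 / \<beta>) * (y j + 1 / \<alpha>)" if "j \<in> J" for j
  proof (cases "E j > \<mu>")
    case True
    then have "y j \<ge> 1 / \<beta>" unfolding y_def \<beta>_def
      using bounds[OF that] by (intro divide_left_mono mult_pos_pos) auto
    moreover have "y j > 0" using True by (simp add: y_def)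
    ultimately show ?thesis using pos by (intro mult_nonneg_nonneg) auto
  next
    case False
    then have lt: "E j < \<mu>" using ne[OF that] by simp
    then have "1 / (\<mu> - E j) \<ge> 1 / \<alpha>" unfolding \<alpha>_def
      using bounds[OF that] by (intro divide_left_mono mult_pos_pos) auto
    moreover have "y j = - (1 / (\<mu> - E j))" using lt by (simp add: y_def field_simps)
    moreover have "1 / \<alpha> > 0" "1 / \<beta> > 0" using pos by auto
    ultimately have "y j + 1 / \<alpha> \<le> 0" "y j - 1 / \<beta> \<le> 0" by linarith+
    then show ?thesis by (rule mult_nonpos_nonpos[rotated])
  qed
  have "0 \<le> (\<Sum>j\<in>J. a j * ((y j - 1 / \<beta>) * (y j + 1 / \<alpha>)))"
    by (intro sum_nonneg mult_nonneg_nonneg[OF less_imp_le[OF a] y])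
  also have "\<dots> = (\<Sum>j\<in>J. a j * (y j)\<^sup>2 + (1 / \<alpha> - 1 / \<beta>) * (a j * y j) - (1 / (\<alpha> * \<beta>)) * a j)"
    by (intro sum.cong refl) (simp add: algebra_simps power2_eq_square)
  also have "\<dots> = (\<Sum>j\<in>J. a j * (y j)\<^sup>2) + (1 / \<alpha> - 1 / \<beta>) * (\<Sum>j\<in>J. a j * y j)
      - (1 / (\<alpha> * \<beta>)) * (\<Sum>j\<in>J. a j)"
    by (simp add: sum.distrib sum_subtractf sum_distrib_left)
  also have "(\<Sum>j\<in>J. a j * y j) = 0" using zero by (simp add: y_def)
  finally have "(\<Sum>j\<in>J. a j) \<le> \<alpha> * \<beta> * (\<Sum>j\<in>J. a j * (y j)\<^sup>2)"
    using pos by (simp add: field_simps)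
  also have "\<dots> \<le> ((hi - lo) / 2)\<^sup>2 * (\<Sum>j\<in>J. a j * (y j)\<^sup>2)"
  proof (rule mult_right_mono)
    have "hi - lo = \<alpha> + \<beta>" by (simp add: \<alpha>_def \<beta>_def)
    then show "\<alpha> * \<beta> \<le> ((hi - lo) / 2)\<^sup>2"
      using zero_le_power2[of "\<alpha> - \<beta>"] by (simp add: power2_eq_square algebra_simps)
    show "0 \<le> (\<Sum>j\<in>J. a j * (y j)\<^sup>2)"
      using a by (intro sum_nonneg mult_nonneg_nonneg) (auto intro: less_imp_le)
  qed
  finally show ?thesis by (simp add: y_def lo_def hi_def power_divide)
qed

section \<open>Consequences of Weyl's law for the weights |\<Phi>_j(p)|^2\<close>

locale spectral_weights =
  fixes a E :: "nat \<Rightarrow> real"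
  assumes a_pos: "0 < a j"
    and E_mono: "strict_mono E"
    and E_nonneg: "0 \<le> E j"
    and E_finite: "finite {j. E j \<le> x}"
    and weyl: "(\<lambda>x. (\<Sum>j | E j \<le> x. a j) - x / (4 * pi)) \<in> O(\<lambda>x. sqrt x)"
begin

text \<open>The squared modulus of the j-th coefficient of either deficiency vector.\<close>

definition w :: "nat \<Rightarrow> real" where "w j = a j / (1 + (E j)\<^sup>2)"

lemma w_pos: "0 < w j"
  using a_pos[of j] by (simp add: w_def add_pos_nonneg)

lemma a_eq: "a j = w j * (1 + (E j)\<^sup>2)"
proof -
  have "1 + (E j)\<^sup>2 > 0" by (simp add: add_pos_nonneg)
  then show ?thesis by (simp add: w_def)
qed

lemma weyl_bound:
  obtains c X where "0 < c" "\<And>x. x \<ge> X \<Longrightarrow> \<bar>(\<Sum>j | E j \<le> x. a j) - x / (4 * pi)\<bar> \<le> c * \<bar>sqrt x\<bar>"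
proof -
  from weyl obtain c where c: "0 < c"
    "\<forall>\<^sub>F x in at_top. norm ((\<Sum>j | E j \<le> x. a j) - x / (4 * pi)) \<le> c * norm (sqrt x)"
    by (rule landau_o.bigE)
  from c(2) obtain X where
    "\<And>x. x \<ge> X \<Longrightarrow> norm ((\<Sum>j | E j \<le> x. a j) - x / (4 * pi)) \<le> c * norm (sqrt x)"
    unfolding eventually_at_top_linorder by blast
  then show thesis using that[of c X] c(1) by (simp only: real_norm_def)
qed

lemma counting_le_linear:
  obtains A where "0 < A" "\<And>x. x \<ge> 1 \<Longrightarrow> (\<Sum>j | E j \<le> x. a j) \<le> A * x"
proof -
  obtain c X where c: "0 < c" and
    bound: "\<And>x. x \<ge> X \<Longrightarrow> \<bar>(\<Sum>j | E j \<le> x. a j) - x / (4 * pi)\<bar> \<le> c * \<bar>sqrt x\<bar>"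
    using weyl_bound by blast
  define N where "N x = (\<Sum>j | E j \<le> x. a j)" for x
  have N_nonneg: "0 \<le> N x" for x unfolding N_def using a_pos by (intro sum_nonneg) (simp add: less_imp_le)
  have "N x \<le> (1 / (4 * pi) + c + N X) * x" if x: "x \<ge> 1" for x
  proof (cases "x \<ge> X")
    case True
    have "sqrt x \<le> x" using x by (intro real_le_lsqrt) (auto simp: power2_eq_square)
    then have "c * sqrt x \<le> c * x" using c by simp
    moreover have "N x \<le> x / (4 * pi) + c * sqrt x" using bound[OF True] x unfolding N_def by simp
    moreover have "0 \<le> N X * x" using N_nonneg x by simp
    ultimately show ?thesis by (simp add: algebra_simps)
  next
    case False
    then have "N x \<le> N X" unfolding N_def
      using a_pos E_finite by (intro sum_mono2) (auto intro: less_imp_le)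
    also have "\<dots> \<le> N X * x" using mult_left_mono[OF x N_nonneg[of X]] by simp
    also have "\<dots> \<le> (1 / (4 * pi) + c + N X) * x" using x c by (intro mult_right_mono) auto
    finally show ?thesis .
  qed
  moreover have "1 / (4 * pi) + c + N X > 0" using c N_nonneg[of X] by (intro add_pos_nonneg add_pos_pos) auto
  ultimately show thesis using that unfolding N_def by blast
qed

text \<open>The main term of Weyl's law outgrows its error. Consequently no nonzero L^2 function has
  coefficients proportional to the conjugates of \<Phi>_j(p), which is how uniqueness of adjoint
  images is obtained.\<close>

lemma a_not_summable: "\<not> summable a"
proof
  assume "summable a"
  define S where "S = (\<Sum>j. a j)"
  have S: "S \<ge> 0" unfolding S_def using \<open>summable a\<close> a_pos by (intro suminf_nonneg) (auto intro: less_imp_le)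
  have NS: "(\<Sum>j | E j \<le> x. a j) \<le> S" for x
    unfolding S_def using \<open>summable a\<close> a_pos E_finite by (intro sum_le_suminf) (auto intro: less_imp_le)
  obtain c X where c: "0 < c" and
    bound: "\<And>x. x \<ge> X \<Longrightarrow> \<bar>(\<Sum>j | E j \<le> x. a j) - x / (4 * pi)\<bar> \<le> c * \<bar>sqrt x\<bar>"
    using weyl_bound by blast
  \<comment> \<open>Weyl's law is read at energy t^2. The first summand makes t/(4 pi) - c at least
    S + 1; the others ensure t \<ge> 1 and t^2 \<ge> X.\<close>
  define t where "t = 4 * pi * (c + S + 1) + \<bar>X\<bar> + 1"
  have t: "t \<ge> 1" "t \<ge> \<bar>X\<bar>" using c S by (auto simp: t_def)
  have "\<bar>X\<bar> * 1 \<le> t * t" using t by (intro mult_mono) auto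
  then have "t\<^sup>2 \<ge> X" by (simp add: power2_eq_square)
  from bound[OF this] have "t\<^sup>2 / (4 * pi) - c * t \<le> (\<Sum>j | E j \<le> t\<^sup>2. a j)"
    using t by simp
  also have "\<dots> \<le> S" by (rule NS)
  finally have "t * (t / (4 * pi) - c) \<le> S" by (simp add: power2_eq_square algebra_simps)
  moreover have "t / (4 * pi) \<ge> c + S + 1" by (simp add: t_def field_simps)
  then have "1 * (S + 1) \<le> t * (t / (4 * pi) - c)" using t S by (intro mult_mono) auto
  ultimately show False by simp
qed

text \<open>Dyadic shells: for R < E j \<le> 2 R the weight is at most a j/R^2 and the counting
  bound is 2 A R, so the shell contributes at most 2 A/R. The factor 1 - (1/2)^n is the partial
  geometric sum over the shells.\<close>

lemma w_shell_sum:
  assumes A: "0 < A" "\<And>x. x \<ge> 1 \<Longrightarrow> (\<Sum>j | E j \<le> x. a j) \<le> A * x" and T: "T \<ge> 1"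
  shows "(\<Sum>j | T < E j \<and> E j \<le> 2 ^ n * T. w j) \<le> 4 * A / T * (1 - (1/2) ^ n)"
proof (induction n)
  case 0
  have "{j. T < E j \<and> E j \<le> 2 ^ 0 * T} = {}" by auto
  then show ?case by (simp only: sum.empty) simp
next
  case (Suc n)
  let ?R = "2 ^ n * T"
  have R: "?R \<ge> 1" using mult_mono[of 1 "2^n::real" 1 T] T by simp
  have fin: "finite {j. P j \<and> E j \<le> x}" for P x by (rule finite_subset[OF _ E_finite[of x]]) auto
  have "{j. T < E j \<and> E j \<le> 2 ^ Suc n * T} =
      {j. T < E j \<and> E j \<le> ?R} \<union> {j. ?R < E j \<and> E j \<le> 2 ^ Suc n * T}"
    using T R by (auto intro: order_trans order_le_less_trans[of T "?R"])
  then have "(\<Sum>j | T < E j \<and> E j \<le> 2 ^ Suc n * T. w j) =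
      (\<Sum>j | T < E j \<and> E j \<le> ?R. w j) + (\<Sum>j | ?R < E j \<and> E j \<le> 2 ^ Suc n * T. w j)"
    by (auto intro!: sum.union_disjoint fin)
  moreover have "(\<Sum>j | ?R < E j \<and> E j \<le> 2 ^ Suc n * T. w j) \<le> 2 * A / T * (1/2) ^ n"
  proof -
    have "(\<Sum>j | ?R < E j \<and> E j \<le> 2 ^ Suc n * T. w j) \<le>
        (\<Sum>j | ?R < E j \<and> E j \<le> 2 ^ Suc n * T. a j / ?R\<^sup>2)"
    proof (rule sum_mono)
      fix j assume "j \<in> {j. ?R < E j \<and> E j \<le> 2 ^ Suc n * T}"
      then have "?R\<^sup>2 \<le> 1 + (E j)\<^sup>2" using R by (intro order_trans[OF power_mono[of ?R "E j" 2]]) auto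
      then show "w j \<le> a j / ?R\<^sup>2" unfolding w_def
        using a_pos[of j] R by (intro divide_left_mono mult_pos_pos) (auto simp: add_pos_nonneg)
    qed
    also have "\<dots> = (\<Sum>j | ?R < E j \<and> E j \<le> 2 ^ Suc n * T. a j) / ?R\<^sup>2"
      by (simp add: sum_divide_distrib)
    also have "\<dots> \<le> (\<Sum>j | E j \<le> 2 ^ Suc n * T. a j) / ?R\<^sup>2"
      using a_pos E_finite by (intro divide_right_mono sum_mono2) (auto intro: less_imp_le)
    also have "\<dots> \<le> A * (2 ^ Suc n * T) / ?R\<^sup>2"
      using R by (intro divide_right_mono A) auto
    also have "\<dots> = 2 * A / T * (1/2) ^ n"
      using T by (simp add: power2_eq_square field_simps power_one_over)
    finally show ?thesis .
  qed
  moreover have "4 * A / T * (1 - (1/2) ^ n) + 2 * A / T * (1/2) ^ n = 4 * A / T * (1 - (1/2) ^ Suc n)"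
    by (simp add: algebra_simps)
  ultimately show ?case using Suc by linarith
qed

text \<open>Finite sets F let the tail bound precede, and then prove, the summability of
  \<open>w\<close>.\<close>

lemma w_tail_finite:
  obtains K where "0 < K" "\<And>T F. T \<ge> 1 \<Longrightarrow> finite F \<Longrightarrow> (\<forall>j\<in>F. T < E j) \<Longrightarrow> (\<Sum>j\<in>F. w j) \<le> K / T"
proof -
  obtain A where A: "0 < A" "\<And>x. x \<ge> 1 \<Longrightarrow> (\<Sum>j | E j \<le> x. a j) \<le> A * x"
    using counting_le_linear by blast
  have "(\<Sum>j\<in>F. w j) \<le> 4 * A / T" if T: "T \<ge> 1" and F: "finite F" "\<forall>j\<in>F. T < E j" for T F
  proof -
    define B where "B = Max (insert 0 (E ` F))"
    have B: "E j \<le> B" if "j \<in> F" for j using that F(1) by (auto simp: B_def)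
    obtain n where n: "B < 2 ^ n" using real_arch_pow[of 2 B] by auto
    have "(2::real) ^ n \<le> 2 ^ n * T" using T by simp
    then have "E j \<le> 2 ^ n * T" if "j \<in> F" for j using B[OF that] n by linarith
    then have "F \<subseteq> {j. T < E j \<and> E j \<le> 2 ^ n * T}" using F(2) by blast
    then have "(\<Sum>j\<in>F. w j) \<le> (\<Sum>j | T < E j \<and> E j \<le> 2 ^ n * T. w j)"
      using finite_subset[OF _ E_finite[of "2 ^ n * T"]] w_pos
      by (intro sum_mono2) (auto intro: less_imp_le)
    also have "\<dots> \<le> 4 * A / T * (1 - (1/2) ^ n)" by (rule w_shell_sum[OF A T])
    also have "\<dots> \<le> 4 * A / T" using A T by (intro mult_left_le) auto
    finally show ?thesis .
  qed
  then show thesis using that[of "4 * A"] A by auto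
qed

lemma w_summable: "summable w"
proof -
  obtain K where K: "0 < K" "\<And>T F. T \<ge> 1 \<Longrightarrow> finite F \<Longrightarrow> (\<forall>j\<in>F. T < E j) \<Longrightarrow> (\<Sum>j\<in>F. w j) \<le> K / T"
    using w_tail_finite by blast
  show ?thesis
  proof (rule bounded_imp_summable)
    fix n
    have "(\<Sum>j\<le>n. w j) = (\<Sum>j\<in>{..n} \<inter> {j. E j \<le> 1}. w j) + (\<Sum>j\<in>{..n} \<inter> {j. 1 < E j}. w j)"
      by (subst sum.union_disjoint[symmetric]) (auto intro!: sum.cong)
    also have "\<dots> \<le> (\<Sum>j | E j \<le> 1. w j) + K / 1"
      using w_pos E_finite by (intro add_mono sum_mono2 K) (auto intro: less_imp_le)
    finally show "(\<Sum>j\<le>n. w j) \<le> (\<Sum>j | E j \<le> 1. w j) + K / 1" .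
  qed (simp add: w_pos less_imp_le)
qed

lemma suminf_w_pos: "0 < suminf w"
  using w_summable w_pos by (rule suminf_pos)

lemma w_tail:
  obtains K where "0 < K" "\<And>T. T > 0 \<Longrightarrow> (\<Sum>j. if E j \<le> T then 0 else w j) \<le> K / T"
proof -
  obtain K where K: "0 < K" "\<And>T F. T \<ge> 1 \<Longrightarrow> finite F \<Longrightarrow> (\<forall>j\<in>F. T < E j) \<Longrightarrow> (\<Sum>j\<in>F. w j) \<le> K / T"
    using w_tail_finite by blast
  have sm: "summable (\<lambda>j. if E j \<le> T then 0 else w j)" for T
    by (rule summable_comparison_test'[OF w_summable, of 0]) (simp add: w_pos less_imp_le)
  \<comment> \<open>The shell bound starts at T = 1. For smaller T the whole sum is at most suminf w
    / T, hence the second summand of the constant.\<close>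
  have "(\<Sum>j. if E j \<le> T then 0 else w j) \<le> (K + suminf w) / T" if T: "T > 0" for T
  proof (cases "T \<ge> 1")
    case True
    have "(\<Sum>j. if E j \<le> T then 0 else w j) \<le> K / T"
    proof (rule suminf_le_const[OF sm])
      fix n
      have "(\<Sum>j<n. if E j \<le> T then 0 else w j) = (\<Sum>j\<in>{..<n} \<inter> {j. T < E j}. w j)"
        by (rule sum.mono_neutral_cong_right) auto
      also have "\<dots> \<le> K / T" by (rule K(2)[OF True]) auto
      finally show "(\<Sum>j<n. if E j \<le> T then 0 else w j) \<le> K / T" .
    qed
    also have "\<dots> \<le> (K + suminf w) / T"
      using T suminf_w_pos by (intro divide_right_mono) auto
    finally show ?thesis .
  next
    case False
    have "(\<Sum>j. if E j \<le> T then 0 else w j) \<le> suminf w"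
      by (rule suminf_le[OF _ sm w_summable]) (simp add: w_pos less_imp_le)
    also have "\<dots> \<le> suminf w / T"
    proof -
      have "suminf w * T \<le> suminf w" using False T suminf_w_pos by (intro mult_left_le) auto
      then show ?thesis using T by (simp add: pos_le_divide_eq)
    qed
    also have "\<dots> \<le> (K + suminf w) / T" using K T by (intro divide_right_mono) auto
    finally show ?thesis .
  qed
  moreover have "K + suminf w > 0"
    using K suminf_w_pos by simp
  ultimately show thesis using that by blast
qed

text \<open>T enters the secular equation on [0,T] only through n, so a bound uniform in the number
  of terms is uniform in T.\<close>

lemma initial_segment:
  assumes "E 0 < T"
  obtains n where "0 < n" "{j. E j \<in> {0..T}} = {..<n}"
proof -
  define k where "k = (LEAST k. T < E k)"
  have "\<exists>k. T < E k"
  proof (rule ccontr)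
    assume "\<nexists>k. T < E k"
    then have "{j. E j \<le> T} = UNIV" by (auto simp: not_less)
    then show False using E_finite[of T] by simp
  qed
  then have k: "T < E k" unfolding k_def by (rule LeastI_ex)
  have iff: "E j \<le> T \<longleftrightarrow> j < k" for j
  proof
    assume "E j \<le> T"
    then have "E j < E k" using k by simp
    then show "j < k" using E_mono by (simp add: strict_mono_less)
  next
    assume "j < k"
    then show "E j \<le> T" unfolding k_def using not_less_Least by fastforce
  qed
  have "0 < k" using iff[of 0] assms by simp
  then show thesis using that[of k] iff E_nonneg by auto
qed

text \<open>If E 0 = 0, the term -a 0/\<mu> must be balanced by the other terms, whose sum is
  bounded above independently of n. If E 0 > 0, a small root forces the difference of the two sides
  at \<mu> = 0 to be negative and of size O(\<mu>), but the negative values of that difference stay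
  away from 0.\<close>

lemma positive_root_lower_bound:
  obtains c where "0 < c"
    "\<And>n \<mu>. 0 < n \<Longrightarrow> 0 < \<mu> \<Longrightarrow> (\<Sum>j<n. a j / (E j - \<mu>)) = (\<Sum>j<n. (E j - \<kappa>) * a j / (1 + (E j)\<^sup>2)) \<Longrightarrow>
      c \<le> \<mu>"
proof -
  define W where "W = suminf w"
  have W: "(\<Sum>j\<in>J. w j) \<le> W" if "finite J" for J
    unfolding W_def using w_summable w_pos that by (intro sum_le_suminf) (auto intro: less_imp_le)
  have W0: "W > 0" using W[of "{0}"] w_pos[of 0] by simp
  have one: "1 + (E j)\<^sup>2 > 0" for j by (simp add: add_pos_nonneg)
  show thesis
  proof (cases "E 0 = 0")
    case True
    have E1: "E 1 > 0" using strict_monoD[OF E_mono, of 0 1] True by simp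
    \<comment> \<open>Bounds (1 - \<kappa> \<mu> + (\<kappa> + \<mu>) x)/(x - \<mu>) for x \<ge> E 1
      and 0 < \<mu> < min 1 (E 1/2), where x - \<mu> \<ge> x/2.\<close>
    define C where "C = 2 * ((1 + \<bar>\<kappa>\<bar>) / E 1 + (1 + \<bar>\<kappa>\<bar>))"
    have C: "C \<ge> 0" using E1 by (simp add: C_def)
    \<comment> \<open>Strictly above the bound for 1/\<mu> obtained by isolating the term j = 0;
      hence the entry 1/Q in \<open>c\<close>, whose other entries make C applicable.\<close>
    define Q where "Q = \<bar>\<kappa>\<bar> + C * W / a 0 + 1"
    have Q: "Q > 0" using C W0 a_pos[of 0] unfolding Q_def by (intro add_nonneg_pos add_nonneg_nonneg) auto
    define c where "c = min (min 1 (E 1 / 2)) (1 / Q)"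
    have "c \<le> \<mu>" if n: "0 < n" and \<mu>: "0 < \<mu>" and
      root: "(\<Sum>j<n. a j / (E j - \<mu>)) = (\<Sum>j<n. (E j - \<kappa>) * a j / (1 + (E j)\<^sup>2))" for n \<mu>
    proof (rule ccontr)
      assume "\<not> c \<le> \<mu>"
      then have small: "\<mu> < 1" "\<mu> < E 1 / 2" "\<mu> < 1 / Q" by (auto simp: c_def)
      define s where "s j = a j / (E j - \<mu>) - (E j - \<kappa>) * a j / (1 + (E j)\<^sup>2)" for j
      have s: "s j \<le> C * w j" if j: "j \<noteq> 0" for j
      proof -
        have Ej: "E 1 \<le> E j" using E_mono j by (simp add: strict_mono_less_eq)
        then have pos: "E j > 0" "E j - \<mu> \<ge> E j / 2" using E1 small by auto
        have "s j = w j * ((1 - \<kappa> * \<mu> + (\<kappa> + \<mu>) * E j) / (E j - \<mu>))"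
        proof -
          have "E j - \<mu> \<noteq> 0" using pos by simp
          then show ?thesis using one[of j] unfolding s_def w_def
            by (simp add: field_simps power2_eq_square)
        qed
        also have "\<dots> \<le> w j * C"
        proof (intro mult_left_mono)
          have \<kappa>\<mu>: "\<bar>\<kappa> * \<mu>\<bar> \<le> \<bar>\<kappa>\<bar>" using small \<mu> by (simp add: abs_mult mult_left_le)
          have "1 - \<kappa> * \<mu> + (\<kappa> + \<mu>) * E j \<le> (1 + \<bar>\<kappa>\<bar>) + (1 + \<bar>\<kappa>\<bar>) * E j"
          proof (rule add_mono)
            show "1 - \<kappa> * \<mu> \<le> 1 + \<bar>\<kappa>\<bar>" using \<kappa>\<mu> by linarith
            have "\<kappa> + \<mu> \<le> 1 + \<bar>\<kappa>\<bar>" using small(1) by linarith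
            then show "(\<kappa> + \<mu>) * E j \<le> (1 + \<bar>\<kappa>\<bar>) * E j"
              using pos(1) by (intro mult_right_mono) auto
          qed
          then have "(1 - \<kappa> * \<mu> + (\<kappa> + \<mu>) * E j) / (E j - \<mu>) \<le>
              ((1 + \<bar>\<kappa>\<bar>) + (1 + \<bar>\<kappa>\<bar>) * E j) / (E j / 2)"
            using pos by (intro frac_le) (auto intro: add_nonneg_nonneg)
          also have "\<dots> = 2 * ((1 + \<bar>\<kappa>\<bar>) / E j + (1 + \<bar>\<kappa>\<bar>))"
            using pos by (simp add: field_simps)
          also have "\<dots> \<le> C" unfolding C_def
            using Ej E1 by (intro mult_left_mono add_right_mono divide_left_mono) auto
          finally show "(1 - \<kappa> * \<mu> + (\<kappa> + \<mu>) * E j) / (E j - \<mu>) \<le> C" .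
        qed (simp add: w_pos less_imp_le)
        finally show ?thesis by (simp add: mult.commute)
      qed
      have "0 = (\<Sum>j<n. s j)" using root by (simp add: s_def sum_subtractf)
      also have "\<dots> = s 0 + (\<Sum>j\<in>{..<n} - {0}. s j)"
        using n by (subst sum.remove[of _ 0]) auto
      also have "(\<Sum>j\<in>{..<n} - {0}. s j) \<le> (\<Sum>j\<in>{..<n} - {0}. C * w j)"
        by (intro sum_mono s) auto
      also have "\<dots> = C * (\<Sum>j\<in>{..<n} - {0}. w j)" by (simp add: sum_distrib_left)
      also have "\<dots> \<le> C * W" using C by (intro mult_left_mono W) auto
      also have "s 0 = a 0 * (\<kappa> - 1 / \<mu>)" unfolding s_def using True by (simp add: algebra_simps)
      finally have "a 0 * (1 / \<mu>) \<le> a 0 * \<kappa> + C * W" by (simp add: algebra_simps)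
      then have "1 / \<mu> \<le> \<kappa> + C * W / a 0" using a_pos[of 0] by (simp add: field_simps)
      also have "\<dots> < Q" by (simp add: Q_def)
      finally have "1 < Q * \<mu>" using \<mu> by (simp add: field_simps)
      then show False using small(3) Q by (simp add: field_simps)
    qed
    moreover have "c > 0" using E1 Q by (simp add: c_def)
    ultimately show thesis using that by blast
  next
    case False
    then have E0: "E 0 > 0" using E_nonneg[of 0] by simp
    have Epos: "E j \<ge> E 0" for j using E_mono by (simp add: strict_mono_less_eq)
    \<comment> \<open>The j-th term of the left side minus that of the right side at \<mu> = 0, over
      a common denominator.\<close>
    define f where "f j = w j * ((1 + \<kappa> * E j) / E j)" for j
    define F where "F n = (\<Sum>j<n. f j)" for n
    \<comment> \<open>For \<mu> \<le> E 0/2 the change of a term from 0 to \<mu> is at most 2 \<mu>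
      a j/(E j)^2, and a j/(E j)^2 = w j (1 + 1/(E j)^2).\<close>
    define D where "D = 2 * (1 + 1 / (E 0)\<^sup>2) * W"
    have D: "D > 0" using W0 E0 by (simp add: D_def add_pos_pos)
    \<comment> \<open>Moving \<mu> from 0 to a small positive value raises every term on the left by
      a positive amount of order \<mu>, so at a root F n must compensate with the opposite
      sign.\<close>
    have key: "- F n \<le> D * \<mu> \<and> F n < 0" if n: "0 < n" and \<mu>: "0 < \<mu>" "\<mu> \<le> E 0 / 2" and
      root: "(\<Sum>j<n. a j / (E j - \<mu>)) = (\<Sum>j<n. (E j - \<kappa>) * a j / (1 + (E j)\<^sup>2))" for n \<mu>
    proof -
      define r where "r j = a j / (E j - \<mu>) - a j / E j" for j
      have f_eq: "a j / (E j - \<mu>) - (E j - \<kappa>) * a j / (1 + (E j)\<^sup>2) = f j + r j" for j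
      proof -
        have "E j \<noteq> 0" using Epos[of j] E0 by simp
        then have "f j = a j / E j - (E j - \<kappa>) * a j / (1 + (E j)\<^sup>2)"
          using one[of j] unfolding f_def w_def by (simp add: field_simps power2_eq_square)
        then show ?thesis by (simp add: r_def)
      qed
      have "0 = (\<Sum>j<n. f j + r j)" using root unfolding f_eq[symmetric] by (simp add: sum_subtractf)
      then have sum0: "F n = - (\<Sum>j<n. r j)" by (simp add: F_def sum.distrib)
      have r: "0 < r j \<and> r j \<le> 2 * (1 + 1 / (E 0)\<^sup>2) * \<mu> * w j" for j
      proof -
        have pos: "E j > 0" "E j - \<mu> \<ge> E j / 2" using Epos[of j] E0 \<mu> by auto
        then have pos': "E j - \<mu> > 0" by linarith
        have r_eq: "r j = a j * \<mu> / (E j * (E j - \<mu>))" unfolding r_def using pos(1) pos' by (simp add: field_simps)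
        have "r j \<le> a j * \<mu> / (E j * (E j / 2))" unfolding r_eq
          using pos pos' a_pos[of j] \<mu> by (intro divide_left_mono mult_left_mono mult_pos_pos mult_nonneg_nonneg) auto
        also have "\<dots> = 2 * \<mu> * w j * ((1 + (E j)\<^sup>2) / (E j)\<^sup>2)"
          using pos by (simp add: a_eq power2_eq_square)
        also have "(1 + (E j)\<^sup>2) / (E j)\<^sup>2 = 1 + 1 / (E j)\<^sup>2" using pos by (simp add: add_divide_distrib)
        also have "2 * \<mu> * w j * (1 + 1 / (E j)\<^sup>2) \<le> 2 * \<mu> * w j * (1 + 1 / (E 0)\<^sup>2)"
          using Epos[of j] E0 \<mu> w_pos[of j]
          by (intro mult_left_mono add_left_mono divide_left_mono power_mono mult_pos_pos) auto
        finally show ?thesis unfolding r_eq using pos pos' a_pos[of j] \<mu> by (simp add: algebra_simps)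
      qed
      have "(\<Sum>j<n. r j) > 0" using n r by (intro sum_pos) auto
      moreover have "(\<Sum>j<n. r j) \<le> (\<Sum>j<n. 2 * (1 + 1 / (E 0)\<^sup>2) * \<mu> * w j)"
        using r by (intro sum_mono) auto
      moreover have "\<dots> = 2 * (1 + 1 / (E 0)\<^sup>2) * \<mu> * (\<Sum>j<n. w j)" by (simp add: sum_distrib_left)
      moreover have "\<dots> \<le> 2 * (1 + 1 / (E 0)\<^sup>2) * \<mu> * W" using \<mu> by (intro mult_left_mono W) auto
      ultimately show ?thesis unfolding sum0 D_def by (simp add: algebra_simps)
    qed
    \<comment> \<open>The increments of \<open>F\<close> have the sign of \<open>1 + \<kappa> E\<^sub>j\<close>, so once \<open>F\<close> is negative it keeps decreasing.\<close>
    have "\<exists>\<delta>>0. \<forall>n. F n < 0 \<longrightarrow> \<delta> \<le> - F n"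
    proof (cases "\<exists>n. F n < 0")
      case True
      \<comment> \<open>The first negative value of F is also the largest negative one, so its
        modulus serves as \<delta>.\<close>
      define k where "k = (LEAST n. F n < 0)"
      have Fk: "F k < 0" unfolding k_def using True by (rule LeastI_ex)
      have "k \<noteq> 0" using Fk by (auto simp: F_def intro: ccontr)
      then obtain i where i: "k = Suc i" by (cases k) auto
      have "\<not> F i < 0" using not_less_Least[of i "\<lambda>n. F n < 0"] i by (simp add: k_def)
      then have "f i < 0" using Fk by (simp add: F_def i)
      then have "1 + \<kappa> * E i < 0"
        using w_pos[of i] Epos[of i] E0 by (auto simp: f_def mult_less_0_iff divide_less_0_iff)
      then have "\<kappa> * E i < 0" by simp
      then have "\<kappa> < 0" using Epos[of i] E0 by (auto simp: mult_less_0_iff)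
      have fneg: "f j \<le> 0" if "i \<le> j" for j
      proof -
        have "\<kappa> * E j \<le> \<kappa> * E i" using E_mono that \<open>\<kappa> < 0\<close>
          by (intro mult_left_mono_neg) (auto simp: strict_mono_less_eq)
        then show ?thesis using \<open>1 + \<kappa> * E i < 0\<close> w_pos[of j] Epos[of j] E0
          by (auto simp: f_def intro!: mult_nonneg_nonpos divide_nonpos_pos)
      qed
      have "F n \<le> F k" if "k \<le> n" for n
        using that
      proof (induction n rule: dec_induct)
        case (step n)
        then have "f n \<le> 0" using i by (intro fneg) simp
        then show ?case using step by (simp add: F_def)
      qed simp
      moreover have "\<not> F n < 0" if "n < k" for n using not_less_Least that unfolding k_def by blast
      ultimately have "- F k \<le> - F n" if "F n < 0" for n using that by (metis neg_le_iff_le not_le)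
      then show ?thesis using Fk by (intro exI[of _ "- F k"]) auto
    \<comment> \<open>If F is never negative the condition is void, and 1 is an arbitrary positive
      value.\<close>
    qed (auto intro: exI[of _ 1])
    then obtain \<delta> where \<delta>: "\<delta> > 0" "\<And>n. F n < 0 \<Longrightarrow> \<delta> \<le> - F n" by blast
    have "min (E 0 / 2) (\<delta> / D) \<le> \<mu>" if "0 < n" "0 < \<mu>"
      "(\<Sum>j<n. a j / (E j - \<mu>)) = (\<Sum>j<n. (E j - \<kappa>) * a j / (1 + (E j)\<^sup>2))" for n \<mu>
    proof (cases "\<mu> \<le> E 0 / 2")
      case True
      then have "\<delta> \<le> D * \<mu>" using key[OF that(1,2) True that(3)] \<delta>(2)[of n] by linarith
      then show ?thesis using D by (simp add: min_le_iff_disj field_simps)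
    qed simp
    then show thesis using that[of "min (E 0 / 2) (\<delta> / D)"] \<delta> D E0 by simp
  qed
qed

end

section \<open>Positivity of the Riemannian volume\<close>

lemma det_2x2_pos:
  fixes A :: "real^2^2"
  assumes pos: "\<And>v. v \<noteq> 0 \<Longrightarrow> 0 < v \<bullet> (A *v v)"
  shows "0 < det A"
proof -
  \<comment> \<open>A maps \<open>v2\<close> to the vector (0, det A), so its quadratic form is A11
    det A; \<open>v1\<close> supplies A11 > 0.\<close>
  define v1 v2 :: "real^2" where "v1 = axis 1 1" and "v2 = vector [- (A $ 1 $ 2), A $ 1 $ 1]"
  have "v1 \<noteq> 0" by (simp add: v1_def axis_eq_0_iff)
  from pos[OF this] have A11: "0 < A $ 1 $ 1"
    by (simp add: v1_def inner_vec_def matrix_vector_mult_def axis_def sum_2)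
  then have "v2 \<noteq> 0" by (auto simp: v2_def vec_eq_iff forall_2)
  from pos[OF this] have "0 < A $ 1 $ 1 * det A"
    by (simp add: v2_def inner_vec_def matrix_vector_mult_def sum_2 det_2 algebra_simps)
  then show ?thesis using A11 by (simp add: zero_less_mult_iff)
qed

text \<open>In a chart the volume density is continuous and strictly positive, so a null open set
  would have a nonempty open image of Lebesgue measure zero.\<close>

lemma riemannian_volume_open_pos:
  assumes atlas: "smooth_atlas \<A>" and metric: "riemannian_metric \<A> G"
    and vol: "riemannian_volume \<A> G vol" and U: "open U" "U \<noteq> {}"
  shows "emeasure vol U \<noteq> 0"
proof
  assume null: "emeasure vol U = 0"
  obtain q where "q \<in> U" using U by blast
  obtain c where c: "c \<in> \<A>" "q \<in> fst c" using atlas unfolding smooth_atlas_def by blast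
  define B V where "B = U \<inter> fst c" and "V = snd c ` B"
  have fst: "open (fst c)" and img: "open (snd c ` fst c)"
    and hom: "homeomorphism (fst c) (snd c ` fst c) (snd c) (chart_inv c)"
    using atlas c unfolding smooth_atlas_def by auto
  have sets: "sets vol = sets borel" using vol by (simp add: riemannian_volume_def)
  have "open B" using U fst by (auto simp: B_def)
  then have "openin (top_of_set (fst c)) B" by (auto simp: B_def openin_open)
  then have "openin (top_of_set (snd c ` fst c)) V"
    unfolding V_def by (rule homeomorphism_imp_open_map[OF hom])
  then have "open V" using img by (rule openin_open_trans)
  have Vsub: "V \<subseteq> snd c ` fst c" by (auto simp: V_def B_def)
  have "V \<noteq> {}" using c \<open>q \<in> U\<close> by (auto simp: V_def B_def)
  have "smooth_on (snd c ` fst c) (G c)" using metric c unfolding riemannian_metric_def by blast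
  then have "continuous_on (snd c ` fst c) (G c)"
    unfolding smooth_on_def by (metis cont_diff_on.simps(1))
  then have "continuous_on V (G c)" using Vsub continuous_on_subset by blast
  then have "continuous_on V (\<lambda>z. sqrt (det (G c z)))"
    unfolding det_2 by (intro continuous_intros)
  then have meas: "(\<lambda>z. indicator V z *\<^sub>R sqrt (det (G c z))) \<in> borel_measurable borel"
    using \<open>open V\<close> by (intro borel_measurable_continuous_on_indicator) auto
  have det: "det (G c z) > 0" if "z \<in> V" for z
    using metric c that Vsub unfolding riemannian_metric_def by (intro det_2x2_pos) auto
  have "emeasure vol B \<le> emeasure vol U"
    using U sets by (intro emeasure_mono) (auto simp: B_def)
  then have "emeasure vol B = 0" using null by simp
  moreover have "emeasure vol B = (\<integral>\<^sup>+ z \<in> V. ennreal (sqrt (det (G c z))) \<partial>lborel)"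
    using vol c \<open>open B\<close> unfolding riemannian_volume_def V_def by (auto simp: B_def)
  moreover have "(\<integral>\<^sup>+ z \<in> V. ennreal (sqrt (det (G c z))) \<partial>lborel) =
      (\<integral>\<^sup>+ z. ennreal (indicator V z *\<^sub>R sqrt (det (G c z))) \<partial>lborel)"
    by (intro nn_integral_cong) (auto simp: indicator_def)
  ultimately have "(\<integral>\<^sup>+ z. ennreal (indicator V z *\<^sub>R sqrt (det (G c z))) \<partial>lborel) = 0" by simp
  then have "AE z in lborel. ennreal (indicator V z *\<^sub>R sqrt (det (G c z))) = 0"
    using meas by (subst (asm) nn_integral_0_iff_AE) auto
  then have "AE z in lborel. z \<notin> V"
    by eventually_elim (use det in \<open>fastforce simp: indicator_def ennreal_eq_0_iff split: if_splits\<close>)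
  then have "V \<in> null_sets lborel"
    using \<open>open V\<close> by (auto simp: AE_iff_null_sets)
  then have "negligible V"
    by (simp add: negligible_iff_null_sets null_sets_completionI)
  then show False using open_not_negligible \<open>open V\<close> \<open>V \<noteq> {}\<close> by blast
qed

text \<open>The point p may lie on the boundary; its neighbourhoods still meet the interior of M,
  and the open intersection has positive volume.\<close>

lemma surface_measure_pos:
  assumes "smooth_atlas \<A>" "riemannian_metric \<A> G" "riemannian_volume \<A> G vol"
    and M: "compact_surface_pw_smooth \<A> M" and "p \<in> M" and m: "m = restrict_space vol M"
    and U: "open U" "p \<in> U"
  shows "space m = M" "U \<inter> M \<in> sets m" "emeasure m (U \<inter> M) \<noteq> 0"
proof -
  have sets: "sets vol = sets borel" using assms(3) by (simp add: riemannian_volume_def)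
  have "compact M" "M \<subseteq> closure (interior M)" using M by (auto simp: compact_surface_pw_smooth_def)
  then have "M \<in> sets vol" using sets by (auto intro: borel_closed compact_imp_closed)
  have "space vol = UNIV" using sets_eq_imp_space_eq[OF sets] by simp
  then show "space m = M" by (simp add: m space_restrict_space)
  show "U \<inter> M \<in> sets m" using U sets \<open>space vol = UNIV\<close> \<open>M \<in> sets vol\<close>
    by (auto simp: m sets_restrict_space_iff)
  have "p \<in> closure (interior M)" using \<open>p \<in> M\<close> \<open>M \<subseteq> closure (interior M)\<close> by blast
  then have "U \<inter> interior M \<noteq> {}" using U open_Int_closure_eq_empty[of U "interior M"] by blast
  then have "emeasure vol (U \<inter> interior M) \<noteq> 0"
    using U by (intro riemannian_volume_open_pos[OF assms(1-3)]) auto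
  moreover have "emeasure vol (U \<inter> interior M) \<le> emeasure vol (U \<inter> M)"
    using U sets \<open>M \<in> sets vol\<close> interior_subset[of M] by (intro emeasure_mono) auto
  moreover have "emeasure m (U \<inter> M) = emeasure vol (U \<inter> M)"
    unfolding m using \<open>M \<in> sets vol\<close> \<open>space vol = UNIV\<close> by (intro emeasure_restrict_space) auto
  ultimately show "emeasure m (U \<inter> M) \<noteq> 0" by auto
qed

section \<open>Point evaluation on the domain of a self-adjoint operator\<close>

locale self_adjoint_graph =
  fixes m :: "'a measure" and T :: "'a l2_op"
  assumes adjoint: "adjoint_op m T = T"
begin

lemma graph_l2: "(f, g) \<in> T \<Longrightarrow> f \<in> l2 m" "(f, g) \<in> T \<Longrightarrow> g \<in> l2 m"
  using adjoint by (auto simp: adjoint_op_def)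

lemma graph_symmetric: "(f, g) \<in> T \<Longrightarrow> (u, v) \<in> T \<Longrightarrow> l2_inner m v f = l2_inner m u g"
proof -
  assume "(f, g) \<in> T" and uv: "(u, v) \<in> T"
  then have "(f, g) \<in> adjoint_op m T" using adjoint by simp
  then show ?thesis using uv unfolding adjoint_op_def by fast
qed

text \<open>Membership is tested by pairing against T itself, so linearity and closedness of T are
  inherited from the inner product.\<close>

lemma graphI:
  assumes "f \<in> l2 m" "g \<in> l2 m" "\<And>u v. (u, v) \<in> T \<Longrightarrow> l2_inner m v f = l2_inner m u g"
  shows "(f, g) \<in> T"
  by (subst adjoint[symmetric]) (use assms in \<open>auto simp: adjoint_op_def\<close>)

lemma graph_add:
  "(f, g) \<in> T \<Longrightarrow> (f', g') \<in> T \<Longrightarrow> (\<lambda>x. f x + f' x, \<lambda>x. g x + g' x) \<in> T"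
  by (rule graphI) (auto simp: l2_inner_add_right graph_l2 l2_add graph_symmetric)

lemma graph_cmult: "(f, g) \<in> T \<Longrightarrow> (\<lambda>x. c * f x, \<lambda>x. c * g x) \<in> T"
  by (rule graphI) (auto simp: graph_l2 l2_cmult graph_symmetric)

lemma graph_diff:
  "(f, g) \<in> T \<Longrightarrow> (f', g') \<in> T \<Longrightarrow> (\<lambda>x. f x - f' x, \<lambda>x. g x - g' x) \<in> T"
  by (rule graphI) (auto simp: l2_inner_diff_right graph_l2 l2_diff graph_symmetric)

lemma graph_zero: "(\<lambda>x. 0, \<lambda>x. 0) \<in> T"
  by (rule graphI) auto

lemma graph_sum:
  "(\<And>i. i \<in> A \<Longrightarrow> (f i, g i) \<in> T) \<Longrightarrow> (\<lambda>x. \<Sum>i\<in>A. f i x, \<lambda>x. \<Sum>i\<in>A. g i x) \<in> T"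
  by (induction A rule: infinite_finite_induct) (auto simp: graph_zero graph_add)

lemma graph_closed:
  assumes fg: "\<And>n. (f n, g n) \<in> T" and F: "F \<in> l2 m" "(\<lambda>n. l2_norm m (\<lambda>x. F x - f n x)) \<longlonglongrightarrow> 0"
    and G: "G \<in> l2 m" "(\<lambda>n. l2_norm m (\<lambda>x. G x - g n x)) \<longlonglongrightarrow> 0"
  shows "(F, G) \<in> T"
proof (rule graphI)
  fix u v assume uv: "(u, v) \<in> T"
  have "(\<lambda>n. l2_inner m v (f n)) \<longlonglongrightarrow> l2_inner m v F"
    using fg uv F by (intro tendsto_l2_inner_right) (auto intro: graph_l2)
  moreover have "(\<lambda>n. l2_inner m v (f n)) \<longlonglongrightarrow> l2_inner m u G"
    unfolding graph_symmetric[OF fg uv]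
    by (rule tendsto_l2_inner_right) (use graph_l2[OF fg] graph_l2[OF uv] G in auto)
  ultimately show "l2_inner m v F = l2_inner m u G" by (rule LIMSEQ_unique)
qed (use F G in auto)

text \<open>A gliding hump in the graph norm, for which \<open>T\<close> is complete because it is closed.\<close>

lemma uniform_boundedness:
  assumes \<xi>: "\<And>k. \<xi> k \<in> l2 m"
    and bounded: "\<And>f g. (f, g) \<in> T \<Longrightarrow> \<exists>B. \<forall>k. cmod (l2_inner m f (\<xi> k)) \<le> B"
  obtains K where "\<And>f g k. (f, g) \<in> T \<Longrightarrow> cmod (l2_inner m f (\<xi> k)) \<le> K * (l2_norm m f + l2_norm m g)"
proof (rule ccontr)
  assume "\<not> thesis"
  then have unbounded: "\<exists>f g k. (f, g) \<in> T \<and> K * (l2_norm m f + l2_norm m g) < cmod (l2_inner m f (\<xi> k))" for K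
    using that by (meson not_le)
  have unit: "\<exists>f g k. (f, g) \<in> T \<and> l2_norm m f \<le> 1 \<and> l2_norm m g \<le> 1 \<and> K < cmod (l2_inner m f (\<xi> k))" for K
  proof -
    obtain f g k where fg: "(f, g) \<in> T" and
      K: "K * (l2_norm m f + l2_norm m g) < cmod (l2_inner m f (\<xi> k))"
      using unbounded by blast
    define \<nu> where "\<nu> = l2_norm m f + l2_norm m g"
    have "\<nu> \<noteq> 0"
    proof
      assume "\<nu> = 0"
      then have "l2_norm m f = 0" using l2_norm_nonneg[of m f] l2_norm_nonneg[of m g] unfolding \<nu>_def by linarith
      then have "cmod (l2_inner m f (\<xi> k)) \<le> 0" using l2_Cauchy_Schwarz[OF graph_l2(1)[OF fg] \<xi>[of k]] by simp
      then show False using K \<open>\<nu> = 0\<close> by (simp add: \<nu>_def)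
    qed
    moreover have "\<nu> \<ge> 0" by (simp add: \<nu>_def)
    ultimately have \<nu>: "\<nu> > 0" by simp
    let ?c = "complex_of_real (1 / \<nu>)"
    have c: "cmod ?c = 1 / \<nu>" using \<nu> by (simp add: norm_divide)
    have "(\<lambda>x. ?c * f x, \<lambda>x. ?c * g x) \<in> T" by (rule graph_cmult[OF fg])
    moreover have "l2_norm m (\<lambda>x. ?c * f x) \<le> 1" "l2_norm m (\<lambda>x. ?c * g x) \<le> 1"
      unfolding l2_norm_cmult c using \<nu> by (auto simp: \<nu>_def field_simps)
    moreover have "K < cmod (l2_inner m (\<lambda>x. ?c * f x) (\<xi> k))"
      unfolding l2_inner_cmult_left norm_mult c using \<nu> K by (simp add: \<nu>_def field_simps)
    ultimately show ?thesis by blast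
  qed
  define P where "P n s \<longleftrightarrow> (fst s, fst (snd s)) \<in> T \<and> 0 < snd (snd s) \<and> snd (snd s) \<le> (1/2) ^ n"
    for n :: nat and s :: "('a \<Rightarrow> complex) \<times> ('a \<Rightarrow> complex) \<times> real"
  \<comment> \<open>A state is (f, g, \<epsilon>) with \<epsilon> the length allowed for the next
    move. A move makes some functional at least n in modulus. The last clause says that all later
    moves, of total length at most twice the new \<epsilon>, change this functional by at most
    1.\<close>
  define Q where "Q n s s' \<longleftrightarrow> l2_norm m (\<lambda>x. fst s' x - fst s x) \<le> snd (snd s) \<and>
      l2_norm m (\<lambda>x. fst (snd s') x - fst (snd s) x) \<le> snd (snd s) \<and>
      snd (snd s') \<le> snd (snd s) / 2 \<and>
      (\<exists>k. real n \<le> cmod (l2_inner m (fst s') (\<xi> k)) \<and> 2 * snd (snd s') * l2_norm m (\<xi> k) \<le> 1)"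
    for n :: nat and s s' :: "('a \<Rightarrow> complex) \<times> ('a \<Rightarrow> complex) \<times> real"
  have "\<exists>s. \<forall>n. P n (s n) \<and> Q n (s n) (s (Suc n))"
  proof (rule dependent_nat_choice)
    show "\<exists>s. P 0 s" by (rule exI[of _ "(\<lambda>x. 0, \<lambda>x. 0, 1)"]) (simp add: P_def graph_zero)
  next
    fix s n assume "P n s"
    obtain f g \<epsilon> where s: "s = (f, g, \<epsilon>)" by (cases s) auto
    have fg: "(f, g) \<in> T" and \<epsilon>: "0 < \<epsilon>" "\<epsilon> \<le> (1/2) ^ n" using \<open>P n s\<close> by (auto simp: P_def s)
    \<comment> \<open>The threshold n/\<epsilon> makes a step of length \<epsilon> along u change
      the functional by more than n.\<close>
    obtain u v k where uv: "(u, v) \<in> T" "l2_norm m u \<le> 1" "l2_norm m v \<le> 1"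
      and big: "real n / \<epsilon> < cmod (l2_inner m u (\<xi> k))"
      using unit[of "real n / \<epsilon>"] by blast
    have u2: "f \<in> l2 m" "u \<in> l2 m" using fg uv by (auto intro: graph_l2)
    \<comment> \<open>One of the two steps by \<open>\<plusminus> \<epsilon> u\<close> makes the functional large.\<close>
    have "\<exists>\<tau>\<in>{\<epsilon>, - \<epsilon>}. real n \<le> cmod (l2_inner m f (\<xi> k) + of_real \<tau> * l2_inner m u (\<xi> k))"
    proof (rule ccontr)
      let ?a = "l2_inner m f (\<xi> k)" and ?b = "of_real \<epsilon> * l2_inner m u (\<xi> k)"
      assume "\<not> ?thesis"
      then have small: "cmod (?a + ?b) < real n" "cmod (?a - ?b) < real n" by auto
      have "2 * cmod ?b = cmod ((?a + ?b) - (?a - ?b))" by (simp flip: norm_mult)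
      also have "\<dots> \<le> cmod (?a + ?b) + cmod (?a - ?b)" by (rule norm_triangle_ineq4)
      finally have "cmod ?b < real n" using small by linarith
      moreover have "cmod ?b = \<epsilon> * cmod (l2_inner m u (\<xi> k))" using \<epsilon> by (simp add: norm_mult)
      ultimately show False using big \<epsilon> by (simp add: field_simps)
    qed
    then obtain \<tau> where "\<tau> \<in> {\<epsilon>, - \<epsilon>}" and
      \<tau>_large: "real n \<le> cmod (l2_inner m f (\<xi> k) + of_real \<tau> * l2_inner m u (\<xi> k))"
      by blast
    then have \<tau>: "\<bar>\<tau>\<bar> = \<epsilon>" using \<epsilon> by auto
    \<comment> \<open>Adding 1 to the norm of \<xi> k keeps the bound on \<epsilon>' meaningful when
      \<xi> k vanishes.\<close>
    define f' g' \<epsilon>' where "f' = (\<lambda>x. f x + of_real \<tau> * u x)" and "g' = (\<lambda>x. g x + of_real \<tau> * v x)"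
      and "\<epsilon>' = min (\<epsilon> / 2) (1 / (2 * (l2_norm m (\<xi> k) + 1)))"
    have "(f', g') \<in> T" unfolding f'_def g'_def by (intro graph_add graph_cmult fg uv)
    moreover have "l2_norm m (\<xi> k) + 1 > 0" by (simp add: add_nonneg_pos)
    then have "0 < \<epsilon>'" "\<epsilon>' \<le> \<epsilon> / 2" using \<epsilon> by (simp_all add: \<epsilon>'_def)
    moreover have "2 * \<epsilon>' * l2_norm m (\<xi> k) \<le> 1"
    proof -
      have "\<epsilon>' * (2 * l2_norm m (\<xi> k)) \<le> 1 / (2 * (l2_norm m (\<xi> k) + 1)) * (2 * l2_norm m (\<xi> k))"
        by (intro mult_right_mono) (auto simp: \<epsilon>'_def)
      also have "\<dots> \<le> 1"
        by (simp add: divide_simps) (use l2_norm_nonneg[of m "\<xi> k"] in linarith)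
      finally show ?thesis by (simp add: mult_ac)
    qed
    moreover have "l2_norm m (\<lambda>x. f' x - f x) \<le> \<epsilon>" "l2_norm m (\<lambda>x. g' x - g x) \<le> \<epsilon>"
      using uv \<epsilon> \<tau> by (auto simp: f'_def g'_def l2_norm_cmult mult_left_le)
    moreover have "real n \<le> cmod (l2_inner m f' (\<xi> k))"
      unfolding f'_def using \<tau>_large u2 \<xi> by (simp add: l2_inner_add_left l2_cmult)
    ultimately have "P (Suc n) (f', g', \<epsilon>') \<and> Q n s (f', g', \<epsilon>')"
      using \<epsilon> by (auto simp: P_def Q_def s)
    then show "\<exists>s'. P (Suc n) s' \<and> Q n s s'" by blast
  qed
  then obtain s where s: "\<And>n. P n (s n)" "\<And>n. Q n (s n) (s (Suc n))" by blast
  define f g \<epsilon> where "f n = fst (s n)" and "g n = fst (snd (s n))" and "\<epsilon> n = snd (snd (s n))" for n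
  have fg: "(f n, g n) \<in> T" and \<epsilon>: "0 < \<epsilon> n" "\<epsilon> n \<le> (1/2) ^ n" for n
    using s(1)[of n] by (auto simp: P_def f_def g_def \<epsilon>_def)
  have step: "l2_norm m (\<lambda>x. f (Suc n) x - f n x) \<le> \<epsilon> n" "l2_norm m (\<lambda>x. g (Suc n) x - g n x) \<le> \<epsilon> n"
    "\<epsilon> (Suc n) \<le> \<epsilon> n / 2"
    and large: "\<exists>k. real n \<le> cmod (l2_inner m (f (Suc n)) (\<xi> k)) \<and> 2 * \<epsilon> (Suc n) * l2_norm m (\<xi> k) \<le> 1" for n
    using s(2)[of n] by (auto simp: Q_def f_def g_def \<epsilon>_def)
  note l2 = graph_l2[OF fg]
  obtain F where F: "F \<in> l2 m" "\<And>n. l2_norm m (\<lambda>x. F x - f n x) \<le> 2 * (1/2) ^ n"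
    using l2_complete_rapid[of f m] l2 order_trans[OF step(1) \<epsilon>(2)] by blast
  obtain G where G: "G \<in> l2 m" "\<And>n. l2_norm m (\<lambda>x. G x - g n x) \<le> 2 * (1/2) ^ n"
    using l2_complete_rapid[of g m] l2 order_trans[OF step(2) \<epsilon>(2)] by blast
  have null: "(\<lambda>n. 2 * (1/2::real) ^ n) \<longlonglongrightarrow> 0"
    using tendsto_mult_right_zero[OF LIMSEQ_power_zero[of "1/2::real"], of 2] by simp
  have "(F, G) \<in> T"
  proof (rule graph_closed[OF fg F(1) _ G(1)])
    show "(\<lambda>n. l2_norm m (\<lambda>x. F x - f n x)) \<longlonglongrightarrow> 0"
      by (rule Lim_null_comparison[OF _ null]) (use F(2) in simp)
    show "(\<lambda>n. l2_norm m (\<lambda>x. G x - g n x)) \<longlonglongrightarrow> 0"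
      by (rule Lim_null_comparison[OF _ null]) (use G(2) in simp)
  qed
  then obtain B where B: "\<And>k. cmod (l2_inner m F (\<xi> k)) \<le> B" using bounded by blast
  have tail: "l2_norm m (\<lambda>x. f (n + j) x - f n x) \<le> 2 * \<epsilon> n - 2 * \<epsilon> (n + j)" for n j
  proof (induction j)
    case (Suc j)
    have "l2_norm m (\<lambda>x. f (n + Suc j) x - f n x) \<le>
        l2_norm m (\<lambda>x. f (Suc (n + j)) x - f (n + j) x) + l2_norm m (\<lambda>x. f (n + j) x - f n x)"
      using l2_norm_triangle3[OF l2(1)[of "Suc (n + j)"] l2(1)[of "n + j"] l2(1)[of n]] by simp
    also have "\<dots> \<le> \<epsilon> (n + j) + (2 * \<epsilon> n - 2 * \<epsilon> (n + j))"
      using step(1) Suc by (intro add_mono)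
    also have "\<dots> \<le> 2 * \<epsilon> n - 2 * \<epsilon> (n + Suc j)" using step(3)[of "n + j"] by simp
    finally show ?case .
  qed simp
  \<comment> \<open>F was obtained with the rate (1/2)^n. Passing through f (n + j) and letting j
    grow replaces it by the rate \<epsilon> n, which is adapted to the norms of the \<xi> k.\<close>
  have dist: "l2_norm m (\<lambda>x. F x - f n x) \<le> 2 * \<epsilon> n" for n
  proof (rule LIMSEQ_le_const)
    show "(\<lambda>j. 2 * (1/2) ^ j + 2 * \<epsilon> n) \<longlonglongrightarrow> 2 * \<epsilon> n"
      using tendsto_add[OF null tendsto_const[of "2 * \<epsilon> n"]] by simp
    have "l2_norm m (\<lambda>x. F x - f n x) \<le> 2 * (1/2) ^ j + 2 * \<epsilon> n" for j
    proof -
      have "l2_norm m (\<lambda>x. F x - f n x) \<le>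
          l2_norm m (\<lambda>x. F x - f (n + j) x) + l2_norm m (\<lambda>x. f (n + j) x - f n x)"
        by (intro l2_norm_triangle3 F l2)
      also have "\<dots> \<le> 2 * (1/2) ^ (n + j) + (2 * \<epsilon> n - 2 * \<epsilon> (n + j))"
        by (intro add_mono F tail)
      also have "(1/2::real) ^ (n + j) \<le> (1/2) ^ j" by (rule power_decreasing) auto
      finally show ?thesis using \<epsilon>(1)[of "n + j"] by simp
    qed
    then show "\<exists>N. \<forall>j\<ge>N. l2_norm m (\<lambda>x. F x - f n x) \<le> 2 * (1/2) ^ j + 2 * \<epsilon> n" by blast
  qed
  obtain n where n: "B + 1 < real n" using reals_Archimedean2 by blast
  obtain k where k: "real n \<le> cmod (l2_inner m (f (Suc n)) (\<xi> k))" "2 * \<epsilon> (Suc n) * l2_norm m (\<xi> k) \<le> 1"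
    using large by blast
  have "cmod (l2_inner m (\<lambda>x. F x - f (Suc n) x) (\<xi> k)) \<le> l2_norm m (\<lambda>x. F x - f (Suc n) x) * l2_norm m (\<xi> k)"
    by (intro l2_Cauchy_Schwarz l2_diff F l2 \<xi>)
  also have "\<dots> \<le> 2 * \<epsilon> (Suc n) * l2_norm m (\<xi> k)" by (intro mult_right_mono dist) simp
  also have "\<dots> \<le> 1" by (rule k)
  finally have "cmod (l2_inner m F (\<xi> k) - l2_inner m (f (Suc n)) (\<xi> k)) \<le> 1"
    using F l2 \<xi> by (simp add: l2_inner_diff_left)
  then have "cmod (l2_inner m (f (Suc n)) (\<xi> k)) \<le> cmod (l2_inner m F (\<xi> k)) + 1"
    by (metis add_left_mono norm_minus_commute norm_triangle_sub order_trans)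
  then show False using k(1) n B[of k] by linarith
qed

end

text \<open>T stands for \<Delta> rather than -\<Delta>, hence the sign in \<open>eigen\<close>.
  Positive measure of the neighbourhoods of p allows averaging over them and so pins down the value
  at p of a continuous representative.\<close>

locale point_evaluation = orthonormal_basis m e + self_adjoint_graph m T
  for m :: "'a::{t2_space,second_countable_topology} measure" and e T +
  fixes ev :: "nat \<Rightarrow> real" and p :: 'a
  assumes eigen: "(e n, \<lambda>x. - (of_real (ev n) * e n x)) \<in> T"
    and e_cont: "continuous (at p within space m) (e n)"
    and evaluable: "domain_evaluable_at m p T"
    and nbhd: "open U \<Longrightarrow> p \<in> U \<Longrightarrow> U \<inter> space m \<in> sets m \<and> emeasure m (U \<inter> space m) \<noteq> 0"
    and nonvanishing: "\<exists>n. e n p \<noteq> 0"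
begin

lemma continuous_within_ball:
  assumes "continuous (at p within space m) (f :: 'a \<Rightarrow> complex)" "\<epsilon> > 0"
  obtains U where "open U" "p \<in> U" "\<And>x. x \<in> U \<Longrightarrow> x \<in> space m \<Longrightarrow> cmod (f x - f p) < \<epsilon>"
proof -
  have "\<forall>\<^sub>F x in at p within space m. dist (f x) (f p) < \<epsilon>"
    using assms unfolding continuous_within by (rule tendstoD)
  then obtain U where "open U" "p \<in> U" "\<forall>x\<in>U. x \<noteq> p \<longrightarrow> x \<in> space m \<longrightarrow> dist (f x) (f p) < \<epsilon>"
    unfolding eventually_at_topological by blast
  then show thesis using that[of U] assms(2) by (metis dist_norm dist_self)
qed

text \<open>Chebyshev's inequality for an eigenfunction with \<open>e n p \<noteq> 0\<close> bounds the measure near \<open>p\<close>.\<close>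

lemma finite_nbhd:
  obtains U where "open U" "p \<in> U" "emeasure m (U \<inter> space m) < \<infinity>"
proof -
  obtain n where n: "e n p \<noteq> 0" using nonvanishing by blast
  define \<delta> where "\<delta> = cmod (e n p) / 2"
  have \<delta>: "\<delta> > 0" using n by (simp add: \<delta>_def)
  obtain U where U: "open U" "p \<in> U" "\<And>x. x \<in> U \<Longrightarrow> x \<in> space m \<Longrightarrow> cmod (e n x - e n p) < \<delta>"
    using continuous_within_ball[OF e_cont \<delta>] by blast
  have sets: "U \<inter> space m \<in> sets m" using nbhd U by blast
  have large: "\<delta> \<le> cmod (e n x)" if "x \<in> U" "x \<in> space m" for x
  proof -
    have "cmod (e n p) \<le> cmod (e n x) + cmod (e n x - e n p)"
      by (metis norm_minus_commute norm_triangle_sub)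
    then show ?thesis using U(3)[OF that] by (simp add: \<delta>_def)
  qed
  have "ennreal (\<delta>\<^sup>2) * emeasure m (U \<inter> space m) = (\<integral>\<^sup>+x. ennreal (\<delta>\<^sup>2) * indicator (U \<inter> space m) x \<partial>m)"
    using sets by (simp add: nn_integral_cmult_indicator)
  also have "\<dots> \<le> (\<integral>\<^sup>+x. ennreal ((cmod (e n x))\<^sup>2) \<partial>m)"
    using large \<delta> by (intro nn_integral_mono) (auto simp: indicator_def intro!: ennreal_leI power_mono)
  also have "\<dots> = ennreal ((l2_norm m (e n))\<^sup>2)" by (rule ennreal_l2_norm_power2[OF in_l2])
  also have "\<dots> < \<infinity>" by simp
  finally have "emeasure m (U \<inter> space m) < \<infinity>"
    using \<delta> by (auto simp: ennreal_mult_eq_top_iff less_top[symmetric])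
  then show thesis using that U by blast
qed

text \<open>Averages ignore null sets, so those of f recover the value at p of any continuous
  representative. The averaging sets stay inside a neighbourhood of finite measure, which puts their
  normalised indicators into L^2.\<close>

lemma averages:
  obtains \<xi> where "\<And>k. \<xi> k \<in> l2 m"
    "\<And>f f'. f \<in> l2 m \<Longrightarrow> continuous_rep_at m p f f' \<Longrightarrow> (\<lambda>k. l2_inner m f (\<xi> k)) \<longlonglongrightarrow> f' p"
proof -
  obtain U where U: "open U" "p \<in> U" "emeasure m (U \<inter> space m) < \<infinity>" by (rule finite_nbhd)
  obtain A :: "nat \<Rightarrow> 'a set" where A: "\<And>k. open (A k)" "\<And>k. p \<in> A k"
    "\<And>S. open S \<Longrightarrow> p \<in> S \<Longrightarrow> \<forall>\<^sub>F k in sequentially. A k \<subseteq> S"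
    using countable_basis_at_decseq by metis
  define V where "V k = (A k \<inter> U) \<inter> space m" for k
  have V: "V k \<in> sets m" "emeasure m (V k) \<noteq> 0" for k
    using nbhd[of "A k \<inter> U"] A U by (auto simp: V_def)
  have "emeasure m (V k) \<le> emeasure m (U \<inter> space m)" for k
    using nbhd[of U] U by (intro emeasure_mono) (auto simp: V_def)
  then have fin: "emeasure m (V k) < \<infinity>" for k using U(3) order_le_less_trans by blast
  have pos: "measure m (V k) > 0" for k
    using V(2)[of k] fin[of k] by (simp add: measure_def enn2real_positive_iff zero_less_iff_neq_zero)
  define \<xi> where "\<xi> k x = complex_of_real (indicator (V k) x / measure m (V k))" for k x
  have ind: "integrable m (indicator (V k) :: 'a \<Rightarrow> real)" for k
    using V fin by (intro integrable_real_indicator) auto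
  have \<xi>: "\<xi> k \<in> l2 m" for k
  proof (rule l2_bounded_by)
    show "\<xi> k \<in> borel_measurable m" unfolding \<xi>_def using V(1)[of k] by measurable
    show "integrable m (\<lambda>x. indicator (V k) x / (measure m (V k))\<^sup>2)" using ind by simp
    show "(cmod (\<xi> k x))\<^sup>2 \<le> indicator (V k) x / (measure m (V k))\<^sup>2" for x
      by (auto simp: \<xi>_def indicator_def power_divide norm_divide)
  qed
  have "(\<lambda>k. l2_inner m f (\<xi> k)) \<longlonglongrightarrow> f' p" if f: "f \<in> l2 m" and rep: "continuous_rep_at m p f f'" for f f'
  proof (rule LIMSEQ_I)
    fix r :: real assume "r > 0"
    then have r: "r / 2 > 0" by simp
    obtain S where S: "open S" "p \<in> S" "\<And>x. x \<in> S \<Longrightarrow> x \<in> space m \<Longrightarrow> cmod (f' x - f' p) < r / 2"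
      using continuous_within_ball[of f' "r / 2"] rep r unfolding continuous_rep_at_def by blast
    have AE: "AE x in m. f' x = f x" using rep by (simp add: continuous_rep_at_def)
    have close: "norm (l2_inner m f (\<xi> k) - f' p) < r" if "A k \<subseteq> S" for k
    proof -
      have int\<xi>: "integrable m (\<xi> k)" unfolding \<xi>_def using ind by (intro integrable_of_real) simp
      have "(\<integral>x. \<xi> k x \<partial>m) = of_real (\<integral>x. indicator (V k) x / measure m (V k) \<partial>m)"
        unfolding \<xi>_def by (rule integral_complex_of_real)
      also have "(\<integral>x. indicator (V k) x / measure m (V k) \<partial>m) = 1"
        using pos[of k] V(1)[of k] sets.sets_into_space[OF V(1)[of k]] by (simp add: Int_absorb2)
      finally have one: "(\<integral>x. \<xi> k x \<partial>m) = 1" by simp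
      have cnj: "cnj (\<xi> k x) = \<xi> k x" for x by (simp add: \<xi>_def)
      have intf: "integrable m (\<lambda>x. f x * \<xi> k x)"
        using l2_inner_integrable[OF f \<xi>[of k]] by (simp add: cnj)
      have "l2_inner m f (\<xi> k) - f' p = (\<integral>x. f x * \<xi> k x \<partial>m) - (\<integral>x. f' p * \<xi> k x \<partial>m)"
        by (simp add: l2_inner_def cnj one)
      also have "\<dots> = (\<integral>x. (f x - f' p) * \<xi> k x \<partial>m)"
        using intf int\<xi> by (simp add: left_diff_distrib)
      finally have "norm (l2_inner m f (\<xi> k) - f' p) \<le> (\<integral>x. norm ((f x - f' p) * \<xi> k x) \<partial>m)"
        by (simp add: integral_norm_bound)
      also have "\<dots> \<le> (\<integral>x. r / 2 * (indicator (V k) x / measure m (V k)) \<partial>m)"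
      proof (rule integral_mono_AE)
        show "integrable m (\<lambda>x. norm ((f x - f' p) * \<xi> k x))"
          using intf int\<xi> by (intro integrable_norm) (simp add: left_diff_distrib)
        show "integrable m (\<lambda>x. r / 2 * (indicator (V k) x / measure m (V k)))" using ind by simp
        show "AE x in m. norm ((f x - f' p) * \<xi> k x) \<le> r / 2 * (indicator (V k) x / measure m (V k))"
        proof (use AE in eventually_elim)
          case (elim x)
          show ?case
          proof (cases "x \<in> V k")
            case True
            then have "cmod (f x - f' p) \<le> r / 2"
              using S(3)[of x] that elim by (auto simp: V_def intro!: less_imp_le)
            then have "cmod (f x - f' p) / measure m (V k) \<le> r / 2 / measure m (V k)"
              using pos[of k] by (intro divide_right_mono) auto
            then show ?thesis using True pos[of k]
              by (simp add: \<xi>_def norm_mult norm_divide)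
          qed (simp add: \<xi>_def)
        qed
      qed
      also have "\<dots> = r / 2 * (\<integral>x. indicator (V k) x / measure m (V k) \<partial>m)" by simp
      also have "(\<integral>x. indicator (V k) x / measure m (V k) \<partial>m) = 1"
        using pos[of k] V(1)[of k] sets.sets_into_space[OF V(1)[of k]] by (simp add: Int_absorb2)
      finally show ?thesis using \<open>r > 0\<close> by simp
    qed
    have "\<forall>\<^sub>F k in sequentially. norm (l2_inner m f (\<xi> k) - f' p) < r"
      using A(3)[OF S(1,2)] by eventually_elim (rule close)
    then show "\<exists>no. \<forall>k\<ge>no. norm (l2_inner m f (\<xi> k) - f' p) < r"
      unfolding eventually_sequentially .
  qed
  then show thesis using that \<xi> by blast
qed

text \<open>Convergent averages give a bound for each f separately; uniform boundedness turns it
  into one constant, which survives the limit.\<close>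

lemma evaluation_bounded:
  obtains K where "\<And>f g f'. (f, g) \<in> T \<Longrightarrow> continuous_rep_at m p f f' \<Longrightarrow>
    cmod (f' p) \<le> K * (l2_norm m f + l2_norm m g)"
proof -
  obtain \<xi> where \<xi>: "\<And>k. \<xi> k \<in> l2 m"
    "\<And>f f'. f \<in> l2 m \<Longrightarrow> continuous_rep_at m p f f' \<Longrightarrow> (\<lambda>k. l2_inner m f (\<xi> k)) \<longlonglongrightarrow> f' p"
    using averages by blast
  have "\<exists>B. \<forall>k. cmod (l2_inner m f (\<xi> k)) \<le> B" if fg: "(f, g) \<in> T" for f g
  proof -
    have "f \<in> op_dom T" using fg by (force simp: op_dom_def)
    then obtain f' where "continuous_rep_at m p f f'"
      using evaluable unfolding domain_evaluable_at_def by blast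
    then have "convergent (\<lambda>k. l2_inner m f (\<xi> k))"
      using \<xi>(2) graph_l2(1)[OF fg] convergentI by blast
    then have "Bseq (\<lambda>k. l2_inner m f (\<xi> k))" by (rule convergent_imp_Bseq)
    then show ?thesis unfolding Bseq_def by blast
  qed
  then obtain K where K: "\<And>f g k. (f, g) \<in> T \<Longrightarrow>
      cmod (l2_inner m f (\<xi> k)) \<le> K * (l2_norm m f + l2_norm m g)"
    using uniform_boundedness[of \<xi>] \<xi>(1) by blast
  have "cmod (f' p) \<le> K * (l2_norm m f + l2_norm m g)"
    if fg: "(f, g) \<in> T" and rep: "continuous_rep_at m p f f'" for f g f'
  proof (rule LIMSEQ_le_const2)
    show "(\<lambda>k. cmod (l2_inner m f (\<xi> k))) \<longlonglongrightarrow> cmod (f' p)"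
      using \<xi>(2)[OF graph_l2(1)[OF fg] rep] by (rule tendsto_norm)
    show "\<exists>N. \<forall>k\<ge>N. cmod (l2_inner m f (\<xi> k)) \<le> K * (l2_norm m f + l2_norm m g)"
      using K[OF fg] by blast
  qed
  then show thesis using that by blast
qed

lemma graph_coeff:
  assumes fg: "(f, g) \<in> T"
  shows "l2_inner m g (e n) = - of_real (ev n) * l2_inner m f (e n)"
proof -
  have "l2_inner m g (e n) = l2_inner m f (\<lambda>x. - (of_real (ev n) * e n x))"
    using graph_symmetric[OF eigen fg] .
  then show ?thesis by simp
qed

text \<open>The eigenfunction expansion converges in the graph norm, for which evaluation at \<open>p\<close> is bounded.\<close>

lemma evaluation_sums:
  assumes fg: "(f, g) \<in> T" and rep: "continuous_rep_at m p f f'"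
  shows "(\<lambda>n. l2_inner m f (e n) * e n p) sums f' p"
proof -
  obtain K where K: "\<And>f g f'. (f, g) \<in> T \<Longrightarrow> continuous_rep_at m p f f' \<Longrightarrow>
      cmod (f' p) \<le> K * (l2_norm m f + l2_norm m g)"
    using evaluation_bounded by blast
  define c where "c n = l2_inner m f (e n)" for n
  define F G where "F N = (\<lambda>x. f x - (\<Sum>n<N. c n * e n x))"
    and "G N = (\<lambda>x. g x - (\<Sum>n<N. c n * - (of_real (ev n) * e n x)))" for N
  have FG: "(F N, G N) \<in> T" for N
    unfolding F_def G_def by (intro graph_diff fg graph_sum graph_cmult eigen)
  have repF: "continuous_rep_at m p (F N) (\<lambda>x. f' x - (\<Sum>n<N. c n * e n x))" for N
    using rep unfolding continuous_rep_at_def F_def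
    by (auto intro!: continuous_intros e_cont)
  have "(\<lambda>N. l2_norm m (F N)) \<longlonglongrightarrow> 0"
    using expansion[OF graph_l2(1)[OF fg]] by (simp add: l2_sums_def F_def c_def)
  \<comment> \<open>Symmetry of T makes the images of the partial sums of f the partial sums of g,
    so the second components converge as well.\<close>
  moreover have "G N = (\<lambda>x. g x - (\<Sum>n<N. l2_inner m g (e n) * e n x))" for N
    unfolding G_def c_def graph_coeff[OF fg] by (simp add: fun_eq_iff mult_ac)
  then have "(\<lambda>N. l2_norm m (G N)) \<longlonglongrightarrow> 0"
    using expansion[OF graph_l2(2)[OF fg]] by (simp add: l2_sums_def)
  ultimately have null: "(\<lambda>N. K * (l2_norm m (F N) + l2_norm m (G N))) \<longlonglongrightarrow> 0"
    using tendsto_mult[OF tendsto_const[of K] tendsto_add] by fastforce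
  have "(\<lambda>N. (\<Sum>n<N. c n * e n p) - f' p) \<longlonglongrightarrow> 0"
    by (rule Lim_null_comparison[OF _ null])
       (use K[OF FG repF] in \<open>auto intro!: always_eventually simp: norm_minus_commute\<close>)
  then show ?thesis
    unfolding sums_def c_def[symmetric] by (simp add: LIM_zero_iff)
qed

end

section \<open>The point perturbation and its quasimodes\<close>

lemma l2_sums_add:
  assumes u: "\<And>j. u j \<in> l2 m" and f: "l2_sums m c u f" and g: "l2_sums m d u g"
  shows "l2_sums m (\<lambda>j. c j + d j) u (\<lambda>x. f x + g x)"
proof -
  have l2: "f \<in> l2 m" "g \<in> l2 m" using f g by (auto simp: l2_sums_def)
  have "(\<lambda>n. l2_norm m (\<lambda>x. f x + g x - (\<Sum>j<n. (c j + d j) * u j x))) \<longlonglongrightarrow> 0"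
  proof (rule Lim_null_comparison)
    show "(\<lambda>n. l2_norm m (\<lambda>x. f x - (\<Sum>j<n. c j * u j x)) + l2_norm m (\<lambda>x. g x - (\<Sum>j<n. d j * u j x)))
        \<longlonglongrightarrow> 0"
      using f g by (auto simp: l2_sums_def intro: tendsto_add_zero)
    have "l2_norm m (\<lambda>x. f x + g x - (\<Sum>j<n. (c j + d j) * u j x)) \<le>
        l2_norm m (\<lambda>x. f x - (\<Sum>j<n. c j * u j x)) + l2_norm m (\<lambda>x. g x - (\<Sum>j<n. d j * u j x))" for n
    proof -
      have "(\<lambda>x. f x + g x - (\<Sum>j<n. (c j + d j) * u j x)) =
          (\<lambda>x. (f x - (\<Sum>j<n. c j * u j x)) + (g x - (\<Sum>j<n. d j * u j x)))"
        by (auto simp: distrib_right sum.distrib)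
      then show ?thesis
        using l2 u by (simp only:) (intro l2_norm_triangle l2_diff l2_sum l2_cmult)
    qed
    then show "\<forall>\<^sub>F n in sequentially. norm (l2_norm m (\<lambda>x. f x + g x - (\<Sum>j<n. (c j + d j) * u j x))) \<le>
        l2_norm m (\<lambda>x. f x - (\<Sum>j<n. c j * u j x)) + l2_norm m (\<lambda>x. g x - (\<Sum>j<n. d j * u j x))"
      by simp
  qed
  then show ?thesis using l2 by (simp add: l2_sums_def l2_add)
qed

lemma l2_sums_cmult:
  assumes "l2_sums m c u f"
  shows "l2_sums m (\<lambda>j. a * c j) u (\<lambda>x. a * f x)"
proof -
  have "(\<lambda>x. a * f x - (\<Sum>j<n. a * c j * u j x)) = (\<lambda>x. a * (f x - (\<Sum>j<n. c j * u j x)))" for n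
    by (simp add: right_diff_distrib sum_distrib_left mult.assoc)
  then show ?thesis
    using assms by (auto simp: l2_sums_def l2_cmult l2_norm_cmult intro: tendsto_mult_right_zero)
qed

lemma l2_sums_finite:
  assumes u: "\<And>j. u j \<in> l2 m" and J: "finite J"
  shows "l2_sums m (\<lambda>j. if j \<in> J then c j else 0) u (\<lambda>x. \<Sum>j\<in>J. c j * u j x)"
proof -
  obtain N where N: "\<forall>j\<in>J. j < N" using J finite_nat_set_iff_bounded by blast
  have "(\<Sum>j<n. (if j \<in> J then c j else 0) * u j x) = (\<Sum>j\<in>J. c j * u j x)" if "n \<ge> N" for n x
    using that N J by (intro sum.mono_neutral_cong_right) auto
  then have "\<forall>\<^sub>F n in sequentially.
      l2_norm m (\<lambda>x. (\<Sum>j\<in>J. c j * u j x) - (\<Sum>j<n. (if j \<in> J then c j else 0) * u j x)) = 0"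
    unfolding eventually_sequentially by (intro exI[of _ N]) simp
  then show ?thesis
    unfolding l2_sums_def using u by (auto intro!: l2_sum l2_cmult tendsto_eventually)
qed

lemma l2_sums_unique_AE:
  assumes u: "\<And>j. u j \<in> l2 m" and f: "l2_sums m c u f" and g: "l2_sums m c u g"
  shows "AE x in m. f x = g x"
proof -
  have l2: "f \<in> l2 m" "g \<in> l2 m" using f g by (auto simp: l2_sums_def)
  have "l2_norm m (\<lambda>x. f x - g x) \<le> 0"
  proof (rule LIMSEQ_le_const)
    show "(\<lambda>n. l2_norm m (\<lambda>x. f x - (\<Sum>j<n. c j * u j x)) + l2_norm m (\<lambda>x. g x - (\<Sum>j<n. c j * u j x))) \<longlonglongrightarrow> 0"
      using f g by (auto simp: l2_sums_def intro: tendsto_add_zero)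
    have "l2_norm m (\<lambda>x. f x - g x) \<le>
        l2_norm m (\<lambda>x. f x - (\<Sum>j<n. c j * u j x)) + l2_norm m (\<lambda>x. g x - (\<Sum>j<n. c j * u j x))" for n
      using l2_norm_triangle3[of f m "\<lambda>x. \<Sum>j<n. c j * u j x" g] l2 u
        l2_norm_minus_commute[of m g "\<lambda>x. \<Sum>j<n. c j * u j x"]
      by (simp add: l2_sum l2_cmult)
    then show "\<exists>N. \<forall>n\<ge>N. l2_norm m (\<lambda>x. f x - g x) \<le>
        l2_norm m (\<lambda>x. f x - (\<Sum>j<n. c j * u j x)) + l2_norm m (\<lambda>x. g x - (\<Sum>j<n. c j * u j x))" by blast
  qed
  then have "l2_norm m (\<lambda>x. f x - g x) = 0" by (simp add: antisym)
  then show ?thesis using l2_norm_eq_0_iff[OF l2_diff[OF l2]] by simp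
qed

section \<open>Adjoints as graphs\<close>

lemma adjoint_opI:
  assumes "\<psi> \<in> l2 m" "\<eta> \<in> l2 m" "\<And>f h. (f, h) \<in> T \<Longrightarrow> l2_inner m h \<psi> = l2_inner m f \<eta>"
  shows "(\<psi>, \<eta>) \<in> adjoint_op m T"
  using assms by (auto simp: adjoint_op_def)

lemma adjoint_opD:
  assumes "(\<psi>, \<eta>) \<in> adjoint_op m T"
  shows "\<psi> \<in> l2 m" "\<eta> \<in> l2 m" "(f, h) \<in> T \<Longrightarrow> l2_inner m h \<psi> = l2_inner m f \<eta>"
  using assms by (auto simp: adjoint_op_def)

lemma adjoint_op_add:
  assumes "\<And>f h. (f, h) \<in> T \<Longrightarrow> f \<in> l2 m \<and> h \<in> l2 m"
    and "(\<psi>, \<eta>) \<in> adjoint_op m T" "(\<psi>', \<eta>') \<in> adjoint_op m T"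
  shows "(\<lambda>x. \<psi> x + \<psi>' x, \<lambda>x. \<eta> x + \<eta>' x) \<in> adjoint_op m T"
proof (rule adjoint_opI)
  fix f h assume "(f, h) \<in> T"
  then show "l2_inner m h (\<lambda>x. \<psi> x + \<psi>' x) = l2_inner m f (\<lambda>x. \<eta> x + \<eta>' x)"
    using assms(1)[of f h] adjoint_opD[OF assms(2)] adjoint_opD[OF assms(3)]
    by (simp add: l2_inner_add_right)
qed (use adjoint_opD[OF assms(2)] adjoint_opD[OF assms(3)] in \<open>auto intro: l2_add\<close>)

lemma adjoint_op_cmult:
  assumes "(\<psi>, \<eta>) \<in> adjoint_op m T"
  shows "(\<lambda>x. c * \<psi> x, \<lambda>x. c * \<eta> x) \<in> adjoint_op m T"
  using assms by (fastforce simp: adjoint_op_def l2_cmult)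

text \<open>The quasimode contains a series limit selected by choice and agrees with its
  decomposition into domain part and deficiency vectors only almost everywhere.\<close>

lemma adjoint_op_cong_AE:
  assumes "\<And>f h. (f, h) \<in> T \<Longrightarrow> f \<in> l2 m \<and> h \<in> l2 m"
    and "(\<psi>, \<eta>) \<in> adjoint_op m T" "\<psi>' \<in> l2 m" "AE x in m. \<psi>' x = \<psi> x"
  shows "(\<psi>', \<eta>) \<in> adjoint_op m T"
proof -
  have "l2_inner m h \<psi>' = l2_inner m h \<psi>" if "(f, h) \<in> T" for f h
    using assms that by (intro l2_inner_cong_AE) (auto simp: adjoint_op_def)
  then show ?thesis using assms(2,3) by (fastforce simp: adjoint_op_def)
qed

section \<open>The symmetric operator \<open>H_0\<close>, its adjoint and its deficiency
  vectors\<close>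

locale point_perturbation = point_evaluation m e T ev p + spectral_weights "\<lambda>j. (cmod (\<Phi> j p))\<^sup>2" E
  for m :: "'a::{t2_space,second_countable_topology} measure" and e T ev p
    and \<Phi> :: "nat \<Rightarrow> 'a \<Rightarrow> complex" and E :: "nat \<Rightarrow> real" +
  fixes r :: "nat \<Rightarrow> nat"
  assumes r: "bij_betw r UNIV {n. e n p \<noteq> 0}"
    and \<Phi>_eq: "\<Phi> j = e (r j)" and E_eq: "E j = ev (r j)"
begin

lemma inj_r: "inj r" and range_r: "range r = {n. e n p \<noteq> 0}"
  using r by (auto simp: bij_betw_def)

sublocale Phi: orthonormal_system m \<Phi>
  by standard (simp_all add: \<Phi>_eq in_l2 orthonormal inj_eq[OF inj_r])

lemma \<Phi>_p_nonzero: "\<Phi> j p \<noteq> 0"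
  using range_r by (auto simp: \<Phi>_eq)

lemma \<Phi>_graph: "(\<Phi> j, \<lambda>x. - (of_real (E j) * \<Phi> j x)) \<in> T"
  by (simp add: \<Phi>_eq E_eq eigen)

lemma bessel: "f \<in> l2 m \<Longrightarrow> summable (\<lambda>j. (cmod (l2_inner m f (\<Phi> j)))\<^sup>2)"
  using summable_reindex[OF sums_summable[OF parseval] inj_r, of f] by (simp add: \<Phi>_eq o_def)

lemma \<Phi>_coeff: "(f, g) \<in> T \<Longrightarrow> l2_inner m g (\<Phi> j) = - of_real (E j) * l2_inner m f (\<Phi> j)"
  by (simp add: \<Phi>_eq E_eq graph_coeff)

text \<open>The \<open>\<Phi> j\<close> enumerate the \<open>e n\<close> in another order, which is harmless by absolute summability.\<close>

lemma evaluation_sums_\<Phi>: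
  assumes fg: "(f, g) \<in> T" and rep: "continuous_rep_at m p f f'"
  shows "(\<lambda>j. l2_inner m f (\<Phi> j) * \<Phi> j p) sums f' p"
proof -
  let ?h = "\<lambda>n. l2_inner m f (e n) * e n p"
  have "summable (\<lambda>j. norm (l2_inner m f (\<Phi> j) * \<Phi> j p))"
  proof (rule summable_comparison_test')
    show "summable (\<lambda>j. (cmod (l2_inner m f (\<Phi> j)))\<^sup>2 + (cmod (l2_inner m g (\<Phi> j)))\<^sup>2 + w j)"
      by (intro summable_add bessel w_summable graph_l2[OF fg])
    fix j
    let ?c = "cmod (l2_inner m f (\<Phi> j))" and ?s = "1 + (E j)\<^sup>2"
    have s: "?s > 0" by (simp add: add_pos_nonneg)
    have "cmod (l2_inner m g (\<Phi> j)) = \<bar>E j\<bar> * ?c" by (simp add: \<Phi>_coeff[OF fg] norm_mult)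
    then have "?c\<^sup>2 + (cmod (l2_inner m g (\<Phi> j)))\<^sup>2 = ?s * ?c\<^sup>2"
      by (simp add: power_mult_distrib algebra_simps)
    moreover have "?c * cmod (\<Phi> j p) \<le> ?s * ?c\<^sup>2 + w j"
    proof -
      \<comment> \<open>AM-GM with the weight sqrt(1 + E_j^2) splits the product into a share of the
        squared graph norm of f and the summable \<open>w j\<close>.\<close>
      have "0 \<le> (sqrt ?s * ?c - cmod (\<Phi> j p) / sqrt ?s)\<^sup>2" by simp
      also have "\<dots> = ?s * ?c\<^sup>2 + w j - 2 * (?c * cmod (\<Phi> j p))"
      proof -
        have "sqrt ?s > 0" "(sqrt ?s)\<^sup>2 = ?s" using s by simp_all
        then show ?thesis unfolding w_def power2_diff power_mult_distrib power_divide
          by (simp only:) simp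
      qed
      finally have "2 * (?c * cmod (\<Phi> j p)) \<le> ?s * ?c\<^sup>2 + w j" by simp
      moreover have "0 \<le> ?c * cmod (\<Phi> j p)" by simp
      ultimately show ?thesis by linarith
    qed
    ultimately show "norm (norm (l2_inner m f (\<Phi> j) * \<Phi> j p)) \<le>
        ?c\<^sup>2 + (cmod (l2_inner m g (\<Phi> j)))\<^sup>2 + w j" by (simp add: norm_mult)
  qed
  then have norm: "summable (\<lambda>j. norm (?h (r j)))" by (simp add: \<Phi>_eq)
  define S where "S = (\<Sum>j. ?h (r j))"
  have S: "(\<lambda>j. ?h (r j)) sums S"
    unfolding S_def by (rule summable_sums[OF summable_norm_cancel[OF norm]])
  then have "((\<lambda>j. ?h (r j)) has_sum S) UNIV"
    by (rule norm_summable_imp_has_sum[OF norm])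
  then have "(?h has_sum S) {n. e n p \<noteq> 0}"
    using has_sum_reindex_bij_betw[OF r, of ?h S] by blast
  moreover have "(?h has_sum S) {n. e n p \<noteq> 0} \<longleftrightarrow> (?h has_sum S) UNIV"
    by (intro has_sum_cong_neutral) auto
  ultimately have "?h sums S" using has_sum_imp_sums by blast
  then have "S = f' p" using evaluation_sums[OF fg rep] sums_unique2 by blast
  then show ?thesis using S by (simp add: \<Phi>_eq)
qed

abbreviation H0 where "H0 \<equiv> H_0 m p T"

lemma H0_cases:
  assumes "(f, h) \<in> H0"
  obtains g f' where "(f, g) \<in> T" "h = (\<lambda>x. - g x)" "continuous_rep_at m p f f'" "f' p = 0"
  using assms by (auto simp: H_0_def dom_p_def)

lemma H0I:
  assumes "(f, g) \<in> T" "continuous_rep_at m p f f'" "f' p = 0"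
  shows "(f, \<lambda>x. - g x) \<in> H0" "f \<in> dom_p m p T"
proof -
  have "f \<in> op_dom T" using assms(1) by (force simp: op_dom_def)
  then show "f \<in> dom_p m p T" using assms by (auto simp: dom_p_def)
  then show "(f, \<lambda>x. - g x) \<in> H0" using assms(1) by (auto simp: H_0_def)
qed

lemma H0_l2: "(f, h) \<in> H0 \<Longrightarrow> f \<in> l2 m \<and> h \<in> l2 m"
  by (auto elim!: H0_cases intro: graph_l2 l2_uminus)

lemma graph_in_adjoint:
  assumes "(f, g) \<in> T"
  shows "(f, \<lambda>x. - g x) \<in> adjoint_op m H0"
proof -
  have "l2_inner m k f = l2_inner m u (\<lambda>x. - g x)" if "(u, k) \<in> H0" for u k
    using that by (rule H0_cases) (simp add: graph_symmetric[OF assms])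
  then show ?thesis using graph_l2[OF assms] by (auto simp: adjoint_op_def l2_uminus)
qed

lemma continuous_rep_e: "continuous_rep_at m p (e n) (e n)"
  by (simp add: continuous_rep_at_def e_cont)

lemma continuous_rep_\<Phi>: "continuous_rep_at m p (\<Phi> j) (\<Phi> j)"
  by (simp add: \<Phi>_eq continuous_rep_e)

text \<open>The difference h of two images is orthogonal to the domain of H_0. Testing against
  \<Phi>_k(p) \<Phi>_j - \<Phi>_j(p) \<Phi>_k, which vanishes at p, makes its coefficients
  proportional to the conjugates of \<Phi>_j(p), so they are zero by \<open>a_not_summable\<close>.
  The other basis elements vanish at p and lie in that domain themselves.\<close>

lemma adjoint_unique:
  assumes "(\<psi>, \<eta>) \<in> adjoint_op m H0" "(\<psi>, \<eta>') \<in> adjoint_op m H0"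
  shows "AE x in m. \<eta> x = \<eta>' x"
proof -
  define h where "h x = \<eta> x - \<eta>' x" for x
  have l2: "\<eta> \<in> l2 m" "\<eta>' \<in> l2 m" using assms by (auto simp: adjoint_op_def)
  then have h: "h \<in> l2 m" unfolding h_def by (rule l2_diff)
  have orth: "l2_inner m f h = 0" if fg: "(f, g) \<in> T" "continuous_rep_at m p f f'" "f' p = 0" for f g f'
  proof -
    have "(f, \<lambda>x. - g x) \<in> H0" using H0I(1) fg by blast
    then have "l2_inner m (\<lambda>x. - g x) \<psi> = l2_inner m f \<eta>" "l2_inner m (\<lambda>x. - g x) \<psi> = l2_inner m f \<eta>'"
      using assms by (fastforce simp: adjoint_op_def)+
    then show ?thesis unfolding h_def using l2 graph_l2[OF fg(1)] by (simp add: l2_inner_diff_right)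
  qed
  have proportional: "\<Phi> k p * l2_inner m (\<Phi> j) h = \<Phi> j p * l2_inner m (\<Phi> k) h" for j k
  proof -
    let ?f = "\<lambda>x. \<Phi> k p * \<Phi> j x - \<Phi> j p * \<Phi> k x"
    have "l2_inner m ?f h = 0"
    proof (rule orth)
      show "(?f, \<lambda>x. \<Phi> k p * (- (of_real (E j) * \<Phi> j x)) - \<Phi> j p * (- (of_real (E k) * \<Phi> k x))) \<in> T"
        by (intro graph_diff graph_cmult \<Phi>_graph)
      show "continuous_rep_at m p ?f ?f"
        using continuous_rep_\<Phi> unfolding continuous_rep_at_def by (auto intro!: continuous_intros)
    qed simp
    then show ?thesis using h by (simp add: l2_inner_diff_left l2_cmult Phi.in_l2)
  qed
  define \<nu> where "\<nu> = l2_inner m (\<Phi> 0) h / \<Phi> 0 p"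
  have coeff: "l2_inner m h (\<Phi> j) = cnj (\<nu> * \<Phi> j p)" for j
    using proportional[of 0 j] \<Phi>_p_nonzero[of 0]
    by (simp add: \<nu>_def l2_inner_cnj[of m h "\<Phi> j"] field_simps flip: complex_cnj_divide complex_cnj_mult)
  have "\<nu> = 0"
  proof (rule ccontr)
    assume "\<nu> \<noteq> 0"
    moreover have "summable (\<lambda>j. (cmod \<nu>)\<^sup>2 * (cmod (\<Phi> j p))\<^sup>2)"
      using bessel[OF h] by (simp add: coeff norm_mult power_mult_distrib)
    ultimately have "summable (\<lambda>j. (cmod (\<Phi> j p))\<^sup>2)" by (simp add: summable_cmult_iff)
    then show False using a_not_summable by simp
  qed
  have "l2_inner m h (e n) = 0" for n
  proof (cases "e n p = 0")
    case True
    then show ?thesis using orth[OF eigen continuous_rep_e True] by (simp add: l2_inner_cnj[of m h])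
  next
    case False
    then obtain j where "n = r j" using range_r by blast
    then show ?thesis using coeff[of j] \<open>\<nu> = 0\<close> by (simp add: \<Phi>_eq)
  qed
  then have "AE x in m. h x = 0" using h by (intro AE_eqI) auto
  then show ?thesis by (simp add: h_def)
qed

abbreviation g_pm where "g_pm z \<equiv> defect m p \<Phi> E z"

lemma
  assumes z: "z \<in> {\<i>, - \<i>}"
  shows E_minus_i_nonzero: "complex_of_real (E j) - z \<noteq> 0"
    and cmod_E_minus_i: "(cmod (complex_of_real (E j) - z))\<^sup>2 = 1 + (E j)\<^sup>2"
  using z by (auto simp: complex_eq_iff cmod_power2)

lemma defect_sums:
  assumes z: "z \<in> {\<i>, - \<i>}"
  shows "l2_sums m (\<lambda>j. cnj (\<Phi> j p) / (of_real (E j) - z)) \<Phi> (g_pm z)"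
  unfolding defect_def
proof (rule Phi.l2_sums_l2_suminf)
  show "summable (\<lambda>j. (cmod (cnj (\<Phi> j p) / (of_real (E j) - z)))\<^sup>2)"
    using w_summable by (simp add: norm_divide power_divide cmod_E_minus_i[OF z] w_def[abs_def])
qed

text \<open>Applying -\<Delta> - z to f multiplies its j-th coefficient by E_j - z, which cancels
  the denominator of the deficiency vector; what remains is the conjugate of the series for f(p),
  and f(p) = 0.\<close>

lemma defect_adjoint:
  assumes z: "z \<in> {\<i>, - \<i>}"
  shows "(g_pm z, \<lambda>x. z * g_pm z x) \<in> adjoint_op m H0"
proof -
  let ?d = "\<lambda>j. cnj (\<Phi> j p) / (of_real (E j) - z)"
  have l2: "g_pm z \<in> l2 m" using defect_sums[OF z] by (simp add: l2_sums_def)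
  have "l2_inner m k (g_pm z) = l2_inner m f (\<lambda>x. z * g_pm z x)" if "(f, k) \<in> H0" for f k
    using that
  proof (rule H0_cases)
    fix g f' assume fg: "(f, g) \<in> T" and k: "k = (\<lambda>x. - g x)"
      and rep: "continuous_rep_at m p f f'" "f' p = 0"
    have "(\<lambda>j. ?d j * l2_inner m (\<Phi> j) g) sums l2_inner m (g_pm z) g"
      "(\<lambda>j. ?d j * l2_inner m (\<Phi> j) f) sums l2_inner m (g_pm z) f"
      by (rule l2_sums_inner_left[OF defect_sums[OF z] Phi.in_l2 graph_l2(2)[OF fg]],
          rule l2_sums_inner_left[OF defect_sums[OF z] Phi.in_l2 graph_l2(1)[OF fg]])
    then have "(\<lambda>j. - (?d j * l2_inner m (\<Phi> j) g) - z * (?d j * l2_inner m (\<Phi> j) f)) sums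
        (- l2_inner m (g_pm z) g - z * l2_inner m (g_pm z) f)"
      by (intro sums_diff sums_minus sums_mult)
    moreover have "- (?d j * l2_inner m (\<Phi> j) g) - z * (?d j * l2_inner m (\<Phi> j) f) =
        cnj (l2_inner m f (\<Phi> j) * \<Phi> j p)" for j
    proof -
      have "l2_inner m (\<Phi> j) g = - of_real (E j) * l2_inner m (\<Phi> j) f"
        using \<Phi>_coeff[OF fg, of j] by (simp add: l2_inner_cnj[of m "\<Phi> j"])
      then have "- (?d j * l2_inner m (\<Phi> j) g) - z * (?d j * l2_inner m (\<Phi> j) f) =
          (of_real (E j) - z) * ?d j * l2_inner m (\<Phi> j) f"
      proof -
        have "- (d * (- x * a)) - z * (d * a) = (x - z) * d * a" for d x a :: complex
          by (simp add: algebra_simps)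
        then show ?thesis using \<open>l2_inner m (\<Phi> j) g = _\<close> by (simp only:)
      qed
      also have "\<dots> = cnj (\<Phi> j p) * l2_inner m (\<Phi> j) f"
        using E_minus_i_nonzero[OF z, of j] by simp
      finally show ?thesis by (simp add: l2_inner_cnj[of m "\<Phi> j" f])
    qed
    ultimately have "(\<lambda>j. cnj (l2_inner m f (\<Phi> j) * \<Phi> j p)) sums
        (- l2_inner m (g_pm z) g - z * l2_inner m (g_pm z) f)" by simp
    moreover have "(\<lambda>j. cnj (l2_inner m f (\<Phi> j) * \<Phi> j p)) sums cnj 0"
      using evaluation_sums_\<Phi>[OF fg rep(1)] rep(2) by (simp only: sums_cnj)
    ultimately have "- l2_inner m (g_pm z) g - z * l2_inner m (g_pm z) f = 0"
      using sums_unique2 by fastforce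
    then have "- l2_inner m (g_pm z) g = z * l2_inner m (g_pm z) f" by simp
    then show ?thesis
      by (simp add: k l2_inner_cnj[of m g] l2_inner_cnj[of m f] flip: complex_cnj_minus complex_cnj_mult)
  qed
  then show ?thesis using l2 by (auto simp: adjoint_op_def l2_cmult)
qed

end

text \<open>With u = e^(i \<Theta>), the second claim is the Cayley transform relation i (1 + u)/(1
  - u) = -cot(\<Theta>/2), cleared of its denominator.\<close>

lemma exp_i_relation:
  assumes "0 < \<Theta>" "\<Theta> < 2 * pi" "\<kappa> = sin \<Theta> / (1 - cos \<Theta>)"
  shows "exp (\<i> * of_real \<Theta>) \<noteq> 1"
    and "\<i> * (1 + exp (\<i> * of_real \<Theta>)) = - ((1 - exp (\<i> * of_real \<Theta>)) * of_real \<kappa>)"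
proof -
  have cos: "cos \<Theta> \<noteq> 1"
  proof
    assume "cos \<Theta> = 1"
    then obtain n :: int where n: "\<Theta> = of_int n * (2 * pi)"
      unfolding cos_one_2pi_int by (auto simp: mult.assoc)
    then have "0 < of_int n * (2 * pi)" "of_int n * (2 * pi) < 1 * (2 * pi)" using assms by auto
    then have "0 < real_of_int n" "real_of_int n < 1"
      by (simp_all only: zero_less_mult_iff mult_less_cancel_right) (use pi_gt_zero in auto)
    then show False by simp
  qed
  have e: "exp (\<i> * of_real \<Theta>) = Complex (cos \<Theta>) (sin \<Theta>)"
    by (simp add: exp_Euler complex_eq_iff cos_of_real sin_of_real)
  show "exp (\<i> * of_real \<Theta>) \<noteq> 1" using cos by (simp add: e complex_eq_iff)
  have "sin \<Theta> * \<kappa> = 1 + cos \<Theta>"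
  proof -
    have "sin \<Theta> * sin \<Theta> = (1 + cos \<Theta>) * (1 - cos \<Theta>)"
      using sin_cos_squared_add[of \<Theta>] by (simp add: power2_eq_square algebra_simps)
    then show ?thesis using cos by (simp add: assms(3) field_simps)
  qed
  moreover have "(1 - cos \<Theta>) * \<kappa> = sin \<Theta>" using cos by (simp add: assms(3))
  ultimately show "\<i> * (1 + exp (\<i> * of_real \<Theta>)) = - ((1 - exp (\<i> * of_real \<Theta>)) * of_real \<kappa>)"
    by (simp add: e complex_eq_iff)
qed

text \<open>At x = E_j these are the factors of the conjugate of \<Phi>_j(p) in (g_i - u g_(-i))/(1
  - u) and in its image under the adjoint, which multiplies the two deficiency vectors by i and -i.
  Dividing by 1 - u makes both real.\<close>

lemma defect_coefficient_identities:
  fixes u :: complex and x \<kappa> :: real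
  assumes "u \<noteq> 1" "\<i> * (1 + u) = - ((1 - u) * of_real \<kappa>)"
  shows "1 / (1 - u) * (1 / (of_real x - \<i>)) + - u / (1 - u) * (1 / (of_real x + \<i>)) =
      of_real ((x - \<kappa>) / (1 + x\<^sup>2))" (is ?A)
    and "1 / (1 - u) * (\<i> / (of_real x - \<i>)) + - u / (1 - u) * (- \<i> / (of_real x + \<i>)) =
      of_real (- (\<kappa> * x + 1) / (1 + x\<^sup>2))" (is ?B)
proof -
  have u: "1 - u \<noteq> 0" using assms(1) by simp
  have D: "(of_real x - \<i>) * (of_real x + \<i>) = complex_of_real (1 + x\<^sup>2)"
    by (simp add: complex_eq_iff power2_eq_square)
  have "1 + x\<^sup>2 > 0" by (simp add: add_pos_nonneg)
  then have D0: "complex_of_real (1 + x\<^sup>2) \<noteq> 0" using of_real_eq_0_iff by (metis less_irrefl)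
  have n: "of_real x - \<i> \<noteq> 0" "of_real x + \<i> \<noteq> 0" by (auto simp: complex_eq_iff)
  have inv: "1 / (of_real x - \<i>) = (of_real x + \<i>) / complex_of_real (1 + x\<^sup>2)"
    "1 / (of_real x + \<i>) = (of_real x - \<i>) / complex_of_real (1 + x\<^sup>2)"
    unfolding D[symmetric] using n by simp_all
  have frac: "1 / (1 - u) * (a / d) + - u / (1 - u) * (b / d) = (a - u * b) / ((1 - u) * d)" for a b d
    by (simp add: diff_divide_distrib)
  have A: "(of_real x + \<i>) - u * (of_real x - \<i>) = (1 - u) * of_real (x - \<kappa>)"
  proof -
    have "(of_real x + \<i>) - u * (of_real x - \<i>) = (1 - u) * of_real x + \<i> * (1 + u)"
      by (simp add: algebra_simps)
    then show ?thesis unfolding assms(2) by (simp add: algebra_simps)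
  qed
  have "1 / (1 - u) * (1 / (of_real x - \<i>)) + - u / (1 - u) * (1 / (of_real x + \<i>)) =
      ((of_real x + \<i>) - u * (of_real x - \<i>)) / ((1 - u) * complex_of_real (1 + x\<^sup>2))"
    unfolding inv by (rule frac)
  also have "\<dots> = of_real ((x - \<kappa>) / (1 + x\<^sup>2))" unfolding A using u by simp
  finally show ?A .
  have B: "\<i> * (of_real x + \<i>) + u * (\<i> * (of_real x - \<i>)) = (1 - u) * of_real (- (\<kappa> * x + 1))"
  proof -
    have "\<i> * (of_real x + \<i>) + u * (\<i> * (of_real x - \<i>)) = \<i> * (1 + u) * of_real x - (1 - u)"
      by (simp add: algebra_simps)
    then show ?thesis unfolding assms(2) by (simp add: algebra_simps)
  qed
  have "\<i> / (of_real x - \<i>) = \<i> * (of_real x + \<i>) / complex_of_real (1 + x\<^sup>2)"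
    "- \<i> / (of_real x + \<i>) = - (\<i> * (of_real x - \<i>)) / complex_of_real (1 + x\<^sup>2)"
    using arg_cong[OF inv(1), of "\<lambda>y. \<i> * y"] arg_cong[OF inv(2), of "\<lambda>y. - \<i> * y"] by simp_all
  then have "1 / (1 - u) * (\<i> / (of_real x - \<i>)) + - u / (1 - u) * (- \<i> / (of_real x + \<i>)) =
      (\<i> * (of_real x + \<i>) - u * - (\<i> * (of_real x - \<i>))) / ((1 - u) * complex_of_real (1 + x\<^sup>2))"
    by (simp only: frac)
  also have "\<dots> = (\<i> * (of_real x + \<i>) + u * (\<i> * (of_real x - \<i>))) / ((1 - u) * complex_of_real (1 + x\<^sup>2))"
    by simp
  also have "\<dots> = of_real (- (\<kappa> * x + 1) / (1 + x\<^sup>2))" unfolding B using u by simp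
  finally show ?B .
qed

section \<open>Coefficients of the quasimodes and of their residuals\<close>

context point_perturbation
begin

definition quasi_coeff :: "real \<Rightarrow> real \<Rightarrow> real set \<Rightarrow> real \<Rightarrow> nat \<Rightarrow> real" where
  "quasi_coeff \<kappa> \<sigma> I \<mu> j =
     (if E j \<in> I then 1 / (E j - \<mu>) else \<sigma> * ((E j - \<kappa>) / (1 + (E j)\<^sup>2)))"

text \<open>For E_j \<noteq> \<mu> this is (E_j - \<mu>) times the quasimode factor, minus \<sigma>.
  Indeed z/(E_j - z) = E_j/(E_j - z) - 1, so the adjoint multiplies by E_j and subtracts the total
  weight \<sigma> of the two deficiency vectors.\<close>

definition residual_coeff :: "real \<Rightarrow> real \<Rightarrow> real set \<Rightarrow> real \<Rightarrow> nat \<Rightarrow> real" where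
  "residual_coeff \<kappa> \<sigma> I \<mu> j =
     (if E j \<in> I then 1 - \<sigma> else - \<sigma> * (((\<kappa> + \<mu>) * E j + (1 - \<kappa> * \<mu>)) / (1 + (E j)\<^sup>2)))"

lemma finite_bounded_E: "bounded I \<Longrightarrow> finite {j. E j \<in> I}"
  by (metis (mono_tags, lifting) E_finite bounded_real abs_le_D1 finite_subset mem_Collect_eq subsetI)

lemma tail_sums:
  "l2_sums m (\<lambda>j. if E j \<notin> I then of_real (E j - \<kappa>) * cnj (\<Phi> j p) / of_real (1 + (E j)\<^sup>2) else 0) \<Phi>
    (l2_suminf m (\<lambda>j. if E j \<notin> I then of_real (E j - \<kappa>) * cnj (\<Phi> j p) / of_real (1 + (E j)\<^sup>2) else 0) \<Phi>)"
proof (rule Phi.l2_sums_l2_suminf, rule summable_comparison_test')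
  show "summable (\<lambda>j. (1 + \<kappa>\<^sup>2) * w j)" using w_summable by (rule summable_mult)
  fix j
  let ?t = "if E j \<notin> I then of_real (E j - \<kappa>) * cnj (\<Phi> j p) / complex_of_real (1 + (E j)\<^sup>2) else 0"
  have s: "1 + (E j)\<^sup>2 > 0" by (simp add: add_pos_nonneg)
  \<comment> \<open>Cauchy-Schwarz for (E_j, 1) and (1, -\<kappa>); the defect is the square of 1 +
    \<kappa> E_j.\<close>
  have "(E j - \<kappa>)\<^sup>2 \<le> (1 + \<kappa>\<^sup>2) * (1 + (E j)\<^sup>2)"
    using zero_le_power2[of "1 + \<kappa> * E j"] by (simp add: power2_eq_square algebra_simps)
  then have "(E j - \<kappa>)\<^sup>2 / (1 + (E j)\<^sup>2) \<le> 1 + \<kappa>\<^sup>2" using s by (simp add: pos_divide_le_eq)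
  then have "(E j - \<kappa>)\<^sup>2 / (1 + (E j)\<^sup>2) * w j \<le> (1 + \<kappa>\<^sup>2) * w j"
    using w_pos[of j] by (intro mult_right_mono) auto
  moreover have "(cmod (of_real (E j - \<kappa>) * cnj (\<Phi> j p) / complex_of_real (1 + (E j)\<^sup>2)))\<^sup>2 =
      (E j - \<kappa>)\<^sup>2 / (1 + (E j)\<^sup>2) * w j"
    using s unfolding w_def norm_divide norm_mult norm_of_real power_divide power_mult_distrib power2_abs
    by (simp add: power2_eq_square)
  moreover have "0 \<le> (1 + \<kappa>\<^sup>2) * w j" using w_pos[of j] by simp
  ultimately show "norm ((cmod ?t)\<^sup>2) \<le> (1 + \<kappa>\<^sup>2) * w j" by simp
qed

lemma quasimode_sums:
  assumes J: "finite {j. E j \<in> I}"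
  shows "l2_sums m (\<lambda>j. of_real (quasi_coeff \<kappa> \<sigma> I \<mu> j) * cnj (\<Phi> j p)) \<Phi>
    (quasimode_fun m p \<Phi> E \<kappa> \<sigma> I \<mu>)"
proof -
  have "(\<lambda>j. (if j \<in> {j. E j \<in> I} then cnj (\<Phi> j p) / of_real (E j - \<mu>) else 0) + of_real \<sigma> *
        (if E j \<notin> I then of_real (E j - \<kappa>) * cnj (\<Phi> j p) / of_real (1 + (E j)\<^sup>2) else 0)) =
      (\<lambda>j. of_real (quasi_coeff \<kappa> \<sigma> I \<mu> j) * cnj (\<Phi> j p))"
    by (auto simp: quasi_coeff_def)
  then have coeffs: "(\<lambda>j. of_real (quasi_coeff \<kappa> \<sigma> I \<mu> j) * cnj (\<Phi> j p)) =
      (\<lambda>j. (if j \<in> {j. E j \<in> I} then cnj (\<Phi> j p) / of_real (E j - \<mu>) else 0) + of_real \<sigma> *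
        (if E j \<notin> I then of_real (E j - \<kappa>) * cnj (\<Phi> j p) / of_real (1 + (E j)\<^sup>2) else 0))"
    by (rule sym)
  show ?thesis
    unfolding quasimode_fun_def coeffs
    by (intro l2_sums_add[OF Phi.in_l2] l2_sums_cmult l2_sums_finite[OF Phi.in_l2 J] tail_sums)
qed

text \<open>One decomposition of \<psi> into a finite sum vanishing at p and a multiple of the
  boundary vector yields membership in the domain and the action of H_\<Theta>; Parseval's identity
  then gives both norms.\<close>

lemma quasimode_norms:
  assumes J: "finite {j. E j \<in> I}" and sec: "secular_solution p \<Phi> E \<kappa> \<sigma> I \<mu>"
    and \<Theta>: "0 < \<Theta>" "\<Theta> < 2 * pi" "\<kappa> = sin \<Theta> / (1 - cos \<Theta>)"
  defines "\<psi> \<equiv> quasimode_fun m p \<Phi> E \<kappa> \<sigma> I \<mu>" and "H \<equiv> H_Theta m p T \<Phi> E \<Theta>"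
  shows "\<psi> \<in> op_dom H"
    and "(\<lambda>j. (quasi_coeff \<kappa> \<sigma> I \<mu> j)\<^sup>2 * (cmod (\<Phi> j p))\<^sup>2) sums (l2_norm m \<psi>)\<^sup>2"
    and "(\<lambda>j. (residual_coeff \<kappa> \<sigma> I \<mu> j)\<^sup>2 * (cmod (\<Phi> j p))\<^sup>2) sums
      (l2_norm m (\<lambda>x. op_apply H \<psi> x - of_real \<mu> * \<psi> x))\<^sup>2"
proof -
  define u where "u = exp (\<i> * complex_of_real \<Theta>)"
  have u: "u \<noteq> 1" "\<i> * (1 + u) = - ((1 - u) * of_real \<kappa>)"
    unfolding u_def using exp_i_relation[OF \<Theta>] by auto
  \<comment> \<open>The ratio of the two weights is the boundary condition; the scale makes their
    combination agree with \<psi> outside I.\<close>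
  define ap am where "ap = of_real \<sigma> * (1 / (1 - u))" and "am = of_real \<sigma> * (- u / (1 - u))"
  \<comment> \<open>What is left of the coefficients of \<psi> on I after the boundary vector is
    removed.\<close>
  define b where "b j = complex_of_real (1 / (E j - \<mu>) - \<sigma> * ((E j - \<kappa>) / (1 + (E j)\<^sup>2))) * cnj (\<Phi> j p)" for j
  define J where "J = {j. E j \<in> I}"
  have finJ: "finite J" using J by (simp add: J_def)
  define \<psi>' where "\<psi>' x = (\<Sum>j\<in>J. b j * \<Phi> j x)" for x
  define g' where "g' x = (\<Sum>j\<in>J. b j * - (of_real (E j) * \<Phi> j x))" for x
  define \<eta> where "\<eta> x = - g' x + ap * (\<i> * g_pm \<i> x) + am * (- \<i> * g_pm (- \<i>) x)" for x
  have \<psi>'T: "(\<psi>', g') \<in> T"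
    unfolding \<psi>'_def g'_def by (intro graph_sum graph_cmult \<Phi>_graph)
  have "continuous_rep_at m p \<psi>' \<psi>'"
    using continuous_rep_\<Phi> unfolding continuous_rep_at_def \<psi>'_def by (auto intro!: continuous_intros)
  moreover have "\<psi>' p = 0"
  proof -
    have "\<psi>' p = (\<Sum>j\<in>J. of_real ((cmod (\<Phi> j p))\<^sup>2 / (E j - \<mu>) -
        \<sigma> * ((E j - \<kappa>) * (cmod (\<Phi> j p))\<^sup>2 / (1 + (E j)\<^sup>2))))"
      unfolding \<psi>'_def b_def
    proof (intro sum.cong refl)
      fix j
      have "cnj (\<Phi> j p) * \<Phi> j p = of_real ((cmod (\<Phi> j p))\<^sup>2)"
        by (simp add: complex_norm_square[symmetric] mult.commute)
      then show "complex_of_real (1 / (E j - \<mu>) - \<sigma> * ((E j - \<kappa>) / (1 + (E j)\<^sup>2))) * cnj (\<Phi> j p) * \<Phi> j p =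
          of_real ((cmod (\<Phi> j p))\<^sup>2 / (E j - \<mu>) - \<sigma> * ((E j - \<kappa>) * (cmod (\<Phi> j p))\<^sup>2 / (1 + (E j)\<^sup>2)))"
        unfolding mult.assoc by (simp only: flip: of_real_mult) (simp add: algebra_simps)
    qed
    also have "\<dots> = of_real ((\<Sum>j\<in>J. (cmod (\<Phi> j p))\<^sup>2 / (E j - \<mu>)) -
        \<sigma> * (\<Sum>j\<in>J. (E j - \<kappa>) * (cmod (\<Phi> j p))\<^sup>2 / (1 + (E j)\<^sup>2)))"
      by (simp add: sum_subtractf sum_distrib_left)
    \<comment> \<open>The secular equation enters as the vanishing of \<psi>' at p.\<close>
    also have "\<dots> = 0" using sec by (simp add: secular_solution_def J_def)
    finally show ?thesis .
  qed
  ultimately have dom: "\<psi>' \<in> dom_p m p T" using H0I(2)[OF \<psi>'T] by blast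

  have pm: "\<i> \<in> {\<i>, - \<i>}" "- \<i> \<in> {\<i>, - \<i>}" by auto
  note l2_sums_intros = l2_sums_add[OF Phi.in_l2] l2_sums_cmult l2_sums_finite[OF Phi.in_l2 finJ]
  have "l2_sums m (\<lambda>j. (if j \<in> J then b j else 0) + ap * (cnj (\<Phi> j p) / (of_real (E j) - \<i>)) +
      am * (cnj (\<Phi> j p) / (of_real (E j) - - \<i>))) \<Phi> (\<lambda>x. \<psi>' x + ap * g_pm \<i> x + am * g_pm (- \<i>) x)"
    unfolding \<psi>'_def by (intro l2_sums_intros defect_sums pm)
  moreover have "(if j \<in> J then b j else 0) + ap * (cnj (\<Phi> j p) / (of_real (E j) - \<i>)) +
      am * (cnj (\<Phi> j p) / (of_real (E j) - - \<i>)) = of_real (quasi_coeff \<kappa> \<sigma> I \<mu> j) * cnj (\<Phi> j p)" for j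
  proof -
    have "ap * (cnj (\<Phi> j p) / (of_real (E j) - \<i>)) + am * (cnj (\<Phi> j p) / (of_real (E j) - - \<i>)) =
        of_real \<sigma> * (1 / (1 - u) * (1 / (of_real (E j) - \<i>)) + - u / (1 - u) * (1 / (of_real (E j) + \<i>))) *
          cnj (\<Phi> j p)"
      by (simp add: ap_def am_def algebra_simps)
    also have "\<dots> = of_real (\<sigma> * ((E j - \<kappa>) / (1 + (E j)\<^sup>2))) * cnj (\<Phi> j p)"
      unfolding defect_coefficient_identities(1)[OF u] by simp
    finally show ?thesis
      by (simp only: add.assoc) (auto simp: b_def quasi_coeff_def J_def algebra_simps)
  qed
  ultimately have decomposition: "l2_sums m (\<lambda>j. of_real (quasi_coeff \<kappa> \<sigma> I \<mu> j) * cnj (\<Phi> j p)) \<Phi>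
      (\<lambda>x. \<psi>' x + ap * g_pm \<i> x + am * g_pm (- \<i>) x)" by simp
  have \<psi>_sums: "l2_sums m (\<lambda>j. of_real (quasi_coeff \<kappa> \<sigma> I \<mu> j) * cnj (\<Phi> j p)) \<Phi> \<psi>"
    unfolding \<psi>_def by (rule quasimode_sums[OF J])
  have AE: "AE x in m. \<psi> x = \<psi>' x + ap * g_pm \<i> x + am * g_pm (- \<i>) x"
    by (rule l2_sums_unique_AE[OF Phi.in_l2 \<psi>_sums decomposition])
  show "(\<lambda>j. (quasi_coeff \<kappa> \<sigma> I \<mu> j)\<^sup>2 * (cmod (\<Phi> j p))\<^sup>2) sums (l2_norm m \<psi>)\<^sup>2"
    using Phi.l2_sums_norm[OF \<psi>_sums] by (simp add: norm_mult power_mult_distrib)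

  have adj: "(\<lambda>x. \<psi>' x + ap * g_pm \<i> x + am * g_pm (- \<i>) x, \<eta>) \<in> adjoint_op m H0"
    unfolding \<eta>_def
    by (intro adjoint_op_add[OF H0_l2] adjoint_op_cmult graph_in_adjoint \<psi>'T defect_adjoint pm)
  have "(\<psi>, \<eta>) \<in> adjoint_op m H0"
    by (rule adjoint_op_cong_AE[OF H0_l2 adj _ AE]) (use \<psi>_sums in \<open>auto simp: l2_sums_def\<close>)
  moreover have "am = - exp (\<i> * of_real \<Theta>) * ap"
    by (simp add: am_def ap_def u_def)
  ultimately have H: "(\<psi>, \<eta>) \<in> H"
    unfolding H_def H_Theta_def using dom AE by blast
  then show "\<psi> \<in> op_dom H" by (force simp: op_dom_def)

  \<comment> \<open>\<open>op_apply\<close> selects an unspecified image of \<psi>; uniqueness of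
    adjoint images identifies it with \<eta> almost everywhere, which is enough for the
    norm.\<close>
  have "(\<psi>, op_apply H \<psi>) \<in> H" unfolding op_apply_def by (rule someI[of "\<lambda>h. (\<psi>, h) \<in> H", OF H])
  then have adj': "(\<psi>, op_apply H \<psi>) \<in> adjoint_op m H0" by (auto simp: H_def H_Theta_def)
  have AE_op: "AE x in m. op_apply H \<psi> x = \<eta> x"
    by (rule adjoint_unique[OF adj' \<open>(\<psi>, \<eta>) \<in> adjoint_op m H0\<close>])
  have l2: "op_apply H \<psi> \<in> l2 m" "\<eta> \<in> l2 m" "\<psi> \<in> l2 m"
    using adjoint_opD[OF adj'] adjoint_opD[OF adj] by auto

  have "(\<lambda>x. - g' x) = (\<lambda>x. \<Sum>j\<in>J. (b j * of_real (E j)) * \<Phi> j x)"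
    by (simp add: g'_def fun_eq_iff sum_negf mult.assoc)
  then have "l2_sums m (\<lambda>j. (if j \<in> J then b j * of_real (E j) else 0)) \<Phi> (\<lambda>x. - g' x)"
    using l2_sums_finite[OF Phi.in_l2 finJ, of "\<lambda>j. b j * of_real (E j)"] by simp
  then have "l2_sums m (\<lambda>j. (if j \<in> J then b j * of_real (E j) else 0) +
        ap * (\<i> * (cnj (\<Phi> j p) / (of_real (E j) - \<i>))) +
        am * (- \<i> * (cnj (\<Phi> j p) / (of_real (E j) - - \<i>))) +
        - of_real \<mu> * (of_real (quasi_coeff \<kappa> \<sigma> I \<mu> j) * cnj (\<Phi> j p))) \<Phi>
      (\<lambda>x. \<eta> x + - of_real \<mu> * \<psi> x)"
    unfolding \<eta>_def by (intro l2_sums_intros defect_sums pm \<psi>_sums)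
  moreover have "(if j \<in> J then b j * of_real (E j) else 0) +
        ap * (\<i> * (cnj (\<Phi> j p) / (of_real (E j) - \<i>))) +
        am * (- \<i> * (cnj (\<Phi> j p) / (of_real (E j) - - \<i>))) +
        - of_real \<mu> * (of_real (quasi_coeff \<kappa> \<sigma> I \<mu> j) * cnj (\<Phi> j p)) =
      of_real (residual_coeff \<kappa> \<sigma> I \<mu> j) * cnj (\<Phi> j p)" for j
  proof -
    have s: "1 + (E j)\<^sup>2 \<noteq> 0" using add_pos_nonneg[of 1 "(E j)\<^sup>2"] by simp
    have "ap * (\<i> * (cnj (\<Phi> j p) / (of_real (E j) - \<i>))) +
        am * (- \<i> * (cnj (\<Phi> j p) / (of_real (E j) - - \<i>))) =
        of_real \<sigma> * (1 / (1 - u) * (\<i> / (of_real (E j) - \<i>)) + - u / (1 - u) * (- \<i> / (of_real (E j) + \<i>))) *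
          cnj (\<Phi> j p)"
      by (simp add: ap_def am_def algebra_simps)
    also have "\<dots> = of_real (\<sigma> * (- (\<kappa> * E j + 1) / (1 + (E j)\<^sup>2))) * cnj (\<Phi> j p)"
      unfolding defect_coefficient_identities(2)[OF u] by simp
    finally have defect_part: "ap * (\<i> * (cnj (\<Phi> j p) / (of_real (E j) - \<i>))) +
        am * (- \<i> * (cnj (\<Phi> j p) / (of_real (E j) - - \<i>))) =
        of_real (\<sigma> * (- (\<kappa> * E j + 1) / (1 + (E j)\<^sup>2))) * cnj (\<Phi> j p)" .
    have real: "(if j \<in> J then (1 / (E j - \<mu>) - \<sigma> * ((E j - \<kappa>) / (1 + (E j)\<^sup>2))) * E j else 0) +
        \<sigma> * (- (\<kappa> * E j + 1) / (1 + (E j)\<^sup>2)) - \<mu> * quasi_coeff \<kappa> \<sigma> I \<mu> j = residual_coeff \<kappa> \<sigma> I \<mu> j"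
    proof (cases "E j \<in> I")
      case True
      then have ne: "E j - \<mu> \<noteq> 0" using sec by (auto simp: secular_solution_def)
      have "1 / (E j - \<mu>) * E j - \<mu> * (1 / (E j - \<mu>)) = 1" using ne by (simp flip: diff_divide_distrib)
      moreover have "\<sigma> * ((E j - \<kappa>) / (1 + (E j)\<^sup>2)) * E j + \<sigma> * ((\<kappa> * E j + 1) / (1 + (E j)\<^sup>2)) = \<sigma>"
      proof -
        have "(E j - \<kappa>) / (1 + (E j)\<^sup>2) * E j + (\<kappa> * E j + 1) / (1 + (E j)\<^sup>2) =
            ((E j - \<kappa>) * E j + (\<kappa> * E j + 1)) / (1 + (E j)\<^sup>2)" by (simp add: add_divide_distrib)
        also have "(E j - \<kappa>) * E j + (\<kappa> * E j + 1) = 1 + (E j)\<^sup>2"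
          by (simp add: power2_eq_square algebra_simps)
        finally have "(E j - \<kappa>) / (1 + (E j)\<^sup>2) * E j + (\<kappa> * E j + 1) / (1 + (E j)\<^sup>2) = 1" using s by simp
        then show ?thesis by (metis distrib_left mult.assoc mult.right_neutral)
      qed
      moreover have "(1 / (E j - \<mu>) - \<sigma> * ((E j - \<kappa>) / (1 + (E j)\<^sup>2))) * E j =
          1 / (E j - \<mu>) * E j - \<sigma> * ((E j - \<kappa>) / (1 + (E j)\<^sup>2)) * E j"
        by (rule left_diff_distrib)
      moreover have "\<sigma> * (- (\<kappa> * E j + 1) / (1 + (E j)\<^sup>2)) = - (\<sigma> * ((\<kappa> * E j + 1) / (1 + (E j)\<^sup>2)))"
        by (simp only: minus_divide_left[symmetric] mult_minus_right)
      ultimately show ?thesis using True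
        unfolding quasi_coeff_def residual_coeff_def J_def mem_Collect_eq by simp
    next
      case False
      have "\<sigma> * (- (\<kappa> * E j + 1) / (1 + (E j)\<^sup>2)) - \<mu> * (\<sigma> * ((E j - \<kappa>) / (1 + (E j)\<^sup>2))) =
          \<sigma> * ((- (\<kappa> * E j + 1) - \<mu> * (E j - \<kappa>)) / (1 + (E j)\<^sup>2))"
        by (simp add: diff_divide_distrib right_diff_distrib mult.left_commute)
      also have "- (\<kappa> * E j + 1) - \<mu> * (E j - \<kappa>) = - ((\<kappa> + \<mu>) * E j + (1 - \<kappa> * \<mu>))"
        by (simp add: algebra_simps)
      also have "\<sigma> * (- ((\<kappa> + \<mu>) * E j + (1 - \<kappa> * \<mu>)) / (1 + (E j)\<^sup>2)) =
          - \<sigma> * (((\<kappa> + \<mu>) * E j + (1 - \<kappa> * \<mu>)) / (1 + (E j)\<^sup>2))"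
        by (simp only: minus_divide_left[symmetric] mult_minus_right mult_minus_left)
      finally show ?thesis
        unfolding quasi_coeff_def residual_coeff_def J_def mem_Collect_eq
        by (simp only: False if_False add_0_left)
    qed
    show ?thesis
      unfolding real[symmetric] add.assoc[of _ "ap * _"] defect_part
      by (simp add: b_def algebra_simps)
  qed
  ultimately have "l2_sums m (\<lambda>j. of_real (residual_coeff \<kappa> \<sigma> I \<mu> j) * cnj (\<Phi> j p)) \<Phi>
      (\<lambda>x. \<eta> x - of_real \<mu> * \<psi> x)" by simp
  from Phi.l2_sums_norm[OF this]
  have "(\<lambda>j. (residual_coeff \<kappa> \<sigma> I \<mu> j)\<^sup>2 * (cmod (\<Phi> j p))\<^sup>2) sums (l2_norm m (\<lambda>x. \<eta> x - of_real \<mu> * \<psi> x))\<^sup>2"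
    by (simp add: norm_mult power_mult_distrib)
  moreover have "l2_norm m (\<lambda>x. op_apply H \<psi> x - of_real \<mu> * \<psi> x) = l2_norm m (\<lambda>x. \<eta> x - of_real \<mu> * \<psi> x)"
    using l2 AE_op by (intro l2_norm_cong_AE l2_diff l2_cmult) auto
  ultimately show "(\<lambda>j. (residual_coeff \<kappa> \<sigma> I \<mu> j)\<^sup>2 * (cmod (\<Phi> j p))\<^sup>2) sums
      (l2_norm m (\<lambda>x. op_apply H \<psi> x - of_real \<mu> * \<psi> x))\<^sup>2" by simp
qed

end

section \<open>Interval length as Lebesgue measure\<close>

lemma bounded_interval_measurable:
  fixes I :: "real set"
  assumes "is_interval I" "bounded I"
  shows "I \<in> fmeasurable lborel"
proof -
  have "I \<in> sets borel"
  proof (cases "I = {}")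
    case False
    have bdd: "bdd_above I" "bdd_below I"
      using assms(2) by (auto intro: bounded_imp_bdd_above bounded_imp_bdd_below)
    have "{Inf I<..<Sup I} \<subseteq> I"
    proof
      fix x assume "x \<in> {Inf I<..<Sup I}"
      then obtain y z where "y \<in> I" "y < x" "z \<in> I" "x < z"
        using bdd False by (auto simp: cInf_less_iff less_cSup_iff)
      then show "x \<in> I" using assms(1) by (auto intro: mem_is_interval_1_I[of I y z])
    qed
    moreover have "I \<subseteq> {Inf I..Sup I}" using bdd by (auto intro: cInf_lower cSup_upper)
    \<comment> \<open>Treats open, closed and half-open intervals at once: only membership of the
      two end points is undecided.\<close>
    ultimately have "I = {Inf I<..<Sup I} \<union> (I \<inter> {Inf I, Sup I})" by fastforce
    moreover have "{Inf I<..<Sup I} \<union> (I \<inter> {Inf I, Sup I}) \<in> sets borel"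
      by (intro sets.Un) (auto intro: borel_closed finite_imp_closed)
    ultimately show ?thesis by simp
  qed simp
  then show ?thesis using emeasure_bounded_finite[OF assms(2)] by (simp add: fmeasurable_def)
qed

lemma diameter_le_length:
  fixes I :: "real set"
  assumes "is_interval I" "bounded I" "lo \<in> I" "hi \<in> I" "lo \<le> hi"
  shows "hi - lo \<le> measure lborel I"
proof -
  have "{lo..hi} \<subseteq> I" using mem_is_interval_1_I[OF assms(1,3,4)] by auto
  then have "measure lborel {lo..hi} \<le> measure lborel I"
    by (intro measure_mono_fmeasurable bounded_interval_measurable assms) auto
  then show ?thesis using assms(5) by simp
qed

section \<open>Discrepancy estimates\<close>

context point_perturbation
begin

text \<open>A single Parseval term suffices. The term j = 0 belongs to every interval [0,T] with T >
  E 0 and so gives a bound uniform in T.\<close>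

lemma quasimode_norm_lower:
  assumes "finite {j. E j \<in> I}" "secular_solution p \<Phi> E \<kappa> \<sigma> I \<mu>"
    and "0 < \<Theta>" "\<Theta> < 2 * pi" "\<kappa> = sin \<Theta> / (1 - cos \<Theta>)" and j: "E j \<in> I"
  shows "cmod (\<Phi> j p) / \<bar>E j - \<mu>\<bar> \<le> l2_norm m (quasimode_fun m p \<Phi> E \<kappa> \<sigma> I \<mu>)"
proof (rule power2_le_imp_le)
  let ?f = "\<lambda>j. (quasi_coeff \<kappa> \<sigma> I \<mu> j)\<^sup>2 * (cmod (\<Phi> j p))\<^sup>2"
  note sums = quasimode_norms(2)[OF assms(1-5)]
  have "sum ?f {j} \<le> (\<Sum>j. ?f j)"
    using sums_summable[OF sums] by (intro sum_le_suminf) auto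
  also have "(\<Sum>j. ?f j) = (l2_norm m (quasimode_fun m p \<Phi> E \<kappa> \<sigma> I \<mu>))\<^sup>2"
    using sums_unique[OF sums] by simp
  finally show "(cmod (\<Phi> j p) / \<bar>E j - \<mu>\<bar>)\<^sup>2 \<le> (l2_norm m (quasimode_fun m p \<Phi> E \<kappa> \<sigma> I \<mu>))\<^sup>2"
    using j by (simp add: quasi_coeff_def power_divide)
qed simp

lemma quasimode_norm_nonzero:
  assumes "finite {j. E j \<in> I}" "secular_solution p \<Phi> E \<kappa> \<sigma> I \<mu>"
    and "0 < \<Theta>" "\<Theta> < 2 * pi" "\<kappa> = sin \<Theta> / (1 - cos \<Theta>)" and j: "E j \<in> I"
  shows "0 < l2_norm m (quasimode_fun m p \<Phi> E \<kappa> \<sigma> I \<mu>)"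
proof -
  have "E j \<noteq> \<mu>" using assms(2) j by (auto simp: secular_solution_def)
  then have "0 < cmod (\<Phi> j p) / \<bar>E j - \<mu>\<bar>" using \<Phi>_p_nonzero[of j] by simp
  then show ?thesis using quasimode_norm_lower[OF assms] by linarith
qed

text \<open>For \<sigma> = 0 the residual factors are 1 on I and 0 elsewhere, so both squared norms
  are finite sums and their quotient is the one estimated by
  \<open>mean_zero_reciprocal_variance\<close>.\<close>

lemma discrepancy_truncated:
  assumes I: "is_interval I" "bounded I" and ex: "E j0 \<in> I"
    and sec: "secular_solution p \<Phi> E \<kappa> 0 I \<mu>"
    and \<Theta>: "0 < \<Theta>" "\<Theta> < 2 * pi" "\<kappa> = sin \<Theta> / (1 - cos \<Theta>)"
  shows "discrepancy m (H_Theta m p T \<Phi> E \<Theta>) (quasimode_fun m p \<Phi> E \<kappa> 0 I \<mu>) \<mu> \<le> 1 / 2 * measure lborel I"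
proof -
  let ?\<psi> = "quasimode_fun m p \<Phi> E \<kappa> 0 I \<mu>"
  define J where "J = {j. E j \<in> I}"
  define a where "a j = (cmod (\<Phi> j p))\<^sup>2" for j
  define \<rho> where "\<rho> = l2_norm m (\<lambda>x. op_apply (H_Theta m p T \<Phi> E \<Theta>) ?\<psi> x - of_real \<mu> * ?\<psi> x)"
  have fin: "finite J" unfolding J_def by (rule finite_bounded_E[OF I(2)])
  have J: "J \<noteq> {}" using ex by (auto simp: J_def)
  note norms = quasimode_norms[OF fin[unfolded J_def] sec \<Theta>]
  have q: "(\<lambda>j. (quasi_coeff \<kappa> 0 I \<mu> j)\<^sup>2 * (cmod (\<Phi> j p))\<^sup>2) = (\<lambda>j. if j \<in> J then a j / (E j - \<mu>)\<^sup>2 else 0)"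
    by (auto simp: quasi_coeff_def J_def a_def power_divide)
  have norm\<psi>: "(l2_norm m ?\<psi>)\<^sup>2 = (\<Sum>j\<in>J. a j / (E j - \<mu>)\<^sup>2)"
    by (rule sums_unique2[OF norms(2)[unfolded q] sums_If_finite_set[OF fin]])
  have res: "(\<lambda>j. (residual_coeff \<kappa> 0 I \<mu> j)\<^sup>2 * (cmod (\<Phi> j p))\<^sup>2) = (\<lambda>j. if j \<in> J then a j else 0)"
    by (auto simp: residual_coeff_def J_def a_def)
  have norm\<rho>: "\<rho>\<^sup>2 = (\<Sum>j\<in>J. a j)"
    unfolding \<rho>_def by (rule sums_unique2[OF norms(3)[unfolded res] sums_If_finite_set[OF fin]])
  let ?D = "Max (E ` J) - Min (E ` J)"
  have ne: "E j \<noteq> \<mu>" if "j \<in> J" for j using sec that by (auto simp: secular_solution_def J_def)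
  have zero: "(\<Sum>j\<in>J. a j / (E j - \<mu>)) = 0" using sec by (simp add: secular_solution_def J_def a_def)
  have "Max (E ` J) \<in> E ` J" "Min (E ` J) \<in> E ` J" using fin J by (auto intro!: Max_in Min_in)
  then have mem: "Max (E ` J) \<in> I" "Min (E ` J) \<in> I" by (auto simp: J_def)
  have le: "Min (E ` J) \<le> Max (E ` J)" using fin J by (auto intro: order_trans[OF Min_le Max_ge])
  have "\<rho>\<^sup>2 \<le> (?D / 2)\<^sup>2 * (l2_norm m ?\<psi>)\<^sup>2"
    unfolding norm\<rho> norm\<psi>
    using mean_zero_reciprocal_variance[OF fin J _ ne zero] \<Phi>_p_nonzero by (simp add: a_def)
  also have "\<dots> = (?D / 2 * l2_norm m ?\<psi>)\<^sup>2" by (rule power_mult_distrib[symmetric])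
  finally have "\<rho> \<le> ?D / 2 * l2_norm m ?\<psi>"
    by (rule power2_le_imp_le) (use le in simp)
  moreover have "0 < l2_norm m ?\<psi>"
    by (rule quasimode_norm_nonzero[OF fin[unfolded J_def] sec \<Theta> ex])
  ultimately have "\<rho> / l2_norm m ?\<psi> \<le> ?D / 2" by (simp add: pos_divide_le_eq)
  moreover have "?D \<le> measure lborel I" by (rule diameter_le_length[OF I mem(2,1) le])
  ultimately show ?thesis by (simp add: discrepancy_def \<rho>_def)
qed

text \<open>For \<sigma> = 1 the residual vanishes on [0,t], leaving a tail of \<open>w\<close>,
  whose square root is of order 1/sqrt t. The cap B on \<mu> serves twice: the residual factors grow
  with \<mu>, and the lower bound for the norm of \<psi> deteriorates with it.\<close>

lemma discrepancy_full:
  assumes \<Theta>: "0 < \<Theta>" "\<Theta> < 2 * pi" "\<kappa> = sin \<Theta> / (1 - cos \<Theta>)"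
  shows "\<exists>C>0. \<forall>t \<mu>. E 0 < t \<and> 0 < \<mu> \<and> \<mu> \<le> B \<and> secular_solution p \<Phi> E \<kappa> 1 {0..t} \<mu> \<longrightarrow>
    discrepancy m (H_Theta m p T \<Phi> E \<Theta>) (quasimode_fun m p \<Phi> E \<kappa> 1 {0..t} \<mu>) \<mu> \<le> C * (\<mu> / sqrt t)"
proof -
  obtain K where K: "0 < K" "\<And>t. t > 0 \<Longrightarrow> (\<Sum>j. if E j \<le> t then 0 else w j) \<le> K / t"
    using w_tail by blast
  obtain c where c: "0 < c"
    "\<And>n \<mu>. 0 < n \<Longrightarrow> 0 < \<mu> \<Longrightarrow> (\<Sum>j<n. (cmod (\<Phi> j p))\<^sup>2 / (E j - \<mu>)) =
      (\<Sum>j<n. (E j - \<kappa>) * (cmod (\<Phi> j p))\<^sup>2 / (1 + (E j)\<^sup>2)) \<Longrightarrow> c \<le> \<mu>"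
    using positive_root_lower_bound[of \<kappa>] by blast
  \<comment> \<open>Bounds the squared numerator of a residual factor divided by 1 + E_j^2, with
    \<mu> replaced by its cap.\<close>
  define L where "L = (1 + \<kappa>\<^sup>2) * (1 + B\<^sup>2)"
  have L: "L > 0" unfolding L_def by (intro mult_pos_pos add_pos_nonneg) auto
  \<comment> \<open>Lower bound for the Parseval term of index 0; the summand 1 keeps the
    denominator positive.\<close>
  define b where "b = cmod (\<Phi> 0 p) / (E 0 + \<bar>B\<bar> + 1)"
  have E0: "E 0 \<ge> 0" by (rule E_nonneg)
  have b: "b > 0" using \<Phi>_p_nonzero[of 0] E0 by (simp add: b_def)
  \<comment> \<open>The factor 1/c converts a constant numerator into a multiple of \<mu>, since c
    \<le> \<mu>.\<close>
  define C where "C = sqrt (L * K) / (b * c)"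
  have "C > 0" using L K c b by (simp add: C_def)
  moreover have "discrepancy m (H_Theta m p T \<Phi> E \<Theta>) (quasimode_fun m p \<Phi> E \<kappa> 1 {0..t} \<mu>) \<mu> \<le> C * (\<mu> / sqrt t)"
    if t: "E 0 < t" and \<mu>: "0 < \<mu>" "\<mu> \<le> B" and sec: "secular_solution p \<Phi> E \<kappa> 1 {0..t} \<mu>" for t \<mu>
  proof -
    let ?\<psi> = "quasimode_fun m p \<Phi> E \<kappa> 1 {0..t} \<mu>"
    define \<rho> where "\<rho> = l2_norm m (\<lambda>x. op_apply (H_Theta m p T \<Phi> E \<Theta>) ?\<psi> x - of_real \<mu> * ?\<psi> x)"
    have "t > 0" using t E0 by linarith
    obtain n where n: "0 < n" "{j. E j \<in> {0..t}} = {..<n}" by (rule initial_segment[OF t])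
    have fin: "finite {j. E j \<in> {0..t}}" unfolding n(2) by simp
    note norms = quasimode_norms[OF fin sec \<Theta>]
    have "c \<le> \<mu>"
      using sec unfolding secular_solution_def n(2) by (intro c(2)[OF n(1) \<mu>(1)]) simp
    have "b \<le> l2_norm m ?\<psi>"
    proof -
      have "E 0 \<noteq> \<mu>" using sec t E0 by (auto simp: secular_solution_def)
      then have "b \<le> cmod (\<Phi> 0 p) / \<bar>E 0 - \<mu>\<bar>"
        unfolding b_def using E0 \<mu> by (intro divide_left_mono mult_pos_pos) auto
      also have "\<dots> \<le> l2_norm m ?\<psi>"
        using t E0 by (intro quasimode_norm_lower[OF fin sec \<Theta>]) simp
      finally show ?thesis .
    qed
    have "\<rho>\<^sup>2 \<le> L * (K / t)"
    proof -
      have sm: "summable (\<lambda>j. if E j \<le> t then 0 else w j)"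
        by (rule summable_comparison_test'[OF w_summable, of 0]) (simp add: w_pos less_imp_le)
      have "\<rho>\<^sup>2 = (\<Sum>j. (residual_coeff \<kappa> 1 {0..t} \<mu> j)\<^sup>2 * (cmod (\<Phi> j p))\<^sup>2)"
        unfolding \<rho>_def using norms(3) by (rule sums_unique)
      also have "\<dots> \<le> (\<Sum>j. L * (if E j \<le> t then 0 else w j))"
      proof (rule suminf_le)
        show "summable (\<lambda>j. (residual_coeff \<kappa> 1 {0..t} \<mu> j)\<^sup>2 * (cmod (\<Phi> j p))\<^sup>2)"
          using norms(3) by (rule sums_summable)
        show "summable (\<lambda>j. L * (if E j \<le> t then 0 else w j))" using sm by (rule summable_mult)
        fix j
        show "(residual_coeff \<kappa> 1 {0..t} \<mu> j)\<^sup>2 * (cmod (\<Phi> j p))\<^sup>2 \<le> L * (if E j \<le> t then 0 else w j)"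
        proof (cases "E j \<le> t")
          case True
          then show ?thesis using E_nonneg[of j] by (simp add: residual_coeff_def)
        next
          case False
          let ?s = "1 + (E j)\<^sup>2" and ?n = "(\<kappa> + \<mu>) * E j + (1 - \<kappa> * \<mu>)"
          have s: "?s > 0" by (simp add: add_pos_nonneg)
          \<comment> \<open>Cauchy-Schwarz for (\<kappa> + \<mu>, 1 - \<kappa> \<mu>) and (E_j, 1);
            the first vector has squared length (1 + \<kappa>^2)(1 + \<mu>^2).\<close>
          have "?n\<^sup>2 \<le> (1 + \<kappa>\<^sup>2) * (1 + \<mu>\<^sup>2) * ?s"
            using zero_le_power2[of "(\<kappa> + \<mu>) - (1 - \<kappa> * \<mu>) * E j"]
            by (simp add: power2_eq_square algebra_simps)
          also have "\<dots> \<le> L * ?s"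
            unfolding L_def using \<mu> by (intro mult_right_mono mult_left_mono add_left_mono power_mono) auto
          finally have n: "?n\<^sup>2 \<le> L * ?s" .
          have coeff: "residual_coeff \<kappa> 1 {0..t} \<mu> j = - (?n / ?s)"
          proof -
            have "E j \<notin> {0..t}" using False by simp
            then show ?thesis unfolding residual_coeff_def
              by (simp only: if_False mult_minus_left mult_1_left)
          qed
          have "(- (x / s))\<^sup>2 * y = x\<^sup>2 / s * (y / s)" for x s y :: real
            by (simp add: power_divide power2_eq_square)
          then have "(residual_coeff \<kappa> 1 {0..t} \<mu> j)\<^sup>2 * (cmod (\<Phi> j p))\<^sup>2 = ?n\<^sup>2 / ?s * w j"
            unfolding coeff w_def .
          also have "\<dots> \<le> L * w j"
            using n s w_pos[of j] by (intro mult_right_mono) (auto simp: pos_divide_le_eq)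
          finally show ?thesis using False by simp
        qed
      qed
      also have "\<dots> = L * (\<Sum>j. if E j \<le> t then 0 else w j)" using sm by (rule suminf_mult)
      also have "\<dots> \<le> L * (K / t)" using L K(2)[OF \<open>t > 0\<close>] by (intro mult_left_mono) auto
      finally show ?thesis .
    qed
    then have "sqrt (\<rho>\<^sup>2) \<le> sqrt (L * (K / t))" by (rule real_sqrt_le_mono)
    moreover have "\<rho> \<ge> 0" by (simp add: \<rho>_def)
    ultimately have "\<rho> \<le> sqrt (L * K) / sqrt t" by (simp add: real_sqrt_divide)
    then have "\<rho> / l2_norm m ?\<psi> \<le> (sqrt (L * K) / sqrt t) / b"
      using \<open>b \<le> l2_norm m ?\<psi>\<close> b \<open>\<rho> \<ge> 0\<close> by (intro frac_le) auto
    also have "\<dots> = C * (c / sqrt t)" using c b by (simp add: C_def)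
    also have "\<dots> \<le> C * (\<mu> / sqrt t)"
      using \<open>C > 0\<close> \<open>c \<le> \<mu>\<close> \<open>t > 0\<close> by (intro mult_left_mono divide_right_mono) auto
    finally show ?thesis by (simp add: discrepancy_def \<rho>_def)
  qed
  ultimately show ?thesis by blast
qed

end

text \<open>The first conjunct makes the discrepancies meaningful: \<psi> has an image under
  H_\<Theta>, and its norm is not the zero for which division would return a default value. In (1)
  the constant is uniform in T and in all roots 0 < \<mu> \<le> B.\<close>

theorem corollary1p2:
  fixes \<A> :: "'a::{t2_space,second_countable_topology} chart set"
    and G :: "'a chart \<Rightarrow> real^2 \<Rightarrow> real^2^2"
    and vol m :: "'a measure"
    and M :: "'a set"
    and p :: 'a
    and \<Delta> :: "'a l2_op"
    and e \<Phi> :: "nat \<Rightarrow> 'a \<Rightarrow> complex"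
    and ev E :: "nat \<Rightarrow> real"
    and \<Theta> \<kappa> :: real
  assumes "smooth_atlas \<A>" and "riemannian_metric \<A> G" and "riemannian_volume \<A> G vol"
    and "compact_surface_pw_smooth \<A> M" and "p \<in> M"
    and "m = restrict_space vol M"
    and "self_adjoint_laplacian \<A> G m \<Delta>" and "nonpositive_op m \<Delta>"
    and "domain_evaluable_at m p \<Delta>"
    and "eigenbasis m p \<Delta> e ev" and "lists_nonvanishing p e ev \<Phi> E"
    and "weyl_law p \<Phi> E"
    and "0 < \<Theta>" and "\<Theta> < 2 * pi" and "\<kappa> = sin \<Theta> / (1 - cos \<Theta>)"
  shows
    "(\<forall>\<sigma> I \<mu>. 0 \<le> \<sigma> \<and> \<sigma> \<le> 1 \<and> is_interval I \<and> bounded I \<and> (\<exists>j. E j \<in> I) \<and>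
         secular_solution p \<Phi> E \<kappa> \<sigma> I \<mu> \<longrightarrow>
       quasimode_fun m p \<Phi> E \<kappa> \<sigma> I \<mu> \<in> op_dom (H_Theta m p \<Delta> \<Phi> E \<Theta>) \<and>
       l2_norm m (quasimode_fun m p \<Phi> E \<kappa> \<sigma> I \<mu>) \<noteq> 0) \<and>
     (\<forall>B. \<exists>C>0. \<forall>T \<mu>. E 0 < T \<and> 0 < \<mu> \<and> \<mu> \<le> B \<and> secular_solution p \<Phi> E \<kappa> 1 {0..T} \<mu> \<longrightarrow>
       discrepancy m (H_Theta m p \<Delta> \<Phi> E \<Theta>) (quasimode_fun m p \<Phi> E \<kappa> 1 {0..T} \<mu>) \<mu>
         \<le> C * (\<mu> / sqrt T)) \<and>
     (\<forall>I \<mu>. is_interval I \<and> bounded I \<and> 2 \<le> card {j. E j \<in> I} \<and>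
         secular_solution p \<Phi> E \<kappa> 0 I \<mu> \<and> \<mu> \<in> I \<longrightarrow>
       discrepancy m (H_Theta m p \<Delta> \<Phi> E \<Theta>) (quasimode_fun m p \<Phi> E \<kappa> 0 I \<mu>) \<mu>
         \<le> 1 / sqrt 2 * measure lborel I) \<and>
     (\<forall>I \<mu>. is_interval I \<and> bounded I \<and> card {j. E j \<in> I} = 2 \<and>
         secular_solution p \<Phi> E \<kappa> 0 I \<mu> \<and> \<mu> \<in> I \<longrightarrow>
       discrepancy m (H_Theta m p \<Delta> \<Phi> E \<Theta>) (quasimode_fun m p \<Phi> E \<kappa> 0 I \<mu>) \<mu>
         \<le> 1 / 2 * measure lborel I)"
proof -
  have adjoint: "adjoint_op m \<Delta> = \<Delta>"
    using assms(7) by (simp add: self_adjoint_laplacian_def self_adjoint_def)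
  have eigen: "(e n, \<lambda>x. - (of_real (ev n) * e n x)) \<in> \<Delta>"
    and cont: "continuous (at p within space m) (e n)"
    and orth: "l2_inner m (e n) (e k) = (if n = k then 1 else 0)"
    and expansion: "f \<in> l2 m \<Longrightarrow> l2_sums m (\<lambda>n. l2_inner m f (e n)) e f" for n k f
    using assms(10) by (auto simp: eigenbasis_def)
  obtain r where mono: "strict_mono E" and r: "bij_betw r UNIV {n. e n p \<noteq> 0}"
    and \<Phi>E: "\<And>j. \<Phi> j = e (r j)" "\<And>j. E j = ev (r j)"
    using assms(11) unfolding lists_nonvanishing_def by blast
  have nonzero: "e (r j) p \<noteq> 0" for j using r by (auto simp: bij_betw_def)
  interpret graph: self_adjoint_graph m \<Delta> by standard (rule adjoint)
  \<comment> \<open>Nonpositivity of \<Delta> tested on the unit vector \<open>e n\<close>.\<close>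
  have ev: "0 \<le> ev n" for n
  proof -
    have "Re (l2_inner m (\<lambda>x. - (of_real (ev n) * e n x)) (e n)) \<le> 0"
      using assms(8) eigen[of n] unfolding nonpositive_op_def by blast
    then show ?thesis by (simp add: orth)
  qed
  interpret point_perturbation m e \<Delta> ev p \<Phi> E r
  proof
    show "e n \<in> l2 m" for n using graph.graph_l2(1)[OF eigen] .
    show "U \<inter> space m \<in> sets m \<and> emeasure m (U \<inter> space m) \<noteq> 0" if "open U" "p \<in> U" for U
      using surface_measure_pos[OF assms(1-6) that] by simp
    show "\<exists>n. e n p \<noteq> 0" using nonzero by blast
    show "0 < (cmod (\<Phi> j p))\<^sup>2" for j using nonzero[of j] by (simp add: \<Phi>E)
    show "finite {j. E j \<le> x}" for x using assms(12) by (simp add: weyl_law_def)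
    show "(\<lambda>x. (\<Sum>j | E j \<le> x. (cmod (\<Phi> j p))\<^sup>2) - x / (4 * pi)) \<in> O(\<lambda>x. sqrt x)"
      using assms(12) by (simp add: weyl_law_def)
  qed (use orth expansion adjoint eigen cont assms(9) mono ev r \<Phi>E in auto)
  note \<Theta> = assms(13-15)
  \<comment> \<open>Passes from half the length to the constant of (2).\<close>
  have half: "1 / 2 * measure lborel I \<le> 1 / sqrt 2 * measure lborel I" for I :: "real set"
  proof (rule mult_right_mono)
    have "sqrt 2 \<le> 2" by (rule real_le_lsqrt) auto
    then show "1 / 2 \<le> 1 / sqrt 2" by (intro divide_left_mono) auto
  qed simp
  have truncated: "discrepancy m (H_Theta m p \<Delta> \<Phi> E \<Theta>) (quasimode_fun m p \<Phi> E \<kappa> 0 I \<mu>) \<mu>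
      \<le> 1 / 2 * measure lborel I"
    if "is_interval I" "bounded I" "2 \<le> card {j. E j \<in> I}" "secular_solution p \<Phi> E \<kappa> 0 I \<mu>" for I \<mu>
  proof -
    have "{j. E j \<in> I} \<noteq> {}" using that(3) by (metis card.empty not_numeral_le_zero)
    then obtain j where "E j \<in> I" by blast
    then show ?thesis using discrepancy_truncated[OF that(1,2) _ that(4) \<Theta>] by blast
  qed
  show ?thesis
  proof (intro conjI allI impI; (elim conjE exE)?)
    fix \<sigma> I \<mu> j
    assume "bounded I" "E j \<in> I" and sec: "secular_solution p \<Phi> E \<kappa> \<sigma> I \<mu>"
    note fin = finite_bounded_E[OF \<open>bounded I\<close>]
    show "quasimode_fun m p \<Phi> E \<kappa> \<sigma> I \<mu> \<in> op_dom (H_Theta m p \<Delta> \<Phi> E \<Theta>)"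
      by (rule quasimode_norms(1)[OF fin sec \<Theta>])
    show "l2_norm m (quasimode_fun m p \<Phi> E \<kappa> \<sigma> I \<mu>) \<noteq> 0"
      using quasimode_norm_nonzero[OF fin sec \<Theta> \<open>E j \<in> I\<close>] by simp
  next
    fix B
    show "\<exists>C>0. \<forall>T \<mu>. E 0 < T \<and> 0 < \<mu> \<and> \<mu> \<le> B \<and> secular_solution p \<Phi> E \<kappa> 1 {0..T} \<mu> \<longrightarrow>
        discrepancy m (H_Theta m p \<Delta> \<Phi> E \<Theta>) (quasimode_fun m p \<Phi> E \<kappa> 1 {0..T} \<mu>) \<mu> \<le> C * (\<mu> / sqrt T)"
      by (rule discrepancy_full[OF \<Theta>])
  next
    fix I \<mu>
    assume "is_interval I" "bounded I" "2 \<le> card {j. E j \<in> I}" "secular_solution p \<Phi> E \<kappa> 0 I \<mu>"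
    then show "discrepancy m (H_Theta m p \<Delta> \<Phi> E \<Theta>) (quasimode_fun m p \<Phi> E \<kappa> 0 I \<mu>) \<mu>
        \<le> 1 / sqrt 2 * measure lborel I"
      using order_trans[OF truncated half] by blast
  next
    fix I \<mu>
    assume "is_interval I" "bounded I" "card {j. E j \<in> I} = 2" "secular_solution p \<Phi> E \<kappa> 0 I \<mu>"
    then show "discrepancy m (H_Theta m p \<Delta> \<Phi> E \<Theta>) (quasimode_fun m p \<Phi> E \<kappa> 0 I \<mu>) \<mu>
        \<le> 1 / 2 * measure lborel I"
      using truncated by simp
  qed
qed

end
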